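(* Let $\mathcal{C}$ be a ribbon fusion category over an algebraically closed field of characteristic zero. Then $\mathcal{C}$ contains a simple transparent object with non-trivial twist if and only if one, or equivalently both, of the Gauss sums $$\tau_{\mathcal{C}}^{\pm}:=\sum_{X_i\in\mathrm{Irr}(\mathcal{C})}\theta_i^{\pm1}\dim(X_i)^2$$ are zero.
   Context: A ribbon fusion category over $k$ is a $k$-linear finite semisimple rigid monoidal category with simple unit $I$ and finite-dimensional Hom-spaces, equipped with a braiding $c_{x,y}:x\otimes y\to y\otimes x$ and a compatible ribbon twist (natural automorphism $\theta$ of the identity functor with $\theta_{x\otimes y}=c_{y,x}c_{x,y}(\theta_x\otimes\theta_y)$ and $\theta_{x^*}=(\theta_x)^*$). $\mathrm{Irr}(\mathcal{C})$ is a set of representatives of the isomorphism classes of simple objects $X_i$; $\theta_i\in k^\times$ is the scalar by which the twist acts on $X_i$ (it is non-trivial if $\theta_i\ne1$); $\dim(X)\in k$ is the quantum dimension, i.e. the evaluation of the $0$-framed unknot labelled by $X$. An object $x$ is transparent if $c_{y,x}\circ c_{x,y}=\mathrm{id}_{x\otimes y}$ for all objects $y$ of $\mathcal{C}$. *)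

theory Defs
  imports "HOL-Computational_Algebra.Computational_Algebra"
begin

section \<open>Linear categories\<close>

text \<open>
  The objects of a category are the elements of the type \<open>'o\<close>. All Hom-spaces of a
  \<open>k\<close>-linear category are subspaces of one ambient \<open>k\<close>-vector space of arrows \<open>'m\<close>; they need
  not be disjoint (they share the zero vector), so every notion that depends on domain or
  codomain takes them as arguments. No generality is lost: take for \<open>'m\<close> the direct sum of all
  Hom-spaces and extend composition (and, below, the tensor product of arrows) bilinearly, by
  zero on non-composable pairs. The operations are constrained on Hom-spaces only.
\<close>

record ('o, 'm, 'k) linear_cat =
  Hom :: "'o \<Rightarrow> 'o \<Rightarrow> 'm set"
  ident :: "'o \<Rightarrow> 'm"
  compose :: "'m \<Rightarrow> 'm \<Rightarrow> 'm" (infixr "\<cdot>\<index>" 72)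
  smult :: "'k \<Rightarrow> 'm \<Rightarrow> 'm"

locale linear_category = vector_space "smult C"
  for C :: "('o, 'm::ab_group_add, 'k::field, 'z) linear_cat_scheme" (structure) +
  assumes subspace_Hom: "subspace (Hom C x y)"
    and ident_in_Hom: "ident C x \<in> Hom C x x"
    and compose_in_Hom: "\<lbrakk>g \<in> Hom C y z; f \<in> Hom C x y\<rbrakk> \<Longrightarrow> g \<cdot> f \<in> Hom C x z"
    and ident_left: "f \<in> Hom C x y \<Longrightarrow> ident C y \<cdot> f = f"
    and ident_right: "f \<in> Hom C x y \<Longrightarrow> f \<cdot> ident C x = f"
    and compose_assoc:
      "\<lbrakk>h \<in> Hom C y z; g \<in> Hom C x y; f \<in> Hom C w x\<rbrakk> \<Longrightarrow> (h \<cdot> g) \<cdot> f = h \<cdot> (g \<cdot> f)"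
    and compose_add_left:
      "\<lbrakk>g \<in> Hom C y z; g' \<in> Hom C y z; f \<in> Hom C x y\<rbrakk> \<Longrightarrow> (g + g') \<cdot> f = g \<cdot> f + g' \<cdot> f"
    and compose_add_right:
      "\<lbrakk>g \<in> Hom C y z; f \<in> Hom C x y; f' \<in> Hom C x y\<rbrakk> \<Longrightarrow> g \<cdot> (f + f') = g \<cdot> f + g \<cdot> f'"
    and compose_smult_left:
      "\<lbrakk>g \<in> Hom C y z; f \<in> Hom C x y\<rbrakk> \<Longrightarrow> smult C a g \<cdot> f = smult C a (g \<cdot> f)"
    and compose_smult_right:
      "\<lbrakk>g \<in> Hom C y z; f \<in> Hom C x y\<rbrakk> \<Longrightarrow> g \<cdot> smult C a f = smult C a (g \<cdot> f)"

text \<open>In the following definitions the object arguments \<open>x y\<close> are the domain and codomain of \<open>f\<close>.\<close>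

definition inverse_arrows ::
  "('o, 'm, 'k, 'z) linear_cat_scheme \<Rightarrow> 'o \<Rightarrow> 'o \<Rightarrow> 'm \<Rightarrow> 'm \<Rightarrow> bool" where
  "inverse_arrows C x y f g \<longleftrightarrow> f \<in> Hom C x y \<and> g \<in> Hom C y x \<and>
     compose C g f = ident C x \<and> compose C f g = ident C y"

definition iso_arrow :: "('o, 'm, 'k, 'z) linear_cat_scheme \<Rightarrow> 'o \<Rightarrow> 'o \<Rightarrow> 'm \<Rightarrow> bool" where
  "iso_arrow C x y f \<longleftrightarrow> (\<exists>g. inverse_arrows C x y f g)"

definition inv_arrow :: "('o, 'm, 'k, 'z) linear_cat_scheme \<Rightarrow> 'o \<Rightarrow> 'o \<Rightarrow> 'm \<Rightarrow> 'm" where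
  "inv_arrow C x y f = (THE g. inverse_arrows C x y f g)"

definition isomorphic :: "('o, 'm, 'k, 'z) linear_cat_scheme \<Rightarrow> 'o \<Rightarrow> 'o \<Rightarrow> bool" where
  "isomorphic C x y \<longleftrightarrow> (\<exists>f. iso_arrow C x y f)"

definition mono_arrow :: "('o, 'm, 'k, 'z) linear_cat_scheme \<Rightarrow> 'o \<Rightarrow> 'o \<Rightarrow> 'm \<Rightarrow> bool" where
  "mono_arrow C x y f \<longleftrightarrow> f \<in> Hom C x y \<and>
     (\<forall>w. \<forall>g \<in> Hom C w x. \<forall>h \<in> Hom C w x. compose C f g = compose C f h \<longrightarrow> g = h)"

definition epi_arrow :: "('o, 'm, 'k, 'z) linear_cat_scheme \<Rightarrow> 'o \<Rightarrow> 'o \<Rightarrow> 'm \<Rightarrow> bool" where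
  "epi_arrow C x y f \<longleftrightarrow> f \<in> Hom C x y \<and>
     (\<forall>z. \<forall>g \<in> Hom C y z. \<forall>h \<in> Hom C y z. compose C g f = compose C h f \<longrightarrow> g = h)"

definition zero_object :: "('o, 'm::zero, 'k, 'z) linear_cat_scheme \<Rightarrow> 'o \<Rightarrow> bool" where
  "zero_object C x \<longleftrightarrow> (\<forall>y. Hom C x y = {0} \<and> Hom C y x = {0})"

definition is_kernel ::
  "('o, 'm::zero, 'k, 'z) linear_cat_scheme \<Rightarrow> 'o \<Rightarrow> 'o \<Rightarrow> 'm \<Rightarrow> 'o \<Rightarrow> 'm \<Rightarrow> bool" where
  "is_kernel C x y f k i \<longleftrightarrow> i \<in> Hom C k x \<and> compose C f i = 0 \<and>
     (\<forall>w. \<forall>g \<in> Hom C w x. compose C f g = 0 \<longrightarrow> (\<exists>!h. h \<in> Hom C w k \<and> compose C i h = g))"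

definition is_cokernel ::
  "('o, 'm::zero, 'k, 'z) linear_cat_scheme \<Rightarrow> 'o \<Rightarrow> 'o \<Rightarrow> 'm \<Rightarrow> 'o \<Rightarrow> 'm \<Rightarrow> bool" where
  "is_cokernel C x y f q p \<longleftrightarrow> p \<in> Hom C y q \<and> compose C p f = 0 \<and>
     (\<forall>z. \<forall>g \<in> Hom C y z. compose C g f = 0 \<longrightarrow> (\<exists>!h. h \<in> Hom C q z \<and> compose C h p = g))"

text \<open>\<open>z\<close> is the direct sum of the finite family \<open>S j\<close> for \<open>j < n\<close>.\<close>

definition is_direct_sum ::
  "('o, 'm::comm_monoid_add, 'k, 'z) linear_cat_scheme \<Rightarrow> 'o \<Rightarrow> nat \<Rightarrow> (nat \<Rightarrow> 'o) \<Rightarrow> bool" where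
  "is_direct_sum C z n S \<longleftrightarrow> (\<exists>i p.
     (\<forall>j<n. i j \<in> Hom C (S j) z \<and> p j \<in> Hom C z (S j)) \<and>
     (\<forall>j<n. \<forall>l<n. compose C (p j) (i l) = (if j = l then ident C (S j) else 0)) \<and>
     (\<Sum>j<n. compose C (i j) (p j)) = ident C z)"

locale abelian_linear_category = linear_category C
  for C :: "('o, 'm::ab_group_add, 'k::field, 'z) linear_cat_scheme" (structure) +
  assumes finite_direct_sums: "\<exists>z. is_direct_sum C z n S"
    and has_kernels: "f \<in> Hom C x y \<Longrightarrow> \<exists>k i. is_kernel C x y f k i"
    and has_cokernels: "f \<in> Hom C x y \<Longrightarrow> \<exists>q p. is_cokernel C x y f q p"
    and mono_is_kernel: "mono_arrow C x y f \<Longrightarrow> \<exists>z g. g \<in> Hom C y z \<and> is_kernel C y z g x f"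
    and epi_is_cokernel: "epi_arrow C x y f \<Longrightarrow> \<exists>w g. g \<in> Hom C w x \<and> is_cokernel C w x g y f"

definition simple_object :: "('o, 'm::zero, 'k, 'z) linear_cat_scheme \<Rightarrow> 'o \<Rightarrow> bool" where
  "simple_object C x \<longleftrightarrow> \<not> zero_object C x \<and>
     (\<forall>y f. mono_arrow C y x f \<longrightarrow> zero_object C y \<or> iso_arrow C y x f)"

locale finite_semisimple_category = abelian_linear_category C
  for C :: "('o, 'm::ab_group_add, 'k::field, 'z) linear_cat_scheme" (structure) +
  assumes semisimple: "\<exists>n S. (\<forall>j<n. simple_object C (S j)) \<and> is_direct_sum C x n S"
    and finitely_many_simples:
      "\<exists>F. finite F \<and> (\<forall>x. simple_object C x \<longrightarrow> (\<exists>y\<in>F. isomorphic C x y))"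
    and Hom_finite_dimensional: "\<exists>B. finite B \<and> Hom C x y \<subseteq> span B"

text \<open>Representatives of the isomorphism classes of simple objects.\<close>

definition is_Irr :: "('o, 'm::zero, 'k, 'z) linear_cat_scheme \<Rightarrow> 'o set \<Rightarrow> bool" where
  "is_Irr C R \<longleftrightarrow> (\<forall>x\<in>R. simple_object C x) \<and>
     (\<forall>x. simple_object C x \<longrightarrow> (\<exists>!y. y \<in> R \<and> isomorphic C x y))"


section \<open>Ribbon fusion categories\<close>

text \<open>
  The monoidal structure is not assumed strict. Directions of the structure arrows:
  \<open>assoc x y z : (x \<otimes> y) \<otimes> z \<rightarrow> x \<otimes> (y \<otimes> z)\<close>, \<open>lunit x : I \<otimes> x \<rightarrow> x\<close>, \<open>runit x : x \<otimes> I \<rightarrow> x\<close>,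
  \<open>ev x : x\<^sup>* \<otimes> x \<rightarrow> I\<close>, \<open>coev x : I \<rightarrow> x \<otimes> x\<^sup>*\<close>, \<open>braid x y : x \<otimes> y \<rightarrow> y \<otimes> x\<close>, \<open>twist x : x \<rightarrow> x\<close>.
\<close>

record ('o, 'm, 'k) ribbon_cat = "('o, 'm, 'k) linear_cat" +
  tensor :: "'o \<Rightarrow> 'o \<Rightarrow> 'o" (infixr "\<otimes>\<index>" 75)
  tensor_arrow :: "'m \<Rightarrow> 'm \<Rightarrow> 'm" (infixr "\<otimes>\<^sub>m\<index>" 75)
  unit_object :: 'o ("I\<index>")
  assoc :: "'o \<Rightarrow> 'o \<Rightarrow> 'o \<Rightarrow> 'm"
  lunit :: "'o \<Rightarrow> 'm"
  runit :: "'o \<Rightarrow> 'm"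
  dual :: "'o \<Rightarrow> 'o"
  ev :: "'o \<Rightarrow> 'm"
  coev :: "'o \<Rightarrow> 'm"
  braid :: "'o \<Rightarrow> 'o \<Rightarrow> 'm"
  twist :: "'o \<Rightarrow> 'm"

definition assoc_inv :: "('o, 'm, 'k, 'z) ribbon_cat_scheme \<Rightarrow> 'o \<Rightarrow> 'o \<Rightarrow> 'o \<Rightarrow> 'm" where
  "assoc_inv C x y z =
     inv_arrow C (tensor C (tensor C x y) z) (tensor C x (tensor C y z)) (assoc C x y z)"

locale linear_monoidal_category = linear_category C
  for C :: "('o, 'm::ab_group_add, 'k::field, 'z) ribbon_cat_scheme" (structure) +
  assumes tensor_in_Hom:
      "\<lbrakk>f \<in> Hom C x y; g \<in> Hom C x' y'\<rbrakk> \<Longrightarrow> f \<otimes>\<^sub>m g \<in> Hom C (x \<otimes> x') (y \<otimes> y')"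
    and tensor_ident: "ident C x \<otimes>\<^sub>m ident C y = ident C (x \<otimes> y)"
    and tensor_compose:
      "\<lbrakk>g \<in> Hom C y z; f \<in> Hom C x y; g' \<in> Hom C y' z'; f' \<in> Hom C x' y'\<rbrakk> \<Longrightarrow>
         (g \<cdot> f) \<otimes>\<^sub>m (g' \<cdot> f') = (g \<otimes>\<^sub>m g') \<cdot> (f \<otimes>\<^sub>m f')"
    and tensor_add_left:
      "\<lbrakk>f \<in> Hom C x y; f' \<in> Hom C x y; g \<in> Hom C x' y'\<rbrakk> \<Longrightarrow>
         (f + f') \<otimes>\<^sub>m g = f \<otimes>\<^sub>m g + f' \<otimes>\<^sub>m g"
    and tensor_add_right:
      "\<lbrakk>f \<in> Hom C x y; g \<in> Hom C x' y'; g' \<in> Hom C x' y'\<rbrakk> \<Longrightarrow>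
         f \<otimes>\<^sub>m (g + g') = f \<otimes>\<^sub>m g + f \<otimes>\<^sub>m g'"
    and tensor_smult_left:
      "\<lbrakk>f \<in> Hom C x y; g \<in> Hom C x' y'\<rbrakk> \<Longrightarrow> smult C a f \<otimes>\<^sub>m g = smult C a (f \<otimes>\<^sub>m g)"
    and tensor_smult_right:
      "\<lbrakk>f \<in> Hom C x y; g \<in> Hom C x' y'\<rbrakk> \<Longrightarrow> f \<otimes>\<^sub>m smult C a g = smult C a (f \<otimes>\<^sub>m g)"
    and assoc_iso: "iso_arrow C ((x \<otimes> y) \<otimes> z) (x \<otimes> (y \<otimes> z)) (assoc C x y z)"
    and lunit_iso: "iso_arrow C (I \<otimes> x) x (lunit C x)"
    and runit_iso: "iso_arrow C (x \<otimes> I) x (runit C x)"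
    and assoc_natural:
      "\<lbrakk>f \<in> Hom C x x'; g \<in> Hom C y y'; h \<in> Hom C z z'\<rbrakk> \<Longrightarrow>
         assoc C x' y' z' \<cdot> ((f \<otimes>\<^sub>m g) \<otimes>\<^sub>m h) = (f \<otimes>\<^sub>m (g \<otimes>\<^sub>m h)) \<cdot> assoc C x y z"
    and lunit_natural:
      "f \<in> Hom C x y \<Longrightarrow> lunit C y \<cdot> (ident C I \<otimes>\<^sub>m f) = f \<cdot> lunit C x"
    and runit_natural:
      "f \<in> Hom C x y \<Longrightarrow> runit C y \<cdot> (f \<otimes>\<^sub>m ident C I) = f \<cdot> runit C x"
    and pentagon:
      "assoc C w x (y \<otimes> z) \<cdot> assoc C (w \<otimes> x) y z =
         (ident C w \<otimes>\<^sub>m assoc C x y z) \<cdot> assoc C w (x \<otimes> y) z \<cdot> (assoc C w x y \<otimes>\<^sub>m ident C z)"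
    and triangle:
      "(ident C x \<otimes>\<^sub>m lunit C y) \<cdot> assoc C x I y = runit C x \<otimes>\<^sub>m ident C y"

text \<open>
  \<open>y\<close> is a left dual of \<open>x\<close> (equivalently \<open>x\<close> is a right dual of \<open>y\<close>), with evaluation
  \<open>e : y \<otimes> x \<rightarrow> I\<close> and coevaluation \<open>c : I \<rightarrow> x \<otimes> y\<close>. The last two clauses are the zigzag
  identities, with the inverses of the unitors moved to the other side.
\<close>

definition left_duality ::
  "('o, 'm, 'k, 'z) ribbon_cat_scheme \<Rightarrow> 'o \<Rightarrow> 'o \<Rightarrow> 'm \<Rightarrow> 'm \<Rightarrow> bool" where
  "left_duality C x y e c \<longleftrightarrow>
     e \<in> Hom C (y \<otimes>\<^bsub>C\<^esub> x) I\<^bsub>C\<^esub> \<and> c \<in> Hom C I\<^bsub>C\<^esub> (x \<otimes>\<^bsub>C\<^esub> y) \<and>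
     runit C x \<cdot>\<^bsub>C\<^esub> (ident C x \<otimes>\<^sub>m\<^bsub>C\<^esub> e) \<cdot>\<^bsub>C\<^esub> assoc C x y x \<cdot>\<^bsub>C\<^esub> (c \<otimes>\<^sub>m\<^bsub>C\<^esub> ident C x) = lunit C x \<and>
     lunit C y \<cdot>\<^bsub>C\<^esub> (e \<otimes>\<^sub>m\<^bsub>C\<^esub> ident C y) \<cdot>\<^bsub>C\<^esub> assoc_inv C y x y \<cdot>\<^bsub>C\<^esub> (ident C y \<otimes>\<^sub>m\<^bsub>C\<^esub> c) = runit C y"

text \<open>The dual \<open>f\<^sup>* : y\<^sup>* \<rightarrow> x\<^sup>*\<close> of \<open>f : x \<rightarrow> y\<close>.\<close>

definition dual_arrow :: "('o, 'm, 'k, 'z) ribbon_cat_scheme \<Rightarrow> 'o \<Rightarrow> 'o \<Rightarrow> 'm \<Rightarrow> 'm" where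
  "dual_arrow C x y f =
     lunit C (dual C x) \<cdot>\<^bsub>C\<^esub>
     (ev C y \<otimes>\<^sub>m\<^bsub>C\<^esub> ident C (dual C x)) \<cdot>\<^bsub>C\<^esub>
     ((ident C (dual C y) \<otimes>\<^sub>m\<^bsub>C\<^esub> f) \<otimes>\<^sub>m\<^bsub>C\<^esub> ident C (dual C x)) \<cdot>\<^bsub>C\<^esub>
     assoc_inv C (dual C y) x (dual C x) \<cdot>\<^bsub>C\<^esub>
     (ident C (dual C y) \<otimes>\<^sub>m\<^bsub>C\<^esub> coev C x) \<cdot>\<^bsub>C\<^esub>
     inv_arrow C (dual C y \<otimes>\<^bsub>C\<^esub> I\<^bsub>C\<^esub>) (dual C y) (runit C (dual C y))"

text \<open>Left duals are part of the data; right duals are only required to exist.\<close>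

locale rigid_linear_monoidal_category = linear_monoidal_category C
  for C :: "('o, 'm::ab_group_add, 'k::field, 'z) ribbon_cat_scheme" (structure) +
  assumes left_dual: "left_duality C x (dual C x) (ev C x) (coev C x)"
    and right_dual: "\<exists>y e c. left_duality C y x e c"

locale ribbon_fusion_category = finite_semisimple_category C + rigid_linear_monoidal_category C
  for C :: "('o, 'm::ab_group_add, 'k::field, 'z) ribbon_cat_scheme" (structure) +
  assumes simple_unit: "simple_object C I"
    and braid_iso: "iso_arrow C (x \<otimes> y) (y \<otimes> x) (braid C x y)"
    and braid_natural:
      "\<lbrakk>f \<in> Hom C x x'; g \<in> Hom C y y'\<rbrakk> \<Longrightarrow>
         braid C x' y' \<cdot> (f \<otimes>\<^sub>m g) = (g \<otimes>\<^sub>m f) \<cdot> braid C x y"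
    and hexagon:
      "assoc C y z x \<cdot> braid C x (y \<otimes> z) \<cdot> assoc C x y z =
         (ident C y \<otimes>\<^sub>m braid C x z) \<cdot> assoc C y x z \<cdot> (braid C x y \<otimes>\<^sub>m ident C z)"
    and hexagon_inv:
      "assoc_inv C z x y \<cdot> braid C (x \<otimes> y) z \<cdot> assoc_inv C x y z =
         (braid C x z \<otimes>\<^sub>m ident C y) \<cdot> assoc_inv C x z y \<cdot> (ident C x \<otimes>\<^sub>m braid C y z)"
    and twist_iso: "iso_arrow C x x (twist C x)"
    and twist_natural: "f \<in> Hom C x y \<Longrightarrow> twist C y \<cdot> f = f \<cdot> twist C x"
    and twist_tensor:
      "twist C (x \<otimes> y) = braid C y x \<cdot> braid C x y \<cdot> (twist C x \<otimes>\<^sub>m twist C y)"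
    and twist_dual: "twist C (dual C x) = dual_arrow C x x (twist C x)"

definition transparent :: "('o, 'm, 'k, 'z) ribbon_cat_scheme \<Rightarrow> 'o \<Rightarrow> bool" where
  "transparent C x \<longleftrightarrow> (\<forall>y. braid C y x \<cdot>\<^bsub>C\<^esub> braid C x y = ident C (x \<otimes>\<^bsub>C\<^esub> y))"

text \<open>Meaningful for simple \<open>x\<close> over an algebraically closed field, by Schur's lemma.\<close>

definition twist_scalar :: "('o, 'm, 'k, 'z) ribbon_cat_scheme \<Rightarrow> 'o \<Rightarrow> 'k" where
  "twist_scalar C x = (THE a. twist C x = smult C a (ident C x))"

text \<open>
  The 0-framed unknot labelled by \<open>x\<close>, as an endomorphism of the unit object: the kink
  \<open>c\<^bsub>x,x\<^sup>*\<^esub>\<close> needed to close up the strand is compensated by the twist \<open>\<theta>\<^sub>x\<close>.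
  The quantum dimension is its value under \<open>End(I) = k\<close>.
\<close>

definition unknot :: "('o, 'm, 'k, 'z) ribbon_cat_scheme \<Rightarrow> 'o \<Rightarrow> 'm" where
  "unknot C x =
     ev C x \<cdot>\<^bsub>C\<^esub> braid C x (dual C x) \<cdot>\<^bsub>C\<^esub> (twist C x \<otimes>\<^sub>m\<^bsub>C\<^esub> ident C (dual C x)) \<cdot>\<^bsub>C\<^esub> coev C x"

definition quantum_dim :: "('o, 'm, 'k, 'z) ribbon_cat_scheme \<Rightarrow> 'o \<Rightarrow> 'k" where
  "quantum_dim C x = (THE a. unknot C x = smult C a (ident C I\<^bsub>C\<^esub>))"

text \<open>\<open>R\<close> is a set of representatives in the sense of \<open>is_Irr\<close>.\<close>

definition gauss_plus :: "('o, 'm, 'k::field, 'z) ribbon_cat_scheme \<Rightarrow> 'o set \<Rightarrow> 'k" where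
  "gauss_plus C R = (\<Sum>x\<in>R. twist_scalar C x * quantum_dim C x ^ 2)"

definition gauss_minus :: "('o, 'm, 'k::field, 'z) ribbon_cat_scheme \<Rightarrow> 'o set \<Rightarrow> 'k" where
  "gauss_minus C R = (\<Sum>x\<in>R. inverse (twist_scalar C x) * quantum_dim C x ^ 2)"

end

theory Submission
  imports Defs
begin

text \<open>
  Write \<open>d\<^sub>i\<close>, \<open>S\<^sub>i\<^sub>j\<close> for dimensions and Hopf link invariants of the simple objects and \<open>D = \<Sum>\<^sub>i d\<^sub>i\<^sup>2\<close>.
  If \<open>i\<close> is transparent then \<open>\<theta>\<^sub>l = \<theta>\<^sub>i \<theta>\<^sub>j\<close> for every constituent \<open>l\<close> of \<open>i \<otimes> j\<close>, so multiplying the Gauss sum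
  \<open>\<tau>\<^sup>\<plusminus>\<close> by \<open>\<theta>\<^sub>i\<^sup>\<plusminus>\<^sup>1 d\<^sub>i\<close> gives \<open>d\<^sub>i \<tau>\<^sup>\<plusminus>\<close>; hence both sums vanish when \<open>\<theta>\<^sub>i \<noteq> 1\<close>. Conversely, balancing gives
  \<open>\<tau>\<^sup>+ \<tau>\<^sup>- = \<Sum>\<^sub>i \<theta>\<^sub>i d\<^sub>i \<Sum>\<^sub>j d\<^sub>j S\<^sub>j\<^sub>i\<close>. The map \<open>j \<mapsto> S\<^sub>j\<^sub>i / d\<^sub>i\<close> is a character of the fusion ring, so the inner sum
  vanishes unless \<open>S\<^sub>j\<^sub>i = d\<^sub>j d\<^sub>i\<close> for all \<open>j\<close>, and by the sliding property of the Kirby colour this forces \<open>i\<close> to be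
  transparent. So \<open>\<tau>\<^sup>+ \<tau>\<^sup>- = D \<cdot> \<Sum> \<theta>\<^sub>i d\<^sub>i\<^sup>2\<close>, summed over the transparent \<open>i\<close>. If these have trivial twist, both
  factors are sums of squares of dimensions over a fusion subcategory; such a sum is an eigenvalue of a positive
  definite integer matrix and therefore nonzero in characteristic zero.

  Diagrammatic arguments take place in a strict model whose objects are lists of objects; arrows carry their
  source and target, so that composability is an equation the simplifier can decide.
\<close>

section \<open>Duality and traces in strict ribbon categories\<close>

text \<open>No pivotal structure and no functorial choice of duals appears. A loop is closed by
  \<open>tev\<close>, an evaluation preceded by a braiding and a twist, and any dual pair may serve,
  because the resulting trace does not depend on it; so duals can be tensored, flipped by the
  braiding and transported along isomorphisms at will. One fact drives all the algebra: in the
  fusion ring, the sum of the \<open>d j\<close> times \<open>j\<close> is an eigenvector of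
  multiplication by each \<open>k\<close>, with eigenvalue \<open>d k\<close>
  (\<open>n_sum_left\<close>). It yields the vanishing of the Gauss sums, the orthogonality of
  characters and the relation \<open>gp_S\<close>. The matrix \<open>S\<close> may be singular, so
  transparency cannot be read off by inverting it. The double braiding with \<open>X\<close> is
  instead tested against all endomorphisms under the trace pairing, which is nondegenerate because
  simple objects have nonzero dimension; the Kirby colour makes the tested strand closable, at the
  cost of a factor \<open>D\<close>. The field has neither order nor conjugation, so cancelling
  \<open>D\<close> needs the separate argument over the rationals.\<close>

locale strict_monoidal =
  fixes arr :: "'a \<Rightarrow> bool" and src trg :: "'a \<Rightarrow> 'o list"
    and comp :: "'a \<Rightarrow> 'a \<Rightarrow> 'a" (infixr "\<bullet>" 65)
    and tens :: "'a \<Rightarrow> 'a \<Rightarrow> 'a" (infixr "\<odot>" 70)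
    and idt :: "'o list \<Rightarrow> 'a" ("\<iota>")
  assumes arr_idt [simp]: "arr (\<iota> x)"
    and src_idt [simp]: "src (\<iota> x) = x"
    and trg_idt [simp]: "trg (\<iota> x) = x"
    and arr_comp [simp]: "\<lbrakk>arr g; arr f; src g = trg f\<rbrakk> \<Longrightarrow> arr (g \<bullet> f)"
    and src_comp [simp]: "src (g \<bullet> f) = src f"
    and trg_comp [simp]: "trg (g \<bullet> f) = trg g"
    and arr_tens [simp]: "\<lbrakk>arr g; arr f\<rbrakk> \<Longrightarrow> arr (g \<odot> f)"
    and src_tens [simp]: "src (g \<odot> f) = src g @ src f"
    and trg_tens [simp]: "trg (g \<odot> f) = trg g @ trg f"
    and comp_assoc [simp]:
      "\<lbrakk>arr h; arr g; arr f; src h = trg g; src g = trg f\<rbrakk> \<Longrightarrow> (h \<bullet> g) \<bullet> f = h \<bullet> g \<bullet> f"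
    and comp_idt_right [simp]: "\<lbrakk>arr f; src f = x\<rbrakk> \<Longrightarrow> f \<bullet> \<iota> x = f"
    and comp_idt_left [simp]: "\<lbrakk>arr f; trg f = x\<rbrakk> \<Longrightarrow> \<iota> x \<bullet> f = f"
    and tens_assoc [simp]: "\<lbrakk>arr h; arr g; arr f\<rbrakk> \<Longrightarrow> (h \<odot> g) \<odot> f = h \<odot> g \<odot> f"
    and tens_unit_right [simp]: "arr f \<Longrightarrow> f \<odot> \<iota> [] = f"
    and tens_unit_left [simp]: "arr f \<Longrightarrow> \<iota> [] \<odot> f = f"
    and tens_idt [simp]: "\<iota> x \<odot> \<iota> y = \<iota> (x @ y)"
    and interchange:
      "\<lbrakk>arr g; arr f; arr g'; arr f'; src g = trg f; src g' = trg f'\<rbrakk> \<Longrightarrow>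
        (g \<odot> g') \<bullet> (f \<odot> f') = (g \<bullet> f) \<odot> (g' \<bullet> f')"
begin

section \<open>Calculus of layered diagrams\<close>

lemma tens_idt_assoc [simp]: "arr f \<Longrightarrow> \<iota> x \<odot> \<iota> y \<odot> f = \<iota> (x @ y) \<odot> f"
  by (simp flip: tens_assoc)

text \<open>As rewrite rules, this and \<open>whisker_right\<close> spread a composite over layers
  with identities on the other strands. Diagrams are thus normalised to right-nested chains of
  layers.\<close>

lemma whisker_left [simp]:
  "\<lbrakk>arr g; arr f; src g = trg f\<rbrakk> \<Longrightarrow> \<iota> x \<odot> (g \<bullet> f) = (\<iota> x \<odot> g) \<bullet> (\<iota> x \<odot> f)"
  by (simp add: interchange)

lemma whisker_right [simp]:
  "\<lbrakk>arr g; arr f; src g = trg f\<rbrakk> \<Longrightarrow> (g \<bullet> f) \<odot> \<iota> x = (g \<odot> \<iota> x) \<bullet> (f \<odot> \<iota> x)"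
  by (simp add: interchange)

lemma tens_right_left:
  "\<lbrakk>arr f; arr g; src f = a; trg g = b\<rbrakk> \<Longrightarrow> (f \<odot> \<iota> b) \<bullet> (\<iota> a \<odot> g) = f \<odot> g"
  by (simp add: interchange)

lemma tens_left_right:
  "\<lbrakk>arr f; arr g; trg f = a; src g = b\<rbrakk> \<Longrightarrow> (\<iota> a \<odot> g) \<bullet> (f \<odot> \<iota> b) = f \<odot> g"
  by (simp add: interchange)

text \<open>The interchange law in layered form: arrows on disjoint strands exchange heights.
  Neither direction is a simplification, so it is instantiated by hand.\<close>

lemma slide:
  "\<lbrakk>arr f; arr g; src f = a; trg g = b; trg f = a'; src g = b'\<rbrakk> \<Longrightarrow>
     (f \<odot> \<iota> b) \<bullet> (\<iota> a \<odot> g) = (\<iota> a' \<odot> g) \<bullet> (f \<odot> \<iota> b')"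
  by (simp add: tens_right_left tens_left_right)

lemma whisker_both:
  "\<lbrakk>g \<bullet> f = h; arr g; arr f; src g = trg f\<rbrakk> \<Longrightarrow> (\<iota> a \<odot> g \<odot> \<iota> b) \<bullet> (\<iota> a \<odot> f \<odot> \<iota> b) = \<iota> a \<odot> h \<odot> \<iota> b"
  by (auto simp: interchange)

text \<open>Right-nesting hides a two-factor equation inside a longer chain. \<open>reassoc\<close>
  and \<open>reassoc1\<close> attach a tail \<open>h\<close> to it, so that it applies at that
  position.\<close>

lemma reassoc:
  "\<lbrakk>g \<bullet> f = g' \<bullet> f'; arr g; arr f; arr g'; arr f'; arr h; src g = trg f; src g' = trg f'; src f = trg h; src f' = trg h\<rbrakk>
    \<Longrightarrow> g \<bullet> f \<bullet> h = g' \<bullet> f' \<bullet> h"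
  by (metis comp_assoc)

lemma reassoc1:
  "\<lbrakk>g \<bullet> f = k; arr g; arr f; arr h; src g = trg f; src f = trg h\<rbrakk> \<Longrightarrow> g \<bullet> f \<bullet> h = k \<bullet> h"
  by (metis comp_assoc)

section \<open>Dual pairs and transposition of arrows\<close>

definition dual_pair :: "'o list \<Rightarrow> 'o list \<Rightarrow> 'a \<Rightarrow> 'a \<Rightarrow> bool" where
  "dual_pair x y e c \<longleftrightarrow> arr e \<and> src e = y @ x \<and> trg e = [] \<and> arr c \<and> src c = [] \<and> trg c = x @ y \<and>
     (\<iota> x \<odot> e) \<bullet> (c \<odot> \<iota> x) = \<iota> x \<and> (e \<odot> \<iota> y) \<bullet> (\<iota> y \<odot> c) = \<iota> y"

lemma dual_pairD:
  assumes "dual_pair x y e c"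
  shows "arr e" "src e = y @ x" "trg e = []" "arr c" "src c = []" "trg c = x @ y"
    "(\<iota> x \<odot> e) \<bullet> (c \<odot> \<iota> x) = \<iota> x" "(e \<odot> \<iota> y) \<bullet> (\<iota> y \<odot> c) = \<iota> y"
  using assms by (auto simp: dual_pair_def)

text \<open>Bending the strand \<open>x\<close> with \<open>e\<close> loses nothing: bending it back
  with \<open>c\<close> recovers the arrow by a zigzag identity.\<close>

lemma ev_cancel:
  assumes "dual_pair x y e c" "arr f" "arr g" "trg f = x @ p" "trg g = x @ p" "src f = q" "src g = q"
    and eq: "(e \<odot> \<iota> p) \<bullet> (\<iota> y \<odot> f) = (e \<odot> \<iota> p) \<bullet> (\<iota> y \<odot> g)"
  shows "f = g"
proof -
  note [simp] = dual_pairD(1-6)[OF assms(1)] assms(2-7)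
  have *: "h = (\<iota> x \<odot> ((e \<odot> \<iota> p) \<bullet> (\<iota> y \<odot> h))) \<bullet> (c \<odot> \<iota> q)"
    if [simp]: "arr h" "trg h = x @ p" "src h = q" for h
  proof -
    have "(\<iota> x \<odot> ((e \<odot> \<iota> p) \<bullet> (\<iota> y \<odot> h))) \<bullet> (c \<odot> \<iota> q)
        = (\<iota> x \<odot> e \<odot> \<iota> p) \<bullet> (\<iota> (x @ y) \<odot> h) \<bullet> (c \<odot> \<iota> q)" by simp
    also have "(\<iota> (x @ y) \<odot> h) \<bullet> (c \<odot> \<iota> q) = (c \<odot> \<iota> (x @ p)) \<bullet> h"
      using slide[of c h "[]" "x @ p" "x @ y" q] by simp
    also have "(\<iota> x \<odot> e \<odot> \<iota> p) \<bullet> (c \<odot> \<iota> (x @ p)) \<bullet> h = h"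
      using reassoc1[OF whisker_both[OF dual_pairD(7)[OF assms(1)], of "[]" p], of h] by simp
    finally show ?thesis by simp
  qed
  show ?thesis using *[of f] *[of g] eq by simp
qed

text \<open>The transpose \<open>y'\<close> \<rightarrow> \<open>y\<close> of an arrow
  \<open>f\<close>, taken with respect to arbitrary dual pairs of its source and target.\<close>

definition mate :: "'a \<Rightarrow> 'a \<Rightarrow> 'a \<Rightarrow> 'o list \<Rightarrow> 'o list \<Rightarrow> 'a" where
  "mate e' c f y' y = (e' \<odot> \<iota> y) \<bullet> (\<iota> y' \<odot> f \<odot> \<iota> y) \<bullet> (\<iota> y' \<odot> c)"

context
  fixes x y x' y' e c e' c' f
  assumes dp: "dual_pair x y e c" "dual_pair x' y' e' c'"
    and f: "arr f" "src f = x" "trg f = x'"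
begin

lemma mate_arr: "arr (mate e' c f y' y)" "src (mate e' c f y' y) = y'" "trg (mate e' c f y' y) = y"
  using dual_pairD(1-6)[OF dp(1)] dual_pairD(1-6)[OF dp(2)] f by (auto simp: mate_def)

text \<open>With \<open>mate_ev\<close> this moves \<open>f\<close> around a bend: what acts on one
  leg of a coevaluation or evaluation acts as its transpose on the other leg.\<close>

lemma mate_coev: "(\<iota> x' \<odot> mate e' c f y' y) \<bullet> c' = (f \<odot> \<iota> y) \<bullet> c"
proof -
  note [simp] = dual_pairD(1-6)[OF dp(1)] dual_pairD(1-6)[OF dp(2)] f
  have "(\<iota> x' \<odot> mate e' c f y' y) \<bullet> c'
      = (\<iota> x' \<odot> e' \<odot> \<iota> y) \<bullet> (\<iota> (x' @ y') \<odot> f \<odot> \<iota> y) \<bullet> (\<iota> (x' @ y') \<odot> c) \<bullet> c'"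
    by (simp add: mate_def)
  also have "(\<iota> (x' @ y') \<odot> c) \<bullet> c' = (c' \<odot> \<iota> (x @ y)) \<bullet> c"
    using slide[of c' c "[]" "x @ y" "x' @ y'" "[]"] by simp
  also have "(\<iota> (x' @ y') \<odot> f \<odot> \<iota> y) \<bullet> (c' \<odot> \<iota> (x @ y)) \<bullet> c = (c' \<odot> \<iota> (x' @ y)) \<bullet> (f \<odot> \<iota> y) \<bullet> c"
    using reassoc[OF slide[of c' "f \<odot> \<iota> y" "[]" "x' @ y" "x' @ y'" "x @ y", symmetric], of c] by simp
  also have "(\<iota> x' \<odot> e' \<odot> \<iota> y) \<bullet> (c' \<odot> \<iota> (x' @ y)) \<bullet> (f \<odot> \<iota> y) \<bullet> c = (f \<odot> \<iota> y) \<bullet> c"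
    using reassoc1[OF whisker_both[OF dual_pairD(7)[OF dp(2)], of "[]" y], of "(f \<odot> \<iota> y) \<bullet> c"] by simp
  finally show ?thesis .
qed

lemma mate_ev: "e \<bullet> (mate e' c f y' y \<odot> \<iota> x) = e' \<bullet> (\<iota> y' \<odot> f)"
proof -
  note [simp] = dual_pairD(1-6)[OF dp(1)] dual_pairD(1-6)[OF dp(2)] f
  have "e \<bullet> (mate e' c f y' y \<odot> \<iota> x)
      = e \<bullet> (e' \<odot> \<iota> (y @ x)) \<bullet> (\<iota> y' \<odot> f \<odot> \<iota> (y @ x)) \<bullet> (\<iota> y' \<odot> c \<odot> \<iota> x)"
    by (simp add: mate_def)
  also have "\<dots> = e' \<bullet> (\<iota> (y' @ x') \<odot> e) \<bullet> (\<iota> y' \<odot> f \<odot> \<iota> (y @ x)) \<bullet> (\<iota> y' \<odot> c \<odot> \<iota> x)"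
    using reassoc[OF slide[of e' e "y' @ x'" "[]" "[]" "y @ x", symmetric],
        of "(\<iota> y' \<odot> f \<odot> \<iota> (y @ x)) \<bullet> (\<iota> y' \<odot> c \<odot> \<iota> x)"] by simp
  also have "(\<iota> (y' @ x') \<odot> e) \<bullet> (\<iota> y' \<odot> f \<odot> \<iota> (y @ x)) \<bullet> (\<iota> y' \<odot> c \<odot> \<iota> x)
      = (\<iota> y' \<odot> f) \<bullet> (\<iota> (y' @ x) \<odot> e) \<bullet> (\<iota> y' \<odot> c \<odot> \<iota> x)"
    using reassoc[OF slide[of "\<iota> y' \<odot> f" e "y' @ x" "[]" "y' @ x'" "y @ x", symmetric],
        of "\<iota> y' \<odot> c \<odot> \<iota> x"] by simp
  also have "(\<iota> (y' @ x) \<odot> e) \<bullet> (\<iota> y' \<odot> c \<odot> \<iota> x) = \<iota> (y' @ x)"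
    using whisker_both[OF dual_pairD(7)[OF dp(1)], of y' "[]"] by simp
  finally show ?thesis by simp
qed

end

text \<open>Evaluations and coevaluations are nested, which reverses the order of the duals. After a
  height exchange, each zigzag for the product separates into the zigzags of the factors.\<close>

lemma dual_pair_tens:
  assumes dp: "dual_pair x y e c" "dual_pair x' y' e' c'"
  shows "dual_pair (x @ x') (y' @ y) (e' \<bullet> (\<iota> y' \<odot> e \<odot> \<iota> x')) ((\<iota> x \<odot> c' \<odot> \<iota> y) \<bullet> c)"
proof -
  note [simp] = dual_pairD(1-6)[OF dp(1)] dual_pairD(1-6)[OF dp(2)]
  have 1: "(\<iota> (x @ x') \<odot> e') \<bullet> (\<iota> (x @ x' @ y') \<odot> e \<odot> \<iota> x') \<bullet> (\<iota> x \<odot> c' \<odot> \<iota> (y @ x @ x')) \<bullet> (c \<odot> \<iota> (x @ x')) = \<iota> (x @ x')"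
  proof -
    have "(\<iota> (x @ x' @ y') \<odot> e \<odot> \<iota> x') \<bullet> (\<iota> x \<odot> c' \<odot> \<iota> (y @ x @ x')) \<bullet> (c \<odot> \<iota> (x @ x'))
       = (\<iota> x \<odot> c' \<odot> \<iota> x') \<bullet> (\<iota> x \<odot> e \<odot> \<iota> x') \<bullet> (c \<odot> \<iota> (x @ x'))"
      using reassoc[OF slide[of "\<iota> x \<odot> c'" "e \<odot> \<iota> x'" x x' "x @ x' @ y'" "y @ x @ x'", symmetric], of "c \<odot> \<iota> (x @ x')"]
      by simp
    also have "(\<iota> x \<odot> e \<odot> \<iota> x') \<bullet> (c \<odot> \<iota> (x @ x')) = \<iota> (x @ x')"
      using whisker_both[OF dual_pairD(7)[OF dp(1)], of "[]" x'] by simp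
    also have "(\<iota> (x @ x') \<odot> e') \<bullet> (\<iota> x \<odot> c' \<odot> \<iota> x') \<bullet> \<iota> (x @ x') = \<iota> (x @ x')"
      using whisker_both[OF dual_pairD(7)[OF dp(2)], of x "[]"] by simp
    finally show ?thesis .
  qed
  have 2: "(e' \<odot> \<iota> (y' @ y)) \<bullet> (\<iota> y' \<odot> e \<odot> \<iota> (x' @ y' @ y)) \<bullet> (\<iota> (y' @ y @ x) \<odot> c' \<odot> \<iota> y) \<bullet> (\<iota> (y' @ y) \<odot> c) = \<iota> (y' @ y)"
  proof -
    have "(\<iota> y' \<odot> e \<odot> \<iota> (x' @ y' @ y)) \<bullet> (\<iota> (y' @ y @ x) \<odot> c' \<odot> \<iota> y) \<bullet> (\<iota> (y' @ y) \<odot> c)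
      = (\<iota> y' \<odot> c' \<odot> \<iota> y) \<bullet> (\<iota> y' \<odot> e \<odot> \<iota> y) \<bullet> (\<iota> (y' @ y) \<odot> c)"
      using reassoc[OF slide[of "\<iota> y' \<odot> e" "c' \<odot> \<iota> y" "y' @ y @ x" "x' @ y' @ y" y' y], of "\<iota> (y' @ y) \<odot> c"] by simp
    also have "(\<iota> y' \<odot> e \<odot> \<iota> y) \<bullet> (\<iota> (y' @ y) \<odot> c) = \<iota> (y' @ y)"
      using whisker_both[OF dual_pairD(8)[OF dp(1)], of y' "[]"] by simp
    also have "(e' \<odot> \<iota> (y' @ y)) \<bullet> (\<iota> y' \<odot> c' \<odot> \<iota> y) \<bullet> \<iota> (y' @ y) = \<iota> (y' @ y)"
      using whisker_both[OF dual_pairD(8)[OF dp(2)], of "[]" y] by simp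
    finally show ?thesis .
  qed
  show ?thesis using 1 2 by (simp add: dual_pair_def)
qed

end

locale strict_ribbon = strict_monoidal arr src trg comp tens idt
  for arr :: "'a \<Rightarrow> bool" and src trg :: "'a \<Rightarrow> 'o list"
    and comp :: "'a \<Rightarrow> 'a \<Rightarrow> 'a" (infixr "\<bullet>" 65)
    and tens :: "'a \<Rightarrow> 'a \<Rightarrow> 'a" (infixr "\<odot>" 70)
    and idt :: "'o list \<Rightarrow> 'a" ("\<iota>") +
  fixes br ibr :: "'o list \<Rightarrow> 'o list \<Rightarrow> 'a" and tw :: "'o list \<Rightarrow> 'a"
  assumes arr_br [simp]: "arr (br x y)" "src (br x y) = x @ y" "trg (br x y) = y @ x"
    and arr_ibr [simp]: "arr (ibr x y)" "src (ibr x y) = y @ x" "trg (ibr x y) = x @ y"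
    and ibr_br [simp]: "ibr x y \<bullet> br x y = \<iota> (x @ y)"
    and br_ibr [simp]: "br x y \<bullet> ibr x y = \<iota> (y @ x)"
    and br_natural: "\<lbrakk>arr f; arr g\<rbrakk> \<Longrightarrow> br (trg f) (trg g) \<bullet> (f \<odot> g) = (g \<odot> f) \<bullet> br (src f) (src g)"
    and br_tens_right: "br x (y @ z) = (\<iota> y \<odot> br x z) \<bullet> (br x y \<odot> \<iota> z)"
    and br_tens_left: "br (x @ y) z = (br x z \<odot> \<iota> y) \<bullet> (\<iota> x \<odot> br y z)"
    and arr_tw [simp]: "arr (tw x)" "src (tw x) = x" "trg (tw x) = x"
    and tw_natural: "arr f \<Longrightarrow> tw (trg f) \<bullet> f = f \<bullet> tw (src f)"
    and tw_tens: "tw (x @ y) = br y x \<bullet> br x y \<bullet> (tw x \<odot> tw y)"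
begin

section \<open>Braidings, units and evaluations\<close>

lemma ibr_br_comp [simp]: "\<lbrakk>arr f; trg f = x @ y\<rbrakk> \<Longrightarrow> ibr x y \<bullet> br x y \<bullet> f = f"
  using reassoc1[OF ibr_br[of x y], of f] by simp

lemma br_ibr_comp [simp]: "\<lbrakk>arr f; trg f = y @ x\<rbrakk> \<Longrightarrow> br x y \<bullet> ibr x y \<bullet> f = f"
  using reassoc1[OF br_ibr[of x y], of f] by simp

lemma ibr_br_whisker [simp]: "(\<iota> a \<odot> ibr x y \<odot> \<iota> b) \<bullet> (\<iota> a \<odot> br x y \<odot> \<iota> b) = \<iota> (a @ x @ y @ b)"
  using whisker_both[OF ibr_br, of x y a b] by simp

lemma br_ibr_whisker [simp]: "(\<iota> a \<odot> br x y \<odot> \<iota> b) \<bullet> (\<iota> a \<odot> ibr x y \<odot> \<iota> b) = \<iota> (a @ y @ x @ b)"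
  using whisker_both[OF br_ibr, of x y a b] by simp

lemma ibr_natural:
  assumes [simp]: "arr f" "arr g"
  shows "ibr (trg f) (trg g) \<bullet> (g \<odot> f) = (f \<odot> g) \<bullet> ibr (src f) (src g)"
proof -
  have "ibr (trg f) (trg g) \<bullet> (g \<odot> f) = ibr (trg f) (trg g) \<bullet> (g \<odot> f) \<bullet> br (src f) (src g) \<bullet> ibr (src f) (src g)"
    by simp
  also have "(g \<odot> f) \<bullet> br (src f) (src g) \<bullet> ibr (src f) (src g) = br (trg f) (trg g) \<bullet> (f \<odot> g) \<bullet> ibr (src f) (src g)"
    using reassoc[OF br_natural[of f g, symmetric], of "ibr (src f) (src g)"] by simp
  finally show ?thesis by simp
qed

text \<open>Used for braidings with the empty word: the strict hexagons make these idempotent, and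
  they have a left inverse.\<close>

lemma iso_idem_eq_idt:
  assumes "b \<bullet> b = b" "b' \<bullet> b = \<iota> x" and [simp]: "arr b" "arr b'" "src b = x" "trg b = x" "src b' = x"
  shows "b = \<iota> x"
proof -
  have "b' \<bullet> b \<bullet> b = b" using reassoc1[OF assms(2), of b] by simp
  then show ?thesis by (simp add: assms(1,2))
qed

lemma br_unit_right [simp]: "br x [] = \<iota> x"
proof -
  have "br x [] \<bullet> br x [] = br x []" using br_tens_right[of x "[]" "[]", symmetric] by simp
  then show ?thesis by (rule iso_idem_eq_idt[of _ "ibr x []"]) (use ibr_br[of x "[]"] in simp_all)
qed

lemma br_unit_left [simp]: "br [] x = \<iota> x"
proof -
  have "br [] x \<bullet> br [] x = br [] x" using br_tens_left[of "[]" "[]" x, symmetric] by simp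
  then show ?thesis by (rule iso_idem_eq_idt[of _ "ibr [] x"]) (use ibr_br[of "[]" x] in simp_all)
qed

lemma ibr_tens_right: "ibr x (y @ z) = (ibr x y \<odot> \<iota> z) \<bullet> (\<iota> y \<odot> ibr x z)" (is "_ = ?r")
proof -
  have "br x (y @ z) \<bullet> ?r = (\<iota> y \<odot> br x z) \<bullet> (br x y \<odot> \<iota> z) \<bullet> (ibr x y \<odot> \<iota> z) \<bullet> (\<iota> y \<odot> ibr x z)"
    by (simp add: br_tens_right)
  also have "(br x y \<odot> \<iota> z) \<bullet> (ibr x y \<odot> \<iota> z) \<bullet> (\<iota> y \<odot> ibr x z) = \<iota> y \<odot> ibr x z"
    using reassoc1[OF br_ibr_whisker[of "[]" x y z], of "\<iota> y \<odot> ibr x z"] by simp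
  also have "(\<iota> y \<odot> br x z) \<bullet> (\<iota> y \<odot> ibr x z) = \<iota> (y @ z @ x)"
    using br_ibr_whisker[of y x z "[]"] by simp
  finally have "ibr x (y @ z) \<bullet> br x (y @ z) \<bullet> ?r = ibr x (y @ z)"
    by simp
  then show ?thesis by simp
qed

text \<open>A strand can be pulled across the cap \<open>e\<close>; it then crosses the other leg
  with the opposite crossing. The reason is naturality of the braiding at \<open>e\<close>, whose
  target braids trivially. \<open>ibr_eval\<close> is the mirror image.\<close>

lemma br_eval:
  assumes [simp]: "arr e" "src e = a @ b" "trg e = []"
  shows "(e \<odot> \<iota> y) \<bullet> (\<iota> a \<odot> br y b) = (\<iota> y \<odot> e) \<bullet> (ibr y a \<odot> \<iota> b)"
proof -
  have "(e \<odot> \<iota> y) \<bullet> (\<iota> a \<odot> br y b)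
     = (e \<odot> \<iota> y) \<bullet> (\<iota> a \<odot> br y b) \<bullet> (br y a \<odot> \<iota> b) \<bullet> (ibr y a \<odot> \<iota> b)"
    using br_ibr_whisker[of "[]" y a b] by simp
  also have "(\<iota> a \<odot> br y b) \<bullet> (br y a \<odot> \<iota> b) \<bullet> (ibr y a \<odot> \<iota> b) = br y (a @ b) \<bullet> (ibr y a \<odot> \<iota> b)"
    by (simp add: br_tens_right)
  also have "(e \<odot> \<iota> y) \<bullet> br y (a @ b) \<bullet> (ibr y a \<odot> \<iota> b) = (\<iota> y \<odot> e) \<bullet> (ibr y a \<odot> \<iota> b)"
    using reassoc1[of "e \<odot> \<iota> y" "br y (a @ b)" "\<iota> y \<odot> e" "ibr y a \<odot> \<iota> b"] br_natural[of "\<iota> y" e] by simp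
  finally show ?thesis .
qed

lemma ibr_eval:
  assumes [simp]: "arr e" "src e = a @ b" "trg e = []"
  shows "(e \<odot> \<iota> y) \<bullet> (\<iota> a \<odot> ibr b y) = (\<iota> y \<odot> e) \<bullet> (br a y \<odot> \<iota> b)"
proof -
  have "(\<iota> y \<odot> e) \<bullet> (br a y \<odot> \<iota> b)
     = (\<iota> y \<odot> e) \<bullet> (br a y \<odot> \<iota> b) \<bullet> (\<iota> a \<odot> br b y) \<bullet> (\<iota> a \<odot> ibr b y)"
    using br_ibr_whisker[of a b y "[]"] by simp
  also have "(br a y \<odot> \<iota> b) \<bullet> (\<iota> a \<odot> br b y) \<bullet> (\<iota> a \<odot> ibr b y) = br (a @ b) y \<bullet> (\<iota> a \<odot> ibr b y)"
    by (simp add: br_tens_left)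
  also have "(\<iota> y \<odot> e) \<bullet> br (a @ b) y \<bullet> (\<iota> a \<odot> ibr b y) = (e \<odot> \<iota> y) \<bullet> (\<iota> a \<odot> ibr b y)"
    using reassoc1[of "\<iota> y \<odot> e" "br (a @ b) y" "e \<odot> \<iota> y" "\<iota> a \<odot> ibr b y"] br_natural[of e "\<iota> y"] by simp
  finally show ?thesis by simp
qed

text \<open>In a braided category left duals are also right duals: crossing the legs of
  \<open>e\<close> and \<open>c\<close> exchanges the roles of \<open>x\<close> and
  \<open>y\<close>.\<close>

lemma dual_pair_flip:
  assumes dp: "dual_pair x y e c"
  shows "dual_pair y x (e \<bullet> br x y) (ibr y x \<bullet> c)"
proof -
  note [simp] = dual_pairD(1-6)[OF dp]
  have 1: "(\<iota> y \<odot> e) \<bullet> (\<iota> y \<odot> br x y) \<bullet> (ibr y x \<odot> \<iota> y) \<bullet> (c \<odot> \<iota> y) = \<iota> y"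
  proof -
    \<comment> \<open>A cancelling pair of crossings of the two \<open>y\<close> strands is
      inserted. One half lets naturality pull \<open>c\<close> across a strand \<open>y\<close>; the
      other completes \<open>ibr y x\<close> to the inverse braiding of \<open>y\<close> with
      \<open>x @ y\<close>.\<close>
    have "(c \<odot> \<iota> y) = (\<iota> x \<odot> ibr y y) \<bullet> (\<iota> x \<odot> br y y) \<bullet> (c \<odot> \<iota> y)"
      using reassoc1[OF ibr_br_whisker[of x y y "[]"], of "c \<odot> \<iota> y"] by simp
    also have "(\<iota> x \<odot> br y y) \<bullet> (c \<odot> \<iota> y) = (ibr x y \<odot> \<iota> y) \<bullet> (\<iota> y \<odot> c)"
    proof -
      have "(\<iota> x \<odot> br y y) \<bullet> (c \<odot> \<iota> y)
         = (ibr x y \<odot> \<iota> y) \<bullet> (br x y \<odot> \<iota> y) \<bullet> (\<iota> x \<odot> br y y) \<bullet> (c \<odot> \<iota> y)"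
        using reassoc1[OF ibr_br_whisker[of "[]" x y y], of "(\<iota> x \<odot> br y y) \<bullet> (c \<odot> \<iota> y)"] by simp
      also have "(br x y \<odot> \<iota> y) \<bullet> (\<iota> x \<odot> br y y) \<bullet> (c \<odot> \<iota> y) = br (x @ y) y \<bullet> (c \<odot> \<iota> y)"
        by (simp add: br_tens_left)
      also have "\<dots> = \<iota> y \<odot> c"
        using br_natural[of c "\<iota> y"] by simp
      finally show ?thesis .
    qed
    finally have "(ibr y x \<odot> \<iota> y) \<bullet> (c \<odot> \<iota> y) =
        (ibr y x \<odot> \<iota> y) \<bullet> (\<iota> x \<odot> ibr y y) \<bullet> (ibr x y \<odot> \<iota> y) \<bullet> (\<iota> y \<odot> c)" by simp
    also have "\<dots> = ibr y (x @ y) \<bullet> (ibr x y \<odot> \<iota> y) \<bullet> (\<iota> y \<odot> c)"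
      by (simp add: ibr_tens_right)
    also have "\<dots> = (\<iota> y \<odot> ibr x y) \<bullet> ibr y (y @ x) \<bullet> (\<iota> y \<odot> c)"
      using reassoc[of "ibr y (x @ y)" "ibr x y \<odot> \<iota> y" "\<iota> y \<odot> ibr x y" "ibr y (y @ x)" "\<iota> y \<odot> c"]
        ibr_natural[of "\<iota> y" "ibr x y"] by simp
    finally have "(\<iota> y \<odot> br x y) \<bullet> (ibr y x \<odot> \<iota> y) \<bullet> (c \<odot> \<iota> y) = ibr y (y @ x) \<bullet> (\<iota> y \<odot> c)"
      using reassoc1[OF br_ibr_whisker[of y x y "[]"], of "ibr y (y @ x) \<bullet> (\<iota> y \<odot> c)"] by simp
    moreover have "(\<iota> y \<odot> e) \<bullet> ibr y (y @ x) \<bullet> (\<iota> y \<odot> c) = (e \<odot> \<iota> y) \<bullet> (\<iota> y \<odot> c)"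
    proof -
      have "(\<iota> y \<odot> e) \<bullet> ibr y (y @ x) = (e \<odot> \<iota> y)"
        using ibr_natural[of "\<iota> y" e] ibr_br[of y "[]"] by simp
      from reassoc1[OF this, of "\<iota> y \<odot> c"] show ?thesis by simp
    qed
    ultimately show ?thesis using dual_pairD(8)[OF dp] by simp
  qed
  have 2: "(e \<odot> \<iota> x) \<bullet> (br x y \<odot> \<iota> x) \<bullet> (\<iota> x \<odot> ibr y x) \<bullet> (\<iota> x \<odot> c) = \<iota> x"
  proof -
    have "(e \<odot> \<iota> x) \<bullet> (br x y \<odot> \<iota> x) \<bullet> (\<iota> x \<odot> ibr y x) \<bullet> (\<iota> x \<odot> c)
       = (\<iota> x \<odot> e) \<bullet> (\<iota> x \<odot> br x y) \<bullet> (br x x \<odot> \<iota> y) \<bullet> (\<iota> x \<odot> c)"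
      using reassoc[OF ibr_eval[of "e \<bullet> br x y" x y x], of "\<iota> x \<odot> c"] by simp
    also have "(\<iota> x \<odot> br x y) \<bullet> (br x x \<odot> \<iota> y) \<bullet> (\<iota> x \<odot> c) = br x (x @ y) \<bullet> (\<iota> x \<odot> c)"
      by (simp add: br_tens_right)
    also have "br x (x @ y) \<bullet> (\<iota> x \<odot> c) = c \<odot> \<iota> x"
      using br_natural[of "\<iota> x" c] by simp
    finally show ?thesis using dual_pairD(7)[OF dp] by simp
  qed
  show ?thesis using 1 2 by (simp add: dual_pair_def)
qed

text \<open>An evaluation with its legs in the order \<open>x\<close>, \<open>y\<close>. The twist
  undoes the framing of the kink made by the braiding, so loops closed with it are 0-framed.\<close>

definition tev :: "'o list \<Rightarrow> 'o list \<Rightarrow> 'a \<Rightarrow> 'a" where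
  "tev x y e = e \<bullet> br x y \<bullet> (tw x \<odot> \<iota> y)"

lemma arr_tev [simp]:
  assumes "arr e" "src e = y @ x" "trg e = []"
  shows "arr (tev x y e)" "src (tev x y e) = x @ y" "trg (tev x y e) = []"
  using assms by (auto simp: tev_def)

text \<open>For an identity \<open>g\<close>, this says that the trace does not depend on the dual used to close the strand.\<close>

lemma trace_cyclic:
  assumes dp: "dual_pair x y e c" "dual_pair x' y' e' c'"
    and f: "arr f" "src f = x" "trg f = x'" and g: "arr g" "src g = x'" "trg g = x"
  shows "tev x y e \<bullet> ((g \<bullet> f) \<odot> \<iota> y) \<bullet> c = tev x' y' e' \<bullet> ((f \<bullet> g) \<odot> \<iota> y') \<bullet> c'"
proof -
  define m where "m = mate e' c f y' y"
  note [simp] = dual_pairD(1-6)[OF dp(1)] dual_pairD(1-6)[OF dp(2)] f g mate_arr[OF dp f, folded m_def]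
  \<comment> \<open>\<open>f\<close> travels around the loop as its transpose \<open>m\<close>: it
    is pushed through the coevaluation, passes \<open>g\<close> on the dual strand and reappears as
    \<open>f\<close> at the other evaluation.\<close>
  have "tev x y e \<bullet> ((g \<bullet> f) \<odot> \<iota> y) \<bullet> c = tev x y e \<bullet> (g \<odot> \<iota> y) \<bullet> (\<iota> x' \<odot> m) \<bullet> c'"
    by (simp add: mate_coev[OF dp f, folded m_def])
  also have "(g \<odot> \<iota> y) \<bullet> (\<iota> x' \<odot> m) \<bullet> c' = (\<iota> x \<odot> m) \<bullet> (g \<odot> \<iota> y') \<bullet> c'"
    using reassoc[OF slide[of g m x' y x y'], of c'] by simp
  also have "tev x y e \<bullet> (\<iota> x \<odot> m) \<bullet> (g \<odot> \<iota> y') \<bullet> c' = tev x' y' e' \<bullet> (f \<odot> \<iota> y') \<bullet> (g \<odot> \<iota> y') \<bullet> c'"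
  proof -
    have "tev x y e \<bullet> (\<iota> x \<odot> m) = e \<bullet> br x y \<bullet> (\<iota> x \<odot> m) \<bullet> (tw x \<odot> \<iota> y')"
      using slide[of "tw x" m x y x y'] by (simp add: tev_def)
    also have "br x y \<bullet> (\<iota> x \<odot> m) \<bullet> (tw x \<odot> \<iota> y') = (m \<odot> \<iota> x) \<bullet> br x y' \<bullet> (tw x \<odot> \<iota> y')"
      using reassoc[of "br x y" "\<iota> x \<odot> m" "m \<odot> \<iota> x" "br x y'" "tw x \<odot> \<iota> y'"] br_natural[of "\<iota> x" m] by simp
    also have "e \<bullet> (m \<odot> \<iota> x) \<bullet> br x y' \<bullet> (tw x \<odot> \<iota> y') = e' \<bullet> (\<iota> y' \<odot> f) \<bullet> br x y' \<bullet> (tw x \<odot> \<iota> y')"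
      using reassoc[OF mate_ev[OF dp f, folded m_def], of "br x y' \<bullet> (tw x \<odot> \<iota> y')"] by simp
    also have "(\<iota> y' \<odot> f) \<bullet> br x y' \<bullet> (tw x \<odot> \<iota> y') = br x' y' \<bullet> (f \<odot> \<iota> y') \<bullet> (tw x \<odot> \<iota> y')"
      using reassoc[of "br x' y'" "f \<odot> \<iota> y'" "\<iota> y' \<odot> f" "br x y'" "tw x \<odot> \<iota> y'"] br_natural[of f "\<iota> y'"] by simp
    also have "(f \<odot> \<iota> y') \<bullet> (tw x \<odot> \<iota> y') = (tw x' \<odot> \<iota> y') \<bullet> (f \<odot> \<iota> y')"
      using arg_cong[OF tw_natural[of f], of "\<lambda>t. t \<odot> \<iota> y'"] by simp
    finally have "tev x y e \<bullet> (\<iota> x \<odot> m) = tev x' y' e' \<bullet> (f \<odot> \<iota> y')"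
      by (simp add: tev_def)
    from reassoc[OF this, of "(g \<odot> \<iota> y') \<bullet> c'"] show ?thesis by simp
  qed
  finally show ?thesis by simp
qed

text \<open>Closing \<open>x @ x'\<close> with a single braiding makes the two loops cross.
  \<open>br_eval\<close> gathers these crossings into two inverse braidings of \<open>x\<close> with
  \<open>x'\<close>, and they cancel the double braiding contained in the twist of
  \<open>x @ x'\<close>.\<close>

lemma tev_tens:
  assumes dp: "dual_pair x y e c" "dual_pair x' y' e' c'"
  shows "tev (x @ x') (y' @ y) (e' \<bullet> (\<iota> y' \<odot> e \<odot> \<iota> x')) = tev x y e \<bullet> (\<iota> x \<odot> tev x' y' e' \<odot> \<iota> y)"
proof -
  note [simp] = dual_pairD(1-6)[OF dp(1)] dual_pairD(1-6)[OF dp(2)]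
  define k where "k = e \<bullet> br x y"
  define k' where "k' = e' \<bullet> br x' y'"
  have [simp]: "arr k" "src k = x @ y" "trg k = []" "arr k'" "src k' = x' @ y'" "trg k' = []"
    by (simp_all add: k_def k'_def)
  have A: "(\<iota> y' \<odot> k \<odot> \<iota> x') \<bullet> (\<iota> (y' @ x) \<odot> br x' y) = (\<iota> (y' @ x') \<odot> k) \<bullet> (\<iota> y' \<odot> ibr x' x \<odot> \<iota> y)"
    using arg_cong[OF br_eval[of k x y x'], of "\<lambda>t. \<iota> y' \<odot> t"] by simp
  have B: "(\<iota> y' \<odot> ibr x' x) \<bullet> br (x @ x') y' = (br x' y' \<odot> \<iota> x) \<bullet> (\<iota> x' \<odot> br x y') \<bullet> (ibr x' x \<odot> \<iota> y')"
    using br_natural[of "ibr x' x" "\<iota> y'"] br_tens_left[of x' x y'] by simp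
  have B': "(\<iota> y' \<odot> ibr x' x \<odot> \<iota> y) \<bullet> (br (x @ x') y' \<odot> \<iota> y)
      = (br x' y' \<odot> \<iota> (x @ y)) \<bullet> (\<iota> x' \<odot> br x y' \<odot> \<iota> y) \<bullet> (ibr x' x \<odot> \<iota> (y' @ y))"
    using arg_cong[OF B, of "\<lambda>t. t \<odot> \<iota> y"] by simp
  have A': "(k' \<odot> \<iota> (x @ y)) \<bullet> (\<iota> x' \<odot> br x y' \<odot> \<iota> y) = (\<iota> x \<odot> k' \<odot> \<iota> y) \<bullet> (ibr x x' \<odot> \<iota> (y' @ y))"
    using arg_cong[OF br_eval[of k' x' y' x], of "\<lambda>t. t \<odot> \<iota> y"] by simp
  have C: "ibr x x' \<bullet> ibr x' x \<bullet> tw (x @ x') = tw x \<odot> tw x'"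
    by (simp add: tw_tens)
  let ?T = "tw (x @ x') \<odot> \<iota> (y' @ y)"
  have "tev (x @ x') (y' @ y) (e' \<bullet> (\<iota> y' \<odot> e \<odot> \<iota> x'))
      = e' \<bullet> (\<iota> y' \<odot> k \<odot> \<iota> x') \<bullet> (\<iota> (y' @ x) \<odot> br x' y) \<bullet> (br (x @ x') y' \<odot> \<iota> y) \<bullet> ?T"
    by (simp add: tev_def k_def br_tens_right br_tens_left[of x x' y])
  also have "(\<iota> y' \<odot> k \<odot> \<iota> x') \<bullet> (\<iota> (y' @ x) \<odot> br x' y) \<bullet> (br (x @ x') y' \<odot> \<iota> y) \<bullet> ?T
     = (\<iota> (y' @ x') \<odot> k) \<bullet> (\<iota> y' \<odot> ibr x' x \<odot> \<iota> y) \<bullet> (br (x @ x') y' \<odot> \<iota> y) \<bullet> ?T"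
    using reassoc[OF A, of "(br (x @ x') y' \<odot> \<iota> y) \<bullet> ?T"] by simp
  also have "(\<iota> y' \<odot> ibr x' x \<odot> \<iota> y) \<bullet> (br (x @ x') y' \<odot> \<iota> y) \<bullet> ?T
     = (br x' y' \<odot> \<iota> (x @ y)) \<bullet> (\<iota> x' \<odot> br x y' \<odot> \<iota> y) \<bullet> (ibr x' x \<odot> \<iota> (y' @ y)) \<bullet> ?T"
    using reassoc1[OF B', of ?T] by simp
  also have "(\<iota> (y' @ x') \<odot> k) \<bullet> (br x' y' \<odot> \<iota> (x @ y)) \<bullet> (\<iota> x' \<odot> br x y' \<odot> \<iota> y) \<bullet> (ibr x' x \<odot> \<iota> (y' @ y)) \<bullet> ?T
    = br x' y' \<bullet> (\<iota> (x' @ y') \<odot> k) \<bullet> (\<iota> x' \<odot> br x y' \<odot> \<iota> y) \<bullet> (ibr x' x \<odot> \<iota> (y' @ y)) \<bullet> ?T"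
    using reassoc[OF slide[of "br x' y'" k "x' @ y'" "[]" "y' @ x'" "x @ y", symmetric],
        of "(\<iota> x' \<odot> br x y' \<odot> \<iota> y) \<bullet> (ibr x' x \<odot> \<iota> (y' @ y)) \<bullet> ?T"] by simp
  also have "e' \<bullet> br x' y' \<bullet> (\<iota> (x' @ y') \<odot> k) \<bullet> (\<iota> x' \<odot> br x y' \<odot> \<iota> y) \<bullet> (ibr x' x \<odot> \<iota> (y' @ y)) \<bullet> ?T
    = k' \<bullet> (\<iota> (x' @ y') \<odot> k) \<bullet> (\<iota> x' \<odot> br x y' \<odot> \<iota> y) \<bullet> (ibr x' x \<odot> \<iota> (y' @ y)) \<bullet> ?T"
    by (simp add: k'_def)
  also have "\<dots> = k \<bullet> (k' \<odot> \<iota> (x @ y)) \<bullet> (\<iota> x' \<odot> br x y' \<odot> \<iota> y) \<bullet> (ibr x' x \<odot> \<iota> (y' @ y)) \<bullet> ?T"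
    using reassoc[OF slide[of k' k "x' @ y'" "[]" "[]" "x @ y"],
        of "(\<iota> x' \<odot> br x y' \<odot> \<iota> y) \<bullet> (ibr x' x \<odot> \<iota> (y' @ y)) \<bullet> ?T"] by simp
  also have "(k' \<odot> \<iota> (x @ y)) \<bullet> (\<iota> x' \<odot> br x y' \<odot> \<iota> y) \<bullet> (ibr x' x \<odot> \<iota> (y' @ y)) \<bullet> ?T
     = (\<iota> x \<odot> k' \<odot> \<iota> y) \<bullet> (ibr x x' \<odot> \<iota> (y' @ y)) \<bullet> (ibr x' x \<odot> \<iota> (y' @ y)) \<bullet> ?T"
    using reassoc[OF A', of "(ibr x' x \<odot> \<iota> (y' @ y)) \<bullet> ?T"] by simp
  also have "(ibr x x' \<odot> \<iota> (y' @ y)) \<bullet> (ibr x' x \<odot> \<iota> (y' @ y)) \<bullet> ?T = (tw x \<odot> tw x') \<odot> \<iota> (y' @ y)"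
    by (subst C[symmetric]) simp
  also have "\<dots> = (tw x \<odot> \<iota> (x' @ y' @ y)) \<bullet> (\<iota> x \<odot> tw x' \<odot> \<iota> (y' @ y))"
    using tens_right_left[of "tw x" "tw x' \<odot> \<iota> (y' @ y)"] by simp
  also have "(\<iota> x \<odot> k' \<odot> \<iota> y) \<bullet> (tw x \<odot> \<iota> (x' @ y' @ y)) \<bullet> (\<iota> x \<odot> tw x' \<odot> \<iota> (y' @ y))
     = (tw x \<odot> \<iota> y) \<bullet> (\<iota> x \<odot> k' \<odot> \<iota> y) \<bullet> (\<iota> x \<odot> tw x' \<odot> \<iota> (y' @ y))"
    using reassoc[OF slide[of "tw x" "k' \<odot> \<iota> y" x y x "x' @ y' @ y"], of "\<iota> x \<odot> tw x' \<odot> \<iota> (y' @ y)"] by simp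
  finally show ?thesis
    by (simp add: tev_def k_def k'_def)
qed

text \<open>The partial trace over the last factor; the strands \<open>a\<close> stay open.\<close>

definition ptr :: "'o list \<Rightarrow> 'o list \<Rightarrow> 'o list \<Rightarrow> 'a \<Rightarrow> 'a \<Rightarrow> 'a \<Rightarrow> 'a" where
  "ptr a x y e c f = (\<iota> a \<odot> tev x y e) \<bullet> (f \<odot> \<iota> y) \<bullet> (\<iota> a \<odot> c)"

text \<open>By \<open>tev_tens\<close> the loop of \<open>x'\<close> is nested inside the loop of
  \<open>x\<close> and can be closed first.\<close>

lemma trace_tens:
  assumes dp: "dual_pair x y e c" "dual_pair x' y' e' c'"
    and [simp]: "arr f" "src f = x @ x'" "trg f = x @ x'"
  shows "tev (x @ x') (y' @ y) (e' \<bullet> (\<iota> y' \<odot> e \<odot> \<iota> x')) \<bullet> (f \<odot> \<iota> (y' @ y)) \<bullet> (\<iota> x \<odot> c' \<odot> \<iota> y) \<bullet> c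
    = tev x y e \<bullet> (ptr x x' y' e' c' f \<odot> \<iota> y) \<bullet> c"
proof -
  note [simp] = dual_pairD(1-6)[OF dp(1)] dual_pairD(1-6)[OF dp(2)]
  show ?thesis unfolding tev_tens[OF dp] ptr_def by simp
qed

section \<open>Transparent objects\<close>

definition is_transparent :: "'o list \<Rightarrow> bool" where
  "is_transparent x \<longleftrightarrow> (\<forall>y. br y x \<bullet> br x y = \<iota> (x @ y))"

text \<open>Transparency says that over- and undercrossings coincide. \<open>br_eval\<close> and
  \<open>ibr_eval\<close> carry this across the cap from \<open>y\<close> to \<open>x\<close>, and
  \<open>ev_cancel\<close> removes the cap.\<close>

lemma is_transparent_dual:
  assumes dp: "dual_pair x y e c" and t: "is_transparent y"
  shows "is_transparent x"
  unfolding is_transparent_def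
proof
  fix z
  note [simp] = dual_pairD(1-6)[OF dp]
  have "br y z = ibr z y \<bullet> br z y \<bullet> br y z" by simp
  also have "br z y \<bullet> br y z = \<iota> (y @ z)" using t by (simp add: is_transparent_def)
  finally have "br y z = ibr z y" by simp
  then have "br z x = ibr x z"
    using br_eval[of e y x z] ibr_eval[of e y x z]
    by - (rule ev_cancel[OF dp, of _ _ z "z @ x"], simp_all)
  then show "br z x \<bullet> br x z = \<iota> (x @ z)" by simp
qed

lemma br_br_natural:
  assumes [simp]: "arr f" "arr g"
  shows "br (trg g) (trg f) \<bullet> br (trg f) (trg g) \<bullet> (f \<odot> g) = (f \<odot> g) \<bullet> br (src g) (src f) \<bullet> br (src f) (src g)"
proof -
  have "br (trg g) (trg f) \<bullet> br (trg f) (trg g) \<bullet> (f \<odot> g) = br (trg g) (trg f) \<bullet> (g \<odot> f) \<bullet> br (src f) (src g)"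
    by (simp add: br_natural)
  also have "\<dots> = (f \<odot> g) \<bullet> br (src g) (src f) \<bullet> br (src f) (src g)"
    using reassoc[OF br_natural[of g f], of "br (src f) (src g)"] by simp
  finally show ?thesis .
qed

lemma is_transparent_retract:
  assumes t: "is_transparent x" and [simp]: "arr e" "arr p" "src e = l" "trg e = x" "src p = x" "trg p = l"
    and pe: "p \<bullet> e = \<iota> l"
  shows "is_transparent l"
  unfolding is_transparent_def
proof
  fix y
  have "br y l \<bullet> br l y = br y l \<bullet> br l y \<bullet> (p \<odot> \<iota> y) \<bullet> (e \<odot> \<iota> y)"
    using whisker_both[OF pe, of "[]" y] by simp
  also have "\<dots> = (p \<odot> \<iota> y) \<bullet> br y x \<bullet> br x y \<bullet> (e \<odot> \<iota> y)"
  proof -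
    have "(br y l \<bullet> br l y \<bullet> (p \<odot> \<iota> y)) \<bullet> (e \<odot> \<iota> y) = ((p \<odot> \<iota> y) \<bullet> br y x \<bullet> br x y) \<bullet> (e \<odot> \<iota> y)"
      using br_br_natural[of p "\<iota> y"] by (intro arg_cong[of _ _ "\<lambda>t. t \<bullet> _"]) simp
    then show ?thesis by simp
  qed
  also have "br y x \<bullet> br x y \<bullet> (e \<odot> \<iota> y) = e \<odot> \<iota> y"
    using t reassoc1[of "br y x" "br x y" "\<iota> (x @ y)" "e \<odot> \<iota> y"] by (simp add: is_transparent_def)
  also have "(p \<odot> \<iota> y) \<bullet> (e \<odot> \<iota> y) = \<iota> (l @ y)"
    using whisker_both[OF pe, of "[]" y] by simp
  finally show "br y l \<bullet> br l y = \<iota> (l @ y)" .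
qed

text \<open>The double braiding with \<open>x\<close> sits between the two halves of the double
  braiding with \<open>y\<close>. This serves both the closure of transparency under products and
  the multiplicativity of Hopf links.\<close>

lemma br_br_tens_left:
  "br z (x @ y) \<bullet> br (x @ y) z = (\<iota> x \<odot> br z y) \<bullet> ((br z x \<bullet> br x z) \<odot> \<iota> y) \<bullet> (\<iota> x \<odot> br y z)"
  unfolding br_tens_left[of x y z] br_tens_right[of z x y] by simp

lemma is_transparent_tens:
  assumes "is_transparent x" "is_transparent y"
  shows "is_transparent (x @ y)"
  unfolding is_transparent_def
proof
  fix z
  show "br z (x @ y) \<bullet> br (x @ y) z = \<iota> ((x @ y) @ z)"
    unfolding br_br_tens_left using assms whisker_both[of "br z y" "br y z" "\<iota> (y @ z)" x "[]"]
    unfolding is_transparent_def by simp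
qed

lemma is_transparent_unit: "is_transparent []"
  by (simp add: is_transparent_def)

end

section \<open>Strict ribbon fusion categories\<close>

text \<open>A relation among the columns of the integer matrix \<open>\<Sum>i. N\<^sub>i N\<^sub>i\<^sup>T\<close> over \<open>k\<close> yields a rational
  one through a \<open>\<rat>\<close>-linear functional on \<open>k\<close>, and the matrix is positive definite.\<close>

lemma sum_squares_character_nonzero:
  fixes d :: "'a \<Rightarrow> 'k::field_char_0" and n :: "'a \<Rightarrow> 'a \<Rightarrow> 'a \<Rightarrow> nat"
  assumes fin: "finite X" and u: "u \<in> X" "d u \<noteq> 0"
    and unit: "\<And>j l. \<lbrakk>j \<in> X; l \<in> X\<rbrakk> \<Longrightarrow> n u j l = (if j = l then 1 else 0)"
    and mult: "\<And>i j. \<lbrakk>i \<in> X; j \<in> X\<rbrakk> \<Longrightarrow> (\<Sum>l\<in>X. of_nat (n i j l) * d l) = d i * d j"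
    and dual: "\<And>i l. \<lbrakk>i \<in> X; l \<in> X\<rbrakk> \<Longrightarrow> (\<Sum>m\<in>X. of_nat (n i m l) * d m) = d i * d l"
  shows "(\<Sum>i\<in>X. (d i)\<^sup>2) \<noteq> 0"
proof
  assume 0: "(\<Sum>i\<in>X. (d i)\<^sup>2) = 0"
  interpret Q: vector_space "\<lambda>(q::rat) (x::'k). of_rat q * x"
    by unfold_locales (auto simp: algebra_simps of_rat_add of_rat_mult)
  interpret QQ: vector_space_pair "\<lambda>(q::rat) (x::'k). of_rat q * x" "\<lambda>(q::rat) (x::rat). q * x"
    by unfold_locales (auto simp: algebra_simps)
  have ind: "\<not> Q.dependent {d u}" using u(2) by (subst Q.dependent_single)
  \<comment> \<open>As \<open>d u\<close> is nonzero, a rational functional can take the value 1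
    there; this normalisation is contradicted at the end.\<close>
  define \<phi> where "\<phi> = QQ.construct {d u} (\<lambda>_. 1)"
  have lin: "Vector_Spaces.linear (\<lambda>(q::rat) (x::'k). of_rat q * x) (\<lambda>(q::rat) (x::rat). q * x) \<phi>"
    unfolding \<phi>_def by (rule QQ.linear_construct[OF ind])
  have \<phi>u: "\<phi> (d u) = 1" unfolding \<phi>_def by (rule QQ.construct_basis[OF ind]) simp
  have \<phi>_sum: "\<phi> (\<Sum>j\<in>A. of_nat (c j) * f j) = (\<Sum>j\<in>A. of_nat (c j) * \<phi> (f j))" for A c and f :: "'a \<Rightarrow> 'k"
  proof -
    have "\<phi> (\<Sum>j\<in>A. of_nat (c j) * f j) = (\<Sum>j\<in>A. \<phi> (of_rat (of_nat (c j)) * f j))"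
      by (simp add: QQ.linear_sum[OF lin])
    also have "\<dots> = (\<Sum>j\<in>A. of_nat (c j) * \<phi> (f j))"
      by (simp only: QQ.linear_scale[OF lin])
    finally show ?thesis .
  qed
  define x where "x j = \<phi> (d j)" for j
  \<comment> \<open>\<open>d\<close> is an eigenvector of the matrix, with the sum of squares as
    eigenvalue, hence in the kernel by assumption. Applying \<open>\<phi>\<close> transfers the
    relation to the rational vector \<open>x\<close>.\<close>
  have "(\<Sum>i\<in>X. \<Sum>l\<in>X. of_nat (n i j l) * (\<Sum>m\<in>X. of_nat (n i m l) * x m)) = 0" if j: "j \<in> X" for j
  proof -
    have "(\<Sum>m\<in>X. of_nat (\<Sum>i\<in>X. \<Sum>l\<in>X. n i j l * n i m l) * d m)
        = (\<Sum>m\<in>X. \<Sum>i\<in>X. \<Sum>l\<in>X. of_nat (n i j l) * (of_nat (n i m l) * d m))"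
      by (simp add: sum_distrib_right mult.assoc)
    also have "\<dots> = (\<Sum>i\<in>X. \<Sum>m\<in>X. \<Sum>l\<in>X. of_nat (n i j l) * (of_nat (n i m l) * d m))"
      by (rule sum.swap)
    also have "\<dots> = (\<Sum>i\<in>X. \<Sum>l\<in>X. \<Sum>m\<in>X. of_nat (n i j l) * (of_nat (n i m l) * d m))"
      by (rule sum.cong[OF refl], rule sum.swap)
    also have "\<dots> = (\<Sum>i\<in>X. \<Sum>l\<in>X. of_nat (n i j l) * (d i * d l))"
      by (simp add: dual flip: sum_distrib_left)
    also have "\<dots> = (\<Sum>i\<in>X. d i * (d i * d j))"
      by (simp add: mult j algebra_simps flip: sum_distrib_left)
         (simp add: mult[OF _ j, symmetric] sum_distrib_left algebra_simps)
    also have "\<dots> = 0"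
      using 0 by (simp add: power2_eq_square sum_distrib_right[symmetric] flip: mult.assoc)
    finally have "\<phi> (\<Sum>m\<in>X. of_nat (\<Sum>i\<in>X. \<Sum>l\<in>X. n i j l * n i m l) * d m) = 0"
      by (simp add: QQ.linear_0[OF lin])
    then have "(\<Sum>m\<in>X. of_nat (\<Sum>i\<in>X. \<Sum>l\<in>X. n i j l * n i m l) * x m) = 0"
      unfolding \<phi>_sum x_def .
    moreover have "(\<Sum>m\<in>X. of_nat (\<Sum>i\<in>X. \<Sum>l\<in>X. n i j l * n i m l) * x m)
        = (\<Sum>m\<in>X. \<Sum>i\<in>X. \<Sum>l\<in>X. of_nat (n i j l) * (of_nat (n i m l) * x m))"
      by (simp only: of_nat_sum of_nat_mult sum_distrib_right mult.assoc)
    moreover have "\<dots> = (\<Sum>i\<in>X. \<Sum>m\<in>X. \<Sum>l\<in>X. of_nat (n i j l) * (of_nat (n i m l) * x m))"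
      by (rule sum.swap)
    moreover have "\<dots> = (\<Sum>i\<in>X. \<Sum>l\<in>X. \<Sum>m\<in>X. of_nat (n i j l) * (of_nat (n i m l) * x m))"
      by (rule sum.cong[OF refl], rule sum.swap)
    ultimately show ?thesis by (simp only: sum_distrib_left)
  qed
  \<comment> \<open>Pairing the relation with \<open>x\<close> itself produces a sum of rational
    squares.\<close>
  then have "0 = (\<Sum>j\<in>X. x j * (\<Sum>i\<in>X. \<Sum>l\<in>X. of_nat (n i j l) * (\<Sum>m\<in>X. of_nat (n i m l) * x m)))"
    by simp
  also have "\<dots> = (\<Sum>j\<in>X. \<Sum>i\<in>X. \<Sum>l\<in>X. (of_nat (n i j l) * x j) * (\<Sum>m\<in>X. of_nat (n i m l) * x m))"
    by (simp only: sum_distrib_left mult_ac)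
  also have "\<dots> = (\<Sum>i\<in>X. \<Sum>j\<in>X. \<Sum>l\<in>X. (of_nat (n i j l) * x j) * (\<Sum>m\<in>X. of_nat (n i m l) * x m))"
    by (rule sum.swap)
  also have "\<dots> = (\<Sum>i\<in>X. \<Sum>l\<in>X. \<Sum>j\<in>X. (of_nat (n i j l) * x j) * (\<Sum>m\<in>X. of_nat (n i m l) * x m))"
    by (rule sum.cong[OF refl], rule sum.swap)
  also have "\<dots> = (\<Sum>i\<in>X. \<Sum>l\<in>X. (\<Sum>m\<in>X. of_nat (n i m l) * x m)\<^sup>2)"
    by (simp add: power2_eq_square flip: sum_distrib_right)
  \<comment> \<open>Only the block \<open>i = u\<close> is kept: by \<open>unit\<close> it is an
    identity matrix, so its vanishing forces \<open>x u = 0\<close>.\<close>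
  finally have "(\<Sum>l\<in>X. (\<Sum>m\<in>X. of_nat (n u m l) * x m)\<^sup>2) = 0"
    using fin u(1) by (subst (asm) eq_commute, subst (asm) sum_nonneg_eq_0_iff) (auto intro!: sum_nonneg)
  then have "(\<Sum>m\<in>X. of_nat (n u m u) * x m) = 0"
    using fin u(1) by (subst (asm) sum_nonneg_eq_0_iff) auto
  moreover have "(\<Sum>m\<in>X. of_nat (n u m u) * x m) = (\<Sum>m\<in>X. if m = u then x m else 0)"
    using u(1) unit by (intro sum.cong) auto
  ultimately show False using fin u(1) \<phi>u by (simp add: x_def)
qed

text \<open>\<open>mk x y v\<close> is the candidate arrow \<open>x \<rightarrow> y\<close> with underlying vector \<open>v\<close>; it is an arrow only if \<open>arr\<close> holds of it.
  \<open>R\<close> represents the simple objects, and \<open>u \<in> R\<close> is isomorphic, though not in general equal, to the unit object \<open>[]\<close>.\<close>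

locale strict_ribbon_fusion = strict_ribbon arr src trg comp tens idt br ibr tw + vector_space scale
  for arr :: "'a \<Rightarrow> bool" and src trg :: "'a \<Rightarrow> 'o list"
    and comp :: "'a \<Rightarrow> 'a \<Rightarrow> 'a" (infixr "\<bullet>" 65)
    and tens :: "'a \<Rightarrow> 'a \<Rightarrow> 'a" (infixr "\<odot>" 70)
    and idt :: "'o list \<Rightarrow> 'a" ("\<iota>")
    and br ibr :: "'o list \<Rightarrow> 'o list \<Rightarrow> 'a" and tw :: "'o list \<Rightarrow> 'a"
    and scale :: "'k::field_char_0 \<Rightarrow> 'm::ab_group_add \<Rightarrow> 'm" (infixr "*s" 75) +
  fixes mk :: "'o list \<Rightarrow> 'o list \<Rightarrow> 'm \<Rightarrow> 'a" and vec :: "'a \<Rightarrow> 'm"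
    and R :: "'o list set" and u :: "'o list"
  assumes vec_mk [simp]: "vec (mk x y v) = v"
    and src_mk [simp]: "src (mk x y v) = x"
    and trg_mk [simp]: "trg (mk x y v) = y"
    and mk_vec: "arr f \<Longrightarrow> mk (src f) (trg f) (vec f) = f"
    and arr_zero [simp]: "arr (mk x y 0)"
    and arr_mk_add: "\<lbrakk>arr (mk x y v); arr (mk x y w)\<rbrakk> \<Longrightarrow> arr (mk x y (v + w))"
    and arr_mk_scale: "arr (mk x y v) \<Longrightarrow> arr (mk x y (a *s v))"
    and vec_comp_add_left: "\<lbrakk>arr (mk y z v); arr (mk y z w); arr f; trg f = y\<rbrakk> \<Longrightarrow>
      vec (mk y z (v + w) \<bullet> f) = vec (mk y z v \<bullet> f) + vec (mk y z w \<bullet> f)"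
    and vec_comp_add_right: "\<lbrakk>arr (mk x y v); arr (mk x y w); arr g; src g = y\<rbrakk> \<Longrightarrow>
      vec (g \<bullet> mk x y (v + w)) = vec (g \<bullet> mk x y v) + vec (g \<bullet> mk x y w)"
    and vec_comp_scale_left: "\<lbrakk>arr (mk y z v); arr f; trg f = y\<rbrakk> \<Longrightarrow>
      vec (mk y z (a *s v) \<bullet> f) = a *s vec (mk y z v \<bullet> f)"
    and vec_comp_scale_right: "\<lbrakk>arr (mk x y v); arr g; src g = y\<rbrakk> \<Longrightarrow>
      vec (g \<bullet> mk x y (a *s v)) = a *s vec (g \<bullet> mk x y v)"
    and vec_tens_add_left: "\<lbrakk>arr (mk y z v); arr (mk y z w); arr f\<rbrakk> \<Longrightarrow>
      vec (mk y z (v + w) \<odot> f) = vec (mk y z v \<odot> f) + vec (mk y z w \<odot> f)"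
    and vec_tens_scale_left: "\<lbrakk>arr (mk y z v); arr f\<rbrakk> \<Longrightarrow>
      vec (mk y z (a *s v) \<odot> f) = a *s vec (mk y z v \<odot> f)"
    and vec_tens_scale_right: "\<lbrakk>arr (mk x y v); arr g\<rbrakk> \<Longrightarrow>
      vec (g \<odot> mk x y (a *s v)) = a *s vec (g \<odot> mk x y v)"
    and finite_R: "finite R"
    and idt_nonzero: "x \<in> R \<Longrightarrow> vec (\<iota> x) \<noteq> 0"
    and schur: "\<lbrakk>x \<in> R; y \<in> R; x \<noteq> y; arr f; src f = x; trg f = y\<rbrakk> \<Longrightarrow> vec f = 0"
    and schur_End: "\<lbrakk>x \<in> R; arr f; src f = x; trg f = x\<rbrakk> \<Longrightarrow> \<exists>a. vec f = a *s vec (\<iota> x)"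
    and unit_R: "u \<in> R"
    and unit_iso: "\<exists>i i'. arr i \<and> src i = u \<and> trg i = [] \<and> arr i' \<and> src i' = [] \<and> trg i' = u \<and>
      i' \<bullet> i = \<iota> u \<and> i \<bullet> i' = \<iota> []"
    and decomposition: "\<exists>(n::nat) r e p. (\<forall>j<n. r j \<in> R \<and> arr (e j) \<and> src (e j) = r j \<and> trg (e j) = x \<and>
        arr (p j) \<and> src (p j) = x \<and> trg (p j) = r j) \<and>
      (\<forall>j<n. \<forall>k<n. vec (p j \<bullet> e k) = (if j = k then vec (\<iota> (r j)) else 0)) \<and>
      (\<Sum>j<n. vec (e j \<bullet> p j)) = vec (\<iota> x)"
    and ex_dual: "\<exists>y e c. dual_pair x y e c"
    and ex_dual_R: "x \<in> R \<Longrightarrow> \<exists>y e c. dual_pair x y e c \<and> (\<forall>t. vec (tw x) = t *s vec (\<iota> x) \<longrightarrow> vec (tw y) = t *s vec (\<iota> y))"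
    and tw_nonzero: "x \<in> R \<Longrightarrow> vec (tw x) \<noteq> 0"
begin

section \<open>Scalars and finite sums of typed arrows\<close>

definition sm :: "'k \<Rightarrow> 'a \<Rightarrow> 'a" where
  "sm a f = mk (src f) (trg f) (a *s vec f)"

text \<open>Source and target are arguments so that an empty sum is still a well-typed zero
  arrow.\<close>

definition asum :: "'o list \<Rightarrow> 'o list \<Rightarrow> 'i set \<Rightarrow> ('i \<Rightarrow> 'a) \<Rightarrow> 'a" where
  "asum x y A F = mk x y (\<Sum>j\<in>A. vec (F j))"

abbreviation zero :: "'o list \<Rightarrow> 'o list \<Rightarrow> 'a" where
  "zero x y \<equiv> mk x y 0"

lemma arr_eqI: "\<lbrakk>arr f; arr g; src f = src g; trg f = trg g; vec f = vec g\<rbrakk> \<Longrightarrow> f = g"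
  by (metis mk_vec)

lemma mk_vec' [simp]: "\<lbrakk>arr f; src f = x; trg f = y\<rbrakk> \<Longrightarrow> mk x y (vec f) = f"
  using mk_vec by blast

lemma sm_simps [simp]: "src (sm a f) = src f" "trg (sm a f) = trg f" "vec (sm a f) = a *s vec f"
  by (auto simp: sm_def)

lemma arr_sm [simp]: "arr f \<Longrightarrow> arr (sm a f)"
  unfolding sm_def by (intro arr_mk_scale) (simp add: mk_vec)

lemma sm_comp_left [simp]:
  assumes "arr f" "arr g" "src g = trg f"
  shows "sm a g \<bullet> f = sm a (g \<bullet> f)"
proof (rule arr_eqI)
  show "vec (sm a g \<bullet> f) = vec (sm a (g \<bullet> f))"
    using vec_comp_scale_left[of "src g" "trg g" "vec g" f a] assms
    unfolding sm_def[of a g, symmetric] mk_vec[OF \<open>arr g\<close>] by simp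
qed (use assms in simp_all)

lemma sm_comp_right [simp]:
  assumes "arr f" "arr g" "src g = trg f"
  shows "g \<bullet> sm a f = sm a (g \<bullet> f)"
proof (rule arr_eqI)
  show "vec (g \<bullet> sm a f) = vec (sm a (g \<bullet> f))"
    using vec_comp_scale_right[of "src f" "trg f" "vec f" g a] assms
    unfolding sm_def[of a f, symmetric] mk_vec[OF \<open>arr f\<close>] by simp
qed (use assms in simp_all)

lemma sm_tens_left [simp]:
  assumes "arr f" "arr g"
  shows "sm a g \<odot> f = sm a (g \<odot> f)"
proof (rule arr_eqI)
  show "vec (sm a g \<odot> f) = vec (sm a (g \<odot> f))"
    using vec_tens_scale_left[of "src g" "trg g" "vec g" f a] assms
    unfolding sm_def[of a g, symmetric] mk_vec[OF \<open>arr g\<close>] by simp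
qed (use assms in simp_all)

lemma sm_tens_right [simp]:
  assumes "arr f" "arr g"
  shows "g \<odot> sm a f = sm a (g \<odot> f)"
proof (rule arr_eqI)
  show "vec (g \<odot> sm a f) = vec (sm a (g \<odot> f))"
    using vec_tens_scale_right[of "src f" "trg f" "vec f" g a] assms
    unfolding sm_def[of a f, symmetric] mk_vec[OF \<open>arr f\<close>] by simp
qed (use assms in simp_all)

lemma sm_sm [simp]: "sm a (sm b f) = sm (a * b) f"
  by (simp add: sm_def)

lemma sm_one [simp]: "arr f \<Longrightarrow> sm 1 f = f"
  by (simp add: sm_def mk_vec)

lemma zero_eq: "arr f \<Longrightarrow> vec f = 0 \<longleftrightarrow> f = zero (src f) (trg f)"
  by (metis mk_vec vec_mk)

lemma sm_0 [simp]: "sm 0 f = zero (src f) (trg f)"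
  by (simp add: sm_def)

lemma sm_zero [simp]: "sm a (zero x y) = zero x y"
  by (simp add: sm_def)

lemma comp_zero_left [simp]: "\<lbrakk>arr f; trg f = y\<rbrakk> \<Longrightarrow> zero y z \<bullet> f = zero (src f) z"
  using sm_comp_left[of f "zero y z" 0] by simp

lemma comp_zero_right [simp]: "\<lbrakk>arr g; src g = y\<rbrakk> \<Longrightarrow> g \<bullet> zero x y = zero x (trg g)"
  using sm_comp_right[of "zero x y" g 0] by simp

lemma tens_zero_left [simp]: "arr f \<Longrightarrow> zero x y \<odot> f = zero (x @ src f) (y @ trg f)"
  using sm_tens_left[of f "zero x y" 0] by simp

lemma asum_simps [simp]: "src (asum x y A F) = x" "trg (asum x y A F) = y" "vec (asum x y A F) = (\<Sum>j\<in>A. vec (F j))"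
  by (auto simp: asum_def)

lemma arr_asum [simp]:
  assumes "\<And>j. j \<in> A \<Longrightarrow> arr (F j)" "\<And>j. j \<in> A \<Longrightarrow> src (F j) = x" "\<And>j. j \<in> A \<Longrightarrow> trg (F j) = y"
  shows "arr (asum x y A F)"
  using assms
proof (induction A rule: infinite_finite_induct)
  case (insert j A)
  then have "arr (mk x y (vec (F j) + (\<Sum>j\<in>A. vec (F j))))"
    by (intro arr_mk_add) (auto simp: asum_def)
  with insert show ?case by (simp add: asum_def)
qed (auto simp: asum_def)

lemma asum_insert_aux:
  assumes "finite A" "j \<notin> A"
  shows "asum x y (insert j A) F = mk x y (vec (F j) + vec (asum x y A F))"
  using assms by (simp add: asum_def)

lemma vec_comp_asum_right:
  assumes "\<And>j. j \<in> A \<Longrightarrow> arr (F j)" "\<And>j. j \<in> A \<Longrightarrow> src (F j) = x" "\<And>j. j \<in> A \<Longrightarrow> trg (F j) = y"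
    and g: "arr g" "src g = y"
  shows "vec (g \<bullet> asum x y A F) = (\<Sum>j\<in>A. vec (g \<bullet> F j))"
  using assms(1-3)
proof (induction A rule: infinite_finite_induct)
  case (insert j A)
  have [simp]: "arr (F j)" "src (F j) = x" "trg (F j) = y" "arr (asum x y A F)"
    using insert by auto
  have IH: "vec (g \<bullet> asum x y A F) = (\<Sum>j\<in>A. vec (g \<bullet> F j))" using insert by auto
  show ?case
    unfolding asum_insert_aux[OF insert(1,2)]
    by (subst vec_comp_add_right) (use insert(1,2) in \<open>simp_all add: g IH del: asum_simps(3)\<close>)
qed (use g in \<open>auto simp: asum_def\<close>)

lemma vec_comp_asum_left:
  assumes "\<And>j. j \<in> A \<Longrightarrow> arr (F j)" "\<And>j. j \<in> A \<Longrightarrow> src (F j) = x" "\<And>j. j \<in> A \<Longrightarrow> trg (F j) = y"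
    and g: "arr g" "trg g = x"
  shows "vec (asum x y A F \<bullet> g) = (\<Sum>j\<in>A. vec (F j \<bullet> g))"
  using assms(1-3)
proof (induction A rule: infinite_finite_induct)
  case (insert j A)
  have [simp]: "arr (F j)" "src (F j) = x" "trg (F j) = y" "arr (asum x y A F)"
    using insert by auto
  have IH: "vec (asum x y A F \<bullet> g) = (\<Sum>j\<in>A. vec (F j \<bullet> g))" using insert by auto
  show ?case
    unfolding asum_insert_aux[OF insert(1,2)]
    by (subst vec_comp_add_left) (use insert(1,2) in \<open>simp_all add: g IH del: asum_simps(3)\<close>)
qed (use g in \<open>auto simp: asum_def\<close>)

lemma vec_tens_asum_left:
  assumes "\<And>j. j \<in> A \<Longrightarrow> arr (F j)" "\<And>j. j \<in> A \<Longrightarrow> src (F j) = x" "\<And>j. j \<in> A \<Longrightarrow> trg (F j) = y"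
    and g: "arr g"
  shows "vec (asum x y A F \<odot> g) = (\<Sum>j\<in>A. vec (F j \<odot> g))"
  using assms(1-3)
proof (induction A rule: infinite_finite_induct)
  case (insert j A)
  have [simp]: "arr (F j)" "src (F j) = x" "trg (F j) = y" "arr (asum x y A F)"
    using insert by auto
  have IH: "vec (asum x y A F \<odot> g) = (\<Sum>j\<in>A. vec (F j \<odot> g))" using insert by auto
  show ?case
    unfolding asum_insert_aux[OF insert(1,2)]
    by (subst vec_tens_add_left) (use insert(1,2) in \<open>simp_all add: g IH del: asum_simps(3)\<close>)
qed (use g in \<open>auto simp: asum_def\<close>)

lemma comp_asum_right:
  assumes "\<And>j. j \<in> A \<Longrightarrow> arr (F j)" "\<And>j. j \<in> A \<Longrightarrow> src (F j) = x" "\<And>j. j \<in> A \<Longrightarrow> trg (F j) = y"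
    "arr g" "src g = y"
  shows "g \<bullet> asum x y A F = asum x (trg g) A (\<lambda>j. g \<bullet> F j)"
  using assms vec_comp_asum_right[OF assms] by (intro arr_eqI) auto

lemma comp_asum_left:
  assumes "\<And>j. j \<in> A \<Longrightarrow> arr (F j)" "\<And>j. j \<in> A \<Longrightarrow> src (F j) = x" "\<And>j. j \<in> A \<Longrightarrow> trg (F j) = y"
    "arr g" "trg g = x"
  shows "asum x y A F \<bullet> g = asum (src g) y A (\<lambda>j. F j \<bullet> g)"
  using assms vec_comp_asum_left[OF assms] by (intro arr_eqI) auto

lemma tens_asum_left:
  assumes "\<And>j. j \<in> A \<Longrightarrow> arr (F j)" "\<And>j. j \<in> A \<Longrightarrow> src (F j) = x" "\<And>j. j \<in> A \<Longrightarrow> trg (F j) = y"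
    "arr g"
  shows "asum x y A F \<odot> g = asum (x @ src g) (y @ trg g) A (\<lambda>j. F j \<odot> g)"
  using assms vec_tens_asum_left[OF assms] by (intro arr_eqI) auto

lemma asum_mono_neutral:
  assumes "finite A" "B \<subseteq> A" "\<And>j. j \<in> A - B \<Longrightarrow> F j = zero x y"
  shows "asum x y A F = asum x y B F"
  unfolding asum_def using assms by (intro arg_cong[of _ _ "mk x y"] sum.mono_neutral_right) auto

lemma asum_cong: "(\<And>j. j \<in> A \<Longrightarrow> F j = G j) \<Longrightarrow> asum x y A F = asum x y A G"
  by (simp add: asum_def)

text \<open>Membership in \<open>R\<close> would be too narrow: scalars must also be read off at the
  empty word and at duals of simple objects, which need not lie in \<open>R\<close>.\<close>

definition brick :: "'o list \<Rightarrow> bool" where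
  "brick x \<longleftrightarrow> vec (\<iota> x) \<noteq> 0 \<and> (\<forall>f. arr f \<longrightarrow> src f = x \<longrightarrow> trg f = x \<longrightarrow> (\<exists>a. f = sm a (\<iota> x)))"

definition sc :: "'a \<Rightarrow> 'k" where
  "sc f = (THE a. f = sm a (\<iota> (src f)))"

lemma sm_idt_inject: "brick x \<Longrightarrow> sm a (\<iota> x) = sm b (\<iota> x) \<longleftrightarrow> a = b"
  unfolding brick_def by (metis scale_right_imp_eq sm_simps(3))

lemma sc_eq:
  assumes "brick x" "arr f" "src f = x" "trg f = x"
  shows "f = sm (sc f) (\<iota> x)"
proof -
  obtain a where a: "f = sm a (\<iota> x)" using assms by (auto simp: brick_def)
  then have "sc f = a" unfolding sc_def using assms by (intro the_equality) (auto simp: sm_idt_inject)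
  with a show ?thesis by simp
qed

lemma sc_sm_idt [simp]: "brick x \<Longrightarrow> sc (sm a (\<iota> x)) = a"
  using sc_eq[of x "sm a (\<iota> x)"] by (simp add: sm_idt_inject)

lemma brick_R: "x \<in> R \<Longrightarrow> brick x"
  unfolding brick_def using idt_nonzero schur_End by (auto intro!: arr_eqI) (metis arr_eqI arr_idt arr_sm sm_simps src_idt trg_idt)

lemma sc_idt [simp]: "brick x \<Longrightarrow> sc (\<iota> x) = 1"
  using sc_sm_idt[of x 1] by simp

lemma sc_zero [simp]: "brick x \<Longrightarrow> sc (zero x x) = 0"
  using sc_sm_idt[of x 0] by simp

lemma sc_sm [simp]: "\<lbrakk>brick x; arr f; src f = x; trg f = x\<rbrakk> \<Longrightarrow> sc (sm a f) = a * sc f"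
  using sc_eq[of x f] by (metis sc_sm_idt sm_sm)

lemma brick_iso:
  assumes "brick x" and [simp]: "arr i" "src i = x" "trg i = y" "arr i'" "src i' = y" "trg i' = x"
    and "i' \<bullet> i = \<iota> x" and i: "i \<bullet> i' = \<iota> y"
  shows "brick y"
  unfolding brick_def
proof (intro conjI allI impI)
  show "vec (\<iota> y) \<noteq> 0"
  proof
    assume "vec (\<iota> y) = 0"
    then have "\<iota> y = zero y y" using zero_eq[of "\<iota> y"] by simp
    then have "i' \<bullet> \<iota> y \<bullet> i = zero x x" by (simp del: comp_idt_left)
    then show False using assms by (simp add: brick_def)
  qed
  fix f assume [simp]: "arr f" "src f = y" "trg f = y"
  obtain a where a: "i' \<bullet> f \<bullet> i = sm a (\<iota> x)" using assms(1) by (fastforce simp: brick_def)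
  have "f = (i \<bullet> i') \<bullet> f \<bullet> (i \<bullet> i')" by (simp add: i)
  also have "\<dots> = i \<bullet> (i' \<bullet> f \<bullet> i) \<bullet> i'" by simp
  also have "\<dots> = sm a (\<iota> y)" by (simp add: a i)
  finally show "\<exists>a. f = sm a (\<iota> y)" by blast
qed

lemma brick_unit: "brick []"
  using unit_iso brick_iso[OF brick_R[OF unit_R]] by blast

lemma sc_asum:
  assumes "brick x" "\<And>j. j \<in> A \<Longrightarrow> arr (F j) \<and> src (F j) = x \<and> trg (F j) = x"
  shows "sc (asum x x A F) = (\<Sum>j\<in>A. sc (F j))"
proof -
  have "asum x x A F = asum x x A (\<lambda>j. sm (sc (F j)) (\<iota> x))"
    using assms sc_eq[OF assms(1)] by (intro asum_cong) auto
  also have "\<dots> = sm (\<Sum>j\<in>A. sc (F j)) (\<iota> x)"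
    by (simp add: asum_def sm_def scale_sum_left)
  finally show ?thesis using assms(1) by simp
qed

text \<open>The quantum trace. Quantifying over all dual pairs avoids choosing one;
  \<open>trace_cyclic\<close> at an identity shows that they agree.\<close>

definition T :: "'a \<Rightarrow> 'k" where
  "T f = (THE t. \<forall>y e c. dual_pair (src f) y e c \<longrightarrow> t = sc (tev (src f) y e \<bullet> (f \<odot> \<iota> y) \<bullet> c))"

lemma T_eq:
  assumes dp: "dual_pair x y e c" and f [simp]: "arr f" "src f = x" "trg f = x"
  shows "tev x y e \<bullet> (f \<odot> \<iota> y) \<bullet> c = sm (T f) (\<iota> [])"
proof -
  note [simp] = dual_pairD(1-6)[OF dp]
  have "T f = sc (tev x y e \<bullet> (f \<odot> \<iota> y) \<bullet> c)"
    unfolding T_def f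
  proof (rule the_equality, intro allI impI)
    fix y' e' c' assume "dual_pair x y' e' c'"
    from trace_cyclic[OF dp this, of f "\<iota> x"]
    show "sc (tev x y e \<bullet> (f \<odot> \<iota> y) \<bullet> c) = sc (tev x y' e' \<bullet> (f \<odot> \<iota> y') \<bullet> c')" by simp
  qed (use dp in blast)
  then show ?thesis using sc_eq[OF brick_unit, of "tev x y e \<bullet> (f \<odot> \<iota> y) \<bullet> c"] by simp
qed

lemma T_sc:
  assumes dp: "dual_pair x y e c" and f: "arr f" "src f = x" "trg f = x"
  shows "T f = sc (tev x y e \<bullet> (f \<odot> \<iota> y) \<bullet> c)"
  using T_eq[OF assms] brick_unit by simp

lemma T_cyclic:
  assumes "arr f" "src f = x" "trg f = y" "arr g" "src g = y" "trg g = x"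
  shows "T (g \<bullet> f) = T (f \<bullet> g)"
proof -
  obtain x' e c where dp: "dual_pair x x' e c" using ex_dual by blast
  obtain y' e' c' where dp': "dual_pair y y' e' c'" using ex_dual by blast
  show ?thesis using trace_cyclic[OF dp dp', of f g] assms T_sc[OF dp, of "g \<bullet> f"] T_sc[OF dp', of "f \<bullet> g"] by simp
qed

lemma T_sm [simp]:
  assumes [simp]: "arr f" "src f = trg f"
  shows "T (sm a f) = a * T f"
proof -
  obtain x' e c where dp: "dual_pair (trg f) x' e c" using ex_dual by blast
  note [simp] = dual_pairD(1-6)[OF dp]
  show ?thesis using T_sc[OF dp, of f] T_sc[OF dp, of "sm a f"] brick_unit by simp
qed

lemma T_zero [simp]: "T (zero x x) = 0"
  using T_sm[of "zero x x" 0] by simp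

lemma T_asum:
  assumes "\<And>j. j \<in> A \<Longrightarrow> arr (F j)" "\<And>j. j \<in> A \<Longrightarrow> src (F j) = x" "\<And>j. j \<in> A \<Longrightarrow> trg (F j) = x"
  shows "T (asum x x A F) = (\<Sum>j\<in>A. T (F j))"
proof -
  obtain x' e c where dp: "dual_pair x x' e c" using ex_dual by blast
  note [simp] = dual_pairD(1-6)[OF dp] assms
  have "tev x x' e \<bullet> (asum x x A F \<odot> \<iota> x') \<bullet> c = asum [] [] A (\<lambda>j. tev x x' e \<bullet> (F j \<odot> \<iota> x') \<bullet> c)"
    by (simp add: tens_asum_left comp_asum_left comp_asum_right)
  then show ?thesis
    using T_sc[OF dp] by (simp add: sc_asum[OF brick_unit] cong: sum.cong)
qed

lemma T_ptr:
  assumes dp: "dual_pair x' y' e' c'" and f: "arr f" "src f = x @ x'" "trg f = x @ x'"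
  shows "T f = T (ptr x x' y' e' c' f)"
proof -
  obtain y e c where dp': "dual_pair x y e c" using ex_dual by blast
  note [simp] = dual_pairD(1-6)[OF dp] f dual_pairD(1-6)[OF dp']
  have "arr (ptr x x' y' e' c' f)" "src (ptr x x' y' e' c' f) = x" "trg (ptr x x' y' e' c' f) = x"
    by (simp_all add: ptr_def)
  then show ?thesis
    using trace_tens[OF dp' dp, of f] T_sc[OF dp', of "ptr x x' y' e' c' f"] T_sc[OF dual_pair_tens[OF dp' dp], of f] by simp
qed

definition d :: "'o list \<Rightarrow> 'k" where "d x = T (\<iota> x)"

text \<open>Closing the second factor turns \<open>f \<odot> g\<close> into \<open>T g\<close> times
  \<open>f\<close>.\<close>

lemma T_tens:
  assumes [simp]: "arr f" "src f = x" "trg f = x" "arr g" "src g = y" "trg g = y"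
  shows "T (f \<odot> g) = T f * T g"
proof -
  obtain y' e c where dp: "dual_pair y y' e c" using ex_dual by blast
  note [simp] = dual_pairD(1-6)[OF dp]
  have "ptr x y y' e c (f \<odot> g) = (\<iota> x \<odot> tev y y' e) \<bullet> (f \<odot> g \<odot> \<iota> y') \<bullet> (\<iota> x \<odot> c)"
    by (simp add: ptr_def)
  also have "f \<odot> g \<odot> \<iota> y' = (\<iota> x \<odot> g \<odot> \<iota> y') \<bullet> (f \<odot> \<iota> (y @ y'))"
    using tens_left_right[of f "g \<odot> \<iota> y'" x "y @ y'"] by simp
  also have "((\<iota> x \<odot> g \<odot> \<iota> y') \<bullet> (f \<odot> \<iota> (y @ y'))) \<bullet> (\<iota> x \<odot> c) = (\<iota> x \<odot> g \<odot> \<iota> y') \<bullet> (\<iota> x \<odot> c) \<bullet> f"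
    using slide[of f c x "y @ y'" x "[]"] by simp
  also have "(\<iota> x \<odot> tev y y' e) \<bullet> (\<iota> x \<odot> g \<odot> \<iota> y') \<bullet> (\<iota> x \<odot> c) \<bullet> f = (\<iota> x \<odot> (tev y y' e \<bullet> (g \<odot> \<iota> y') \<bullet> c)) \<bullet> f"
    by simp
  also have "\<dots> = sm (T g) f" using T_eq[OF dp, of g] by simp
  finally show ?thesis using T_ptr[OF dp, of "f \<odot> g" x] by simp
qed

text \<open>A connected sum formula: two closed diagrams are joined along a strand labelled by the
  simple object \<open>x\<close>. Closing \<open>F\<close> over \<open>z\<close> leaves an
  endomorphism of \<open>x\<close>, hence a scalar, which enters \<open>T F\<close> with the factor
  \<open>d x\<close>. That factor stays on the left because it is only later shown to be
  nonzero.\<close>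

lemma T_link:
  assumes x: "x \<in> R" and [simp]: "arr A" "src A = a @ x" "trg A = a @ x" "arr F" "src F = x @ z" "trg F = x @ z"
  shows "T ((A \<odot> \<iota> z) \<bullet> (\<iota> a \<odot> F)) * d x = T A * T F"
proof -
  obtain z' e c where dp: "dual_pair z z' e c" using ex_dual by blast
  note [simp] = dual_pairD(1-6)[OF dp]
  let ?P = "ptr x z z' e c F"
  have [simp]: "arr ?P" "src ?P = x" "trg ?P = x" by (simp_all add: ptr_def)
  have P: "?P = sm (sc ?P) (\<iota> x)" by (rule sc_eq[OF brick_R[OF x]]) auto
  have "ptr (a @ x) z z' e c ((A \<odot> \<iota> z) \<bullet> (\<iota> a \<odot> F))
      = (\<iota> (a @ x) \<odot> tev z z' e) \<bullet> (A \<odot> \<iota> (z @ z')) \<bullet> (\<iota> a \<odot> F \<odot> \<iota> z') \<bullet> (\<iota> (a @ x) \<odot> c)"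
    by (simp add: ptr_def)
  also have "\<dots> = A \<bullet> (\<iota> (a @ x) \<odot> tev z z' e) \<bullet> (\<iota> a \<odot> F \<odot> \<iota> z') \<bullet> (\<iota> (a @ x) \<odot> c)"
    using reassoc[OF slide[of A "tev z z' e" "a @ x" "[]" "a @ x" "z @ z'", symmetric],
       of "(\<iota> a \<odot> F \<odot> \<iota> z') \<bullet> (\<iota> (a @ x) \<odot> c)"] by simp
  also have "(\<iota> (a @ x) \<odot> tev z z' e) \<bullet> (\<iota> a \<odot> F \<odot> \<iota> z') \<bullet> (\<iota> (a @ x) \<odot> c) = \<iota> a \<odot> ?P"
    by (simp add: ptr_def)
  also have "\<dots> = sm (sc ?P) (\<iota> (a @ x))" by (subst P) simp
  finally have "T ((A \<odot> \<iota> z) \<bullet> (\<iota> a \<odot> F)) = sc ?P * T A"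
    using T_ptr[OF dp, of "(A \<odot> \<iota> z) \<bullet> (\<iota> a \<odot> F)" "a @ x"] by simp
  moreover have "T F = sc ?P * d x"
  proof -
    have "T F = T (sm (sc ?P) (\<iota> x))" using T_ptr[OF dp, of F x] P by simp
    then show ?thesis by (simp add: d_def)
  qed
  ultimately show ?thesis by simp
qed

text \<open>Pairings \<open>y @ x\<close> \<rightarrow> \<open>[]\<close> correspond to
  endomorphisms of \<open>x\<close>; for a brick \<open>x\<close> they are therefore all multiples
  of \<open>e\<close>.\<close>

lemma bend_ev:
  assumes dp: "dual_pair x y e c" and [simp]: "arr p" "src p = y @ x" "trg p = []"
  shows "p = e \<bullet> (\<iota> y \<odot> ((\<iota> x \<odot> p) \<bullet> (c \<odot> \<iota> x)))"
proof -
  note [simp] = dual_pairD(1-6)[OF dp]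
  have "e \<bullet> (\<iota> y \<odot> ((\<iota> x \<odot> p) \<bullet> (c \<odot> \<iota> x))) = e \<bullet> (\<iota> (y @ x) \<odot> p) \<bullet> (\<iota> y \<odot> c \<odot> \<iota> x)" by simp
  also have "\<dots> = p \<bullet> (e \<odot> \<iota> (y @ x)) \<bullet> (\<iota> y \<odot> c \<odot> \<iota> x)"
    using reassoc[OF slide[of e p "y @ x" "[]" "[]" "y @ x"], of "\<iota> y \<odot> c \<odot> \<iota> x"] by simp
  also have "(e \<odot> \<iota> (y @ x)) \<bullet> (\<iota> y \<odot> c \<odot> \<iota> x) = \<iota> (y @ x)"
    using whisker_both[OF dual_pairD(8)[OF dp], of "[]" x] by simp
  finally show ?thesis by simp
qed

text \<open>An endomorphism \<open>f\<close> of \<open>y\<close> can be recovered from the pairing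
  \<open>e \<bullet> (f \<odot> \<iota> x)\<close>, and by \<open>bend_ev\<close> this pairing is a
  multiple of \<open>e\<close>.\<close>

lemma brick_dual:
  assumes dp: "dual_pair x y e c" and x: "brick x"
  shows "brick y"
  unfolding brick_def
proof (intro conjI allI impI)
  note [simp] = dual_pairD(1-6)[OF dp]
  show "vec (\<iota> y) \<noteq> 0"
  proof
    assume "vec (\<iota> y) = 0"
    then have 0: "\<iota> y = zero y y" using zero_eq[of "\<iota> y"] by simp
    have "e = e \<bullet> (\<iota> y \<odot> \<iota> x)" by simp
    also have "\<dots> = zero (y @ x) []" unfolding 0 by (simp del: tens_idt)
    finally have e: "e = zero (y @ x) []" .
    have "c = (\<iota> x \<odot> \<iota> y) \<bullet> c" by simp
    have "\<iota> x \<odot> \<iota> y = sm 0 (\<iota> (x @ y))"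
    proof -
      \<comment> \<open>The braiding brings the vanishing factor \<open>\<iota> y\<close> to the
        left, where \<open>tens_zero_left\<close> applies.\<close>
      have "\<iota> x \<odot> \<iota> y = br y x \<bullet> (\<iota> y \<odot> \<iota> x) \<bullet> ibr y x" by simp
      also have "\<dots> = zero (x @ y) (x @ y)" unfolding 0 by (simp del: tens_idt)
      finally show ?thesis by simp
    qed
    then have "c = zero [] (x @ y)" using \<open>c = (\<iota> x \<odot> \<iota> y) \<bullet> c\<close> by (simp del: comp_idt_left)
    then have "\<iota> x = zero x x" using dual_pairD(7)[OF dp] by simp
    then show False using x by (simp add: brick_def)
  qed
  fix f assume [simp]: "arr f" "src f = y" "trg f = y"
  obtain s where s: "(\<iota> x \<odot> (e \<bullet> (f \<odot> \<iota> x))) \<bullet> (c \<odot> \<iota> x) = sm s (\<iota> x)" using x by (force simp: brick_def)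
  have ef: "e \<bullet> (f \<odot> \<iota> x) = sm s e"
    by (subst bend_ev[OF dp]) (use s in simp_all)
  have "sm s (\<iota> y) = (sm s e \<odot> \<iota> y) \<bullet> (\<iota> y \<odot> c)" by (simp add: dual_pairD(8)[OF dp])
  also have "\<dots> = (e \<odot> \<iota> y) \<bullet> (f \<odot> \<iota> (x @ y)) \<bullet> (\<iota> y \<odot> c)" unfolding ef[symmetric] by simp
  also have "(f \<odot> \<iota> (x @ y)) \<bullet> (\<iota> y \<odot> c) = (\<iota> y \<odot> c) \<bullet> f"
    using slide[of f c y "x @ y" y "[]"] by simp
  also have "(e \<odot> \<iota> y) \<bullet> (\<iota> y \<odot> c) \<bullet> f = f"
    using reassoc1[OF dual_pairD(8)[OF dp], of f] by simp
  finally show "\<exists>a. f = sm a (\<iota> y)" by metis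
qed

section \<open>Decompositions into simple objects\<close>

definition decomp :: "'o list \<Rightarrow> 'i set \<Rightarrow> ('i \<Rightarrow> 'o list) \<Rightarrow> ('i \<Rightarrow> 'a) \<Rightarrow> ('i \<Rightarrow> 'a) \<Rightarrow> bool" where
  "decomp x A r e p \<longleftrightarrow> finite A \<and>
     (\<forall>j\<in>A. r j \<in> R \<and> arr (e j) \<and> src (e j) = r j \<and> trg (e j) = x \<and> arr (p j) \<and> src (p j) = x \<and> trg (p j) = r j) \<and>
     (\<forall>j\<in>A. \<forall>k\<in>A. p j \<bullet> e k = (if j = k then \<iota> (r j) else zero (r k) (r j))) \<and>
     asum x x A (\<lambda>j. e j \<bullet> p j) = \<iota> x"

lemma decompD:
  assumes "decomp x A r e p"
  shows "finite A" "j \<in> A \<Longrightarrow> r j \<in> R" "j \<in> A \<Longrightarrow> arr (e j)" "j \<in> A \<Longrightarrow> src (e j) = r j" "j \<in> A \<Longrightarrow> trg (e j) = x"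
    "j \<in> A \<Longrightarrow> arr (p j)" "j \<in> A \<Longrightarrow> src (p j) = x" "j \<in> A \<Longrightarrow> trg (p j) = r j"
    "\<lbrakk>j \<in> A; k \<in> A\<rbrakk> \<Longrightarrow> p j \<bullet> e k = (if j = k then \<iota> (r j) else zero (r k) (r j))"
    "asum x x A (\<lambda>j. e j \<bullet> p j) = \<iota> x"
  using assms by (auto simp: decomp_def)

lemma ex_decomp: "\<exists>(A::nat set) r e p. decomp x A r e p"
proof -
  obtain n :: nat and r e p where
    1: "\<forall>j<n. r j \<in> R \<and> arr (e j) \<and> src (e j) = r j \<and> trg (e j) = x \<and> arr (p j) \<and> src (p j) = x \<and> trg (p j) = r j"
    and 2: "\<forall>j<n. \<forall>k<n. vec (p j \<bullet> e k) = (if j = k then vec (\<iota> (r j)) else 0)"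
    and 3: "(\<Sum>j<n. vec (e j \<bullet> p j)) = vec (\<iota> x)"
    using decomposition by blast
  have "decomp x {..<n} r e p"
    unfolding decomp_def
  proof (intro conjI ballI)
    fix j k assume jk: "j \<in> {..<n}" "k \<in> {..<n}"
    then show "p j \<bullet> e k = (if j = k then \<iota> (r j) else zero (r k) (r j))"
      using 1 2 by (intro arr_eqI) auto
  next
    show "asum x x {..<n} (\<lambda>j. e j \<bullet> p j) = \<iota> x"
      unfolding asum_def 3 by simp
  qed (use 1 in auto)
  then show ?thesis by blast
qed

lemma decomp_expand_left:
  assumes dc: "decomp x A r e p" and [simp]: "arr h" "trg h = x"
  shows "h = asum (src h) x A (\<lambda>j. e j \<bullet> p j \<bullet> h)"
proof -
  note [simp] = decompD(1-8)[OF dc]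
  have "h = asum x x A (\<lambda>j. e j \<bullet> p j) \<bullet> h" by (simp add: decompD(10)[OF dc])
  also have "\<dots> = asum (src h) x A (\<lambda>j. e j \<bullet> p j \<bullet> h)"
    by (subst comp_asum_left) (auto intro!: asum_cong)
  finally show ?thesis .
qed

lemma decomp_expand_right:
  assumes dc: "decomp x A r e p" and [simp]: "arr h" "src h = x"
  shows "h = asum x (trg h) A (\<lambda>j. h \<bullet> e j \<bullet> p j)"
proof -
  note [simp] = decompD(1-8)[OF dc]
  have "h = h \<bullet> asum x x A (\<lambda>j. e j \<bullet> p j)" by (simp add: decompD(10)[OF dc])
  also have "\<dots> = asum x (trg h) A (\<lambda>j. h \<bullet> e j \<bullet> p j)"
    by (subst comp_asum_right) (auto intro!: asum_cong)
  finally show ?thesis .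
qed

text \<open>Only the first factor is decomposed; the spectator strands \<open>V\<close> carry the
  rest of a link diagram.\<close>

lemma T_decomp:
  assumes dc: "decomp x A r e p" and [simp]: "arr Q" "src Q = x @ V" "trg Q = x @ V"
  shows "T Q = (\<Sum>j\<in>A. T ((p j \<odot> \<iota> V) \<bullet> Q \<bullet> (e j \<odot> \<iota> V)))"
proof -
  note [simp] = decompD(1-8)[OF dc]
  have "Q = Q \<bullet> (asum x x A (\<lambda>j. e j \<bullet> p j) \<odot> \<iota> V)" by (simp add: decompD(10)[OF dc])
  also have "\<dots> = asum (x @ V) (x @ V) A (\<lambda>j. Q \<bullet> ((e j \<bullet> p j) \<odot> \<iota> V))"
    by (subst tens_asum_left, simp_all, subst comp_asum_right, simp_all)
  finally have "T Q = T (asum (x @ V) (x @ V) A (\<lambda>j. Q \<bullet> ((e j \<bullet> p j) \<odot> \<iota> V)))" by simp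
  also have "\<dots> = (\<Sum>j\<in>A. T (Q \<bullet> ((e j \<bullet> p j) \<odot> \<iota> V)))" by (rule T_asum) auto
  also have "\<dots> = (\<Sum>j\<in>A. T ((p j \<odot> \<iota> V) \<bullet> Q \<bullet> (e j \<odot> \<iota> V)))"
  proof (rule sum.cong[OF refl])
    fix j assume [simp]: "j \<in> A"
    show "T (Q \<bullet> ((e j \<bullet> p j) \<odot> \<iota> V)) = T ((p j \<odot> \<iota> V) \<bullet> Q \<bullet> (e j \<odot> \<iota> V))"
      using T_cyclic[of "p j \<odot> \<iota> V" "x @ V" "r j @ V" "Q \<bullet> (e j \<odot> \<iota> V)"] by simp
  qed
  finally show ?thesis .
qed

lemma T_decomp0:
  assumes dc: "decomp x A r e p" and [simp]: "arr Q" "src Q = x" "trg Q = x"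
  shows "T Q = (\<Sum>j\<in>A. T (p j \<bullet> Q \<bullet> e j))"
  using T_decomp[OF dc, of Q "[]"] decompD(3,6)[OF dc] by (simp cong: sum.cong)

definition \<theta> :: "'o list \<Rightarrow> 'k" where "\<theta> x = sc (tw x)"

lemma tw_eq: "x \<in> R \<Longrightarrow> tw x = sm (\<theta> x) (\<iota> x)"
  unfolding \<theta>_def by (rule sc_eq[OF brick_R]) auto

lemma theta_nonzero: "x \<in> R \<Longrightarrow> \<theta> x \<noteq> 0"
  using tw_eq[of x] tw_nonzero[of x] by auto

text \<open>Semisimplicity splits the coevaluation, and the splitting is a multiple of the twisted evaluation.\<close>

lemma d_nonzero:
  assumes x: "x \<in> R"
  shows "d x \<noteq> 0"
proof
  assume dx: "d x = 0"
  obtain y e c where dp: "dual_pair x y e c" using ex_dual by blast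
  note [simp] = dual_pairD(1-6)[OF dp]
  obtain A :: "nat set" and r ee pp where dc: "decomp (x @ y) A r ee pp" using ex_decomp by blast
  note dcs = decompD(1-8)[OF dc]
  obtain i i' where i: "arr i" "src i = u" "trg i = []" "arr i'" "src i' = []" "trg i' = u" "i' \<bullet> i = \<iota> u" "i \<bullet> i' = \<iota> []"
    using unit_iso by blast
  note [simp] = i(1-6)
  \<comment> \<open>Some simple summand must meet \<open>c\<close>, since otherwise \<open>c\<close>
    and hence \<open>\<iota> x\<close> would vanish. Schur's lemma then identifies this summand with
    \<open>u\<close>.\<close>
  have "\<exists>j\<in>A. pp j \<bullet> c \<noteq> zero [] (r j)"
  proof (rule ccontr)
    assume "\<not> ?thesis"
    then have *: "pp j \<bullet> c = zero [] (r j)" if "j \<in> A" for j using that by blast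
    have "c = asum [] (x @ y) A (\<lambda>j. ee j \<bullet> pp j \<bullet> c)" using decomp_expand_left[OF dc, of c] by simp
    also have "\<dots> = asum [] (x @ y) A (\<lambda>j. zero [] (x @ y))"
      by (intro asum_cong) (simp add: * dcs)
    also have "\<dots> = zero [] (x @ y)" by (simp add: asum_def)
    finally have "\<iota> x = zero x x" using dual_pairD(7)[OF dp] by simp
    then show False using idt_nonzero[OF x] by simp
  qed
  then obtain j where j: "j \<in> A" "pp j \<bullet> c \<noteq> zero [] (r j)" by blast
  note [simp] = dcs(2-8)[OF j(1)]
  have nz: "pp j \<bullet> c \<bullet> i \<noteq> zero u (r j)"
  proof
    assume "pp j \<bullet> c \<bullet> i = zero u (r j)"
    then have "(pp j \<bullet> c \<bullet> i) \<bullet> i' = zero [] (r j)" by simp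
    then show False using j i(8) by simp
  qed
  have ru: "u = r j"
    using schur[of u "r j" "pp j \<bullet> c \<bullet> i"] unit_R nz zero_eq[of "pp j \<bullet> c \<bullet> i"] by auto
  then obtain s where s: "pp j \<bullet> c \<bullet> i = sm s (\<iota> u)"
    using sc_eq[OF brick_R[OF unit_R], of "pp j \<bullet> c \<bullet> i"] by auto
  have "s \<noteq> 0" using s nz ru by auto
  \<comment> \<open>The factor \<open>inverse s\<close> makes \<open>q\<close> a left inverse of the
    coevaluation.\<close>
  define q where "q = sm (inverse s) (i \<bullet> pp j)"
  have [simp]: "arr q" "src q = x @ y" "trg q = []" by (simp_all add: q_def ru)
  have "q \<bullet> c = sm (inverse s) (i \<bullet> (pp j \<bullet> c \<bullet> i) \<bullet> i')" by (simp add: q_def ru[symmetric] i(8))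
  also have "\<dots> = \<iota> []" using \<open>s \<noteq> 0\<close> by (simp add: s i(8))
  finally have qc: "q \<bullet> c = \<iota> []" .
  obtain t where t: "(\<iota> x \<odot> (q \<bullet> ibr x y)) \<bullet> (c \<odot> \<iota> x) = sm t (\<iota> x)"
    using brick_R[OF x] by (force simp: brick_def)
  \<comment> \<open>By \<open>bend_ev\<close> the splitting is \<open>e\<close> up to braiding and a
    scalar. Composed with \<open>c\<close> it is then a multiple of \<open>d x\<close>, so it would
    vanish instead of being the identity.\<close>
  have qi: "q \<bullet> ibr x y = sm t e"
    by (subst bend_ev[OF dp]) (use t in simp_all)
  have "q = (q \<bullet> ibr x y) \<bullet> br x y" by simp
  also have "\<dots> = sm t (e \<bullet> br x y)" unfolding qi by simp
  finally have "q = sm t (e \<bullet> br x y)" .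
  with qc have 1: "sm t (e \<bullet> br x y \<bullet> c) = \<iota> []" by simp
  have "tev x y e \<bullet> c = sm (\<theta> x) (e \<bullet> br x y \<bullet> c)"
    by (simp add: tev_def tw_eq[OF x])
  moreover have "tev x y e \<bullet> c = zero [] []"
    using T_eq[OF dp, of "\<iota> x"] dx by (simp add: d_def)
  ultimately have "vec (sm (\<theta> x) (e \<bullet> br x y \<bullet> c)) = 0" by (metis vec_mk)
  then have "vec (e \<bullet> br x y \<bullet> c) = 0" using theta_nonzero[OF x] by simp
  then have "vec (sm t (e \<bullet> br x y \<bullet> c)) = 0" by simp
  then show False using 1 brick_unit by (auto simp: brick_def)
qed

text \<open>Between simple summands \<open>f\<close> has scalar matrix entries, and testing against
  \<open>e j \<bullet> p k\<close> returns such an entry times a dimension. As these dimensions are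
  nonzero, the trace detects every entry.\<close>

lemma T_nondegenerate:
  assumes [simp]: "arr f" "src f = x" "trg f = x"
    and T: "\<And>g. \<lbrakk>arr g; src g = x; trg g = x\<rbrakk> \<Longrightarrow> T (g \<bullet> f) = T g"
  shows "f = \<iota> x"
proof -
  obtain A :: "nat set" and r e p where dc: "decomp x A r e p" using ex_decomp by blast
  note [simp] = decompD(1-8)[OF dc]
  have pfe: "p k \<bullet> f \<bullet> e j = p k \<bullet> e j" if [simp]: "j \<in> A" "k \<in> A" for j k
  proof (cases "r j = r k")
    case False
    then show ?thesis
      using schur[of "r j" "r k"] zero_eq[of "p k \<bullet> f \<bullet> e j"] zero_eq[of "p k \<bullet> e j"] by simp
  next
    case True
    then have b: "brick (r k)" by (simp add: brick_R)
    have "T (p k \<bullet> f \<bullet> e j) = T ((e j \<bullet> p k) \<bullet> f)"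
      using T_cyclic[of "p k \<bullet> f" "x" "r k" "e j"] True by simp
    also have "\<dots> = T (e j \<bullet> p k)" using T[of "e j \<bullet> p k"] True by simp
    also have "\<dots> = T (p k \<bullet> e j)"
      using T_cyclic[of "p k" "x" "r k" "e j"] True by simp
    finally have eq: "T (p k \<bullet> f \<bullet> e j) = T (p k \<bullet> e j)" .
    have "p k \<bullet> f \<bullet> e j = sm (sc (p k \<bullet> f \<bullet> e j)) (\<iota> (r k))" "p k \<bullet> e j = sm (sc (p k \<bullet> e j)) (\<iota> (r k))"
      by (rule sc_eq[OF b], simp_all add: True)+
    moreover from this have "sc (p k \<bullet> f \<bullet> e j) * d (r k) = sc (p k \<bullet> e j) * d (r k)"
      using eq unfolding d_def by (metis T_sm arr_idt src_idt trg_idt)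
    ultimately show ?thesis using d_nonzero[of "r k"] by simp
  qed
  have fe: "f \<bullet> e j = e j" if [simp]: "j \<in> A" for j
  proof -
    have "f \<bullet> e j = asum (r j) x A (\<lambda>k. e k \<bullet> p k \<bullet> f \<bullet> e j)"
      using decomp_expand_left[OF dc, of "f \<bullet> e j"] by simp
    also have "\<dots> = asum (r j) x A (\<lambda>k. e k \<bullet> p k \<bullet> e j)" by (intro asum_cong) (simp add: pfe)
    also have "\<dots> = e j" using decomp_expand_left[OF dc, of "e j"] by simp
    finally show ?thesis .
  qed
  have "f = asum x x A (\<lambda>j. f \<bullet> e j \<bullet> p j)" using decomp_expand_right[OF dc, of f] by simp
  also have "\<dots> = asum x x A (\<lambda>j. e j \<bullet> p j)"
  proof (rule asum_cong)
    fix j assume [simp]: "j \<in> A"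
    show "f \<bullet> e j \<bullet> p j = e j \<bullet> p j" using reassoc1[OF fe, of j "p j"] by simp
  qed
  also have "\<dots> = \<iota> x" by (rule decompD(10)[OF dc])
  finally show ?thesis .
qed

text \<open>Bases of the arrows from and to a simple object \<open>l\<close>, dual to each other
  under composition; they describe the part of \<open>x\<close> of type \<open>l\<close>.\<close>

definition dual_bases :: "'o list \<Rightarrow> 'o list \<Rightarrow> 'i set \<Rightarrow> ('i \<Rightarrow> 'a) \<Rightarrow> ('i \<Rightarrow> 'a) \<Rightarrow> bool" where
  "dual_bases x l A e p \<longleftrightarrow> finite A \<and>
     (\<forall>j\<in>A. arr (e j) \<and> src (e j) = l \<and> trg (e j) = x \<and> arr (p j) \<and> src (p j) = x \<and> trg (p j) = l) \<and>
     (\<forall>j\<in>A. \<forall>k\<in>A. p j \<bullet> e k = (if j = k then \<iota> l else zero l l)) \<and>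
     (\<forall>h. arr h \<longrightarrow> src h = l \<longrightarrow> trg h = x \<longrightarrow> h = asum l x A (\<lambda>j. e j \<bullet> p j \<bullet> h))"

lemma dual_basesD:
  assumes "dual_bases x l A e p"
  shows "finite A" "j \<in> A \<Longrightarrow> arr (e j)" "j \<in> A \<Longrightarrow> src (e j) = l" "j \<in> A \<Longrightarrow> trg (e j) = x"
    "j \<in> A \<Longrightarrow> arr (p j)" "j \<in> A \<Longrightarrow> src (p j) = x" "j \<in> A \<Longrightarrow> trg (p j) = l"
    "\<lbrakk>j \<in> A; k \<in> A\<rbrakk> \<Longrightarrow> p j \<bullet> e k = (if j = k then \<iota> l else zero l l)"
    "\<lbrakk>arr h; src h = l; trg h = x\<rbrakk> \<Longrightarrow> h = asum l x A (\<lambda>j. e j \<bullet> p j \<bullet> h)"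
  using assms unfolding dual_bases_def by blast+

lemma decomp_dual_bases:
  assumes dc: "decomp x A r e p" and l: "l \<in> R"
  shows "dual_bases x l {j\<in>A. r j = l} e p"
  unfolding dual_bases_def
proof (intro conjI allI impI)
  note [simp] = decompD(1-8)[OF dc]
  fix h assume [simp]: "arr h" "src h = l" "trg h = x"
  have "h = asum l x A (\<lambda>j. e j \<bullet> p j \<bullet> h)" using decomp_expand_left[OF dc, of h] by simp
  also have "\<dots> = asum l x {j\<in>A. r j = l} (\<lambda>j. e j \<bullet> p j \<bullet> h)"
  proof (rule asum_mono_neutral)
    fix j assume j: "j \<in> A - {j\<in>A. r j = l}"
    then have "p j \<bullet> h = zero l (r j)"
      using schur[OF l, of "r j" "p j \<bullet> h"] zero_eq[of "p j \<bullet> h"] by auto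
    then show "e j \<bullet> p j \<bullet> h = zero l x" using j by simp
  qed auto
  finally show "h = asum l x {j\<in>A. r j = l} (\<lambda>j. e j \<bullet> p j \<bullet> h)" .
qed (use decompD[OF dc] in auto)

text \<open>Expanding each basis in the other exhibits both cardinalities, times \<open>d l\<close>,
  as the same double sum of traces up to cyclicity. Characteristic zero and
  \<open>d l \<noteq> 0\<close> then give equality of the cardinalities.\<close>

lemma dual_bases_unique:
  assumes l: "l \<in> R" and F: "dual_bases x l A e p" and G: "dual_bases x l B f q"
  shows "card A = card B"
proof -
  note [simp] = dual_basesD(1-7)[OF F] dual_basesD(1-7)[OF G]
  have A: "of_nat (card A) * d l = (\<Sum>a\<in>A. \<Sum>b\<in>B. T (p a \<bullet> f b \<bullet> q b \<bullet> e a))"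
  proof -
    have "(\<Sum>b\<in>B. T (p a \<bullet> f b \<bullet> q b \<bullet> e a)) = d l" if [simp]: "a \<in> A" for a
    proof -
      have "d l = T (p a \<bullet> e a)" using dual_basesD(8)[OF F] by (simp add: d_def)
      also have "e a = asum l x B (\<lambda>b. f b \<bullet> q b \<bullet> e a)" by (rule dual_basesD(9)[OF G]) auto
      also have "p a \<bullet> \<dots> = asum l l B (\<lambda>b. p a \<bullet> f b \<bullet> q b \<bullet> e a)" by (subst comp_asum_right) auto
      also have "T \<dots> = (\<Sum>b\<in>B. T (p a \<bullet> f b \<bullet> q b \<bullet> e a))" by (rule T_asum) auto
      finally show ?thesis by simp
    qed
    then show ?thesis by simp
  qed
  have B: "of_nat (card B) * d l = (\<Sum>b\<in>B. \<Sum>a\<in>A. T (q b \<bullet> e a \<bullet> p a \<bullet> f b))"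
  proof -
    have "(\<Sum>a\<in>A. T (q b \<bullet> e a \<bullet> p a \<bullet> f b)) = d l" if [simp]: "b \<in> B" for b
    proof -
      have "d l = T (q b \<bullet> f b)" using dual_basesD(8)[OF G] by (simp add: d_def)
      also have "f b = asum l x A (\<lambda>a. e a \<bullet> p a \<bullet> f b)" by (rule dual_basesD(9)[OF F]) auto
      also have "q b \<bullet> \<dots> = asum l l A (\<lambda>a. q b \<bullet> e a \<bullet> p a \<bullet> f b)" by (subst comp_asum_right) auto
      also have "T \<dots> = (\<Sum>a\<in>A. T (q b \<bullet> e a \<bullet> p a \<bullet> f b))" by (rule T_asum) auto
      finally show ?thesis by simp
    qed
    then show ?thesis by simp
  qed
  have "T (p a \<bullet> f b \<bullet> q b \<bullet> e a) = T (q b \<bullet> e a \<bullet> p a \<bullet> f b)" if [simp]: "a \<in> A" "b \<in> B" for a b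
    using T_cyclic[of "q b \<bullet> e a" l l "p a \<bullet> f b"] by simp
  then have "of_nat (card A) * d l = (\<Sum>a\<in>A. \<Sum>b\<in>B. T (q b \<bullet> e a \<bullet> p a \<bullet> f b))"
    unfolding A by (simp cong: sum.cong)
  also have "\<dots> = of_nat (card B) * d l" unfolding B by (rule sum.swap)
  finally show ?thesis using d_nonzero[OF l] by simp
qed

lemma dual_bases_iso:
  assumes F: "dual_bases x l A e p"
    and [simp]: "arr i" "src i = x" "trg i = y" "arr i'" "src i' = y" "trg i' = x"
    and inv: "i' \<bullet> i = \<iota> x" "i \<bullet> i' = \<iota> y"
  shows "dual_bases y l A (\<lambda>j. i \<bullet> e j) (\<lambda>j. p j \<bullet> i')"
  unfolding dual_bases_def
proof (intro conjI ballI allI impI)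
  note [simp] = dual_basesD(1-7)[OF F]
  fix j k assume [simp]: "j \<in> A" "k \<in> A"
  show "(p j \<bullet> i') \<bullet> i \<bullet> e k = (if j = k then \<iota> l else zero l l)"
    using reassoc1[OF inv(1), of "e k"] dual_basesD(8)[OF F, of j k] by simp
next
  note [simp] = dual_basesD(1-7)[OF F]
  fix h assume [simp]: "arr h" "src h = l" "trg h = y"
  have "h = i \<bullet> i' \<bullet> h" using reassoc1[OF inv(2), of h] by simp
  also have "i' \<bullet> h = asum l x A (\<lambda>j. e j \<bullet> p j \<bullet> i' \<bullet> h)" by (rule dual_basesD(9)[OF F]) auto
  also have "i \<bullet> \<dots> = asum l y A (\<lambda>j. i \<bullet> e j \<bullet> p j \<bullet> i' \<bullet> h)" by (subst comp_asum_right) auto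
  finally show "h = asum l y A (\<lambda>j. (i \<bullet> e j) \<bullet> (p j \<bullet> i') \<bullet> h)" by (simp add: asum_def)
qed (use dual_basesD[OF F] in auto)

text \<open>The multiplicity of \<open>l\<close> in \<open>x\<close>. Index sets of naturals merely
  fix a type for the choice; by \<open>N_dual_bases\<close> any dual bases give the same
  number.\<close>

definition N :: "'o list \<Rightarrow> 'o list \<Rightarrow> nat" where
  "N x l = (SOME n. \<exists>(A :: nat set) r e p. decomp x A r e p \<and> n = card {j\<in>A. r j = l})"

lemma N_dual_bases:
  assumes F: "dual_bases x l B f q" and l: "l \<in> R"
  shows "N x l = card B"
proof -
  have "\<exists>n. \<exists>(A :: nat set) r e p. decomp x A r e p \<and> n = card {j\<in>A. r j = l}" using ex_decomp by blast
  from someI_ex[OF this] obtain A :: "nat set" and r e p where "decomp x A r e p" "N x l = card {j\<in>A. r j = l}"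
    unfolding N_def by blast
  then show ?thesis using dual_bases_unique[OF l decomp_dual_bases F] l by simp
qed

lemma N_iso:
  assumes "arr i" "src i = x" "trg i = y" "arr i'" "src i' = y" "trg i' = x"
    "i' \<bullet> i = \<iota> x" "i \<bullet> i' = \<iota> y" and l: "l \<in> R"
  shows "N x l = N y l"
proof -
  obtain A :: "nat set" and r e p where dc: "decomp x A r e p" using ex_decomp by blast
  note F = decomp_dual_bases[OF dc l]
  show ?thesis using N_dual_bases[OF F l] N_dual_bases[OF dual_bases_iso[OF F assms(1-8)] l] by simp
qed

lemma sum_decomp:
  assumes dc: "decomp x A r e p"
  shows "(\<Sum>j\<in>A. f (r j)) = (\<Sum>l\<in>R. of_nat (N x l) * (f l :: 'k))"
proof -
  have "(\<Sum>j\<in>A. f (r j)) = (\<Sum>l\<in>R. \<Sum>j\<in>{j\<in>A. r j = l}. f (r j))"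
    using decompD(1,2)[OF dc] finite_R by (intro sum.group[symmetric]) auto
  also have "\<dots> = (\<Sum>l\<in>R. of_nat (N x l) * f l)"
    using N_dual_bases[OF decomp_dual_bases[OF dc]] by (intro sum.cong) auto
  finally show ?thesis .
qed

text \<open>The factor \<open>d l / d k\<close> arises because \<open>b i \<bullet> a j\<close> can be closed to a trace over \<open>l\<close> or over \<open>k\<close>.\<close>

lemma rotate_dual_bases:
  assumes dp: "dual_pair W y e c" and dc: "decomp (l @ W) A r b a" and l: "l \<in> R" and k: "k \<in> R"
  shows "dual_bases (k @ y) l {j\<in>A. r j = k} (\<lambda>j. (a j \<odot> \<iota> y) \<bullet> (\<iota> l \<odot> c))
    (\<lambda>j. sm (d l / d k) ((\<iota> l \<odot> tev W y e) \<bullet> (b j \<odot> \<iota> y)))"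
proof -
  note [simp] = dual_pairD(1-6)[OF dp] decompD(1-8)[OF dc]
  let ?A = "{j\<in>A. r j = k}"
  define E where "E j = (a j \<odot> \<iota> y) \<bullet> (\<iota> l \<odot> c)" for j
  define P where "P j = sm (d l / d k) ((\<iota> l \<odot> tev W y e) \<bullet> (b j \<odot> \<iota> y))" for j
  have [simp]: "arr (E j)" "src (E j) = l" "trg (E j) = k @ y" "arr (P j)" "src (P j) = k @ y" "trg (P j) = l"
    if "j \<in> A" "r j = k" for j
    using that by (simp_all add: E_def P_def)
  have orth: "P i \<bullet> E j = (if i = j then \<iota> l else zero l l)" if ij [simp]: "i \<in> A" "j \<in> A" "r i = k" "r j = k" for i j
  proof -
    let ?P = "ptr l W y e c (b i \<bullet> a j)"
    have [simp]: "arr ?P" "src ?P = l" "trg ?P = l" by (simp_all add: ptr_def)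
    have P: "?P = sm (sc ?P) (\<iota> l)" by (rule sc_eq[OF brick_R[OF l]]) auto
    then have "sc ?P * d l = T ?P" unfolding d_def by (metis T_sm arr_idt src_idt trg_idt)
    also have "\<dots> = T (b i \<bullet> a j)"
      using T_ptr[OF dp, of "b i \<bullet> a j" l] by simp
    also have "\<dots> = T (a j \<bullet> b i)"
      using T_cyclic[of "a j" "l @ W" k "b i"] by simp
    also have "\<dots> = (if i = j then d k else 0)"
      using decompD(9)[OF dc, of j i] by (auto simp: d_def)
    finally have "sc ?P = (if i = j then d k / d l else 0)"
      using d_nonzero[OF l] by (simp add: field_simps split: if_splits)
    then have "sm (d l / d k) ?P = (if i = j then \<iota> l else zero l l)"
      using d_nonzero[OF l] d_nonzero[OF k] by (subst P) simp
    then show ?thesis by (simp add: E_def P_def ptr_def)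
  qed
  have complete: "h = asum l (k @ y) ?A (\<lambda>j. E j \<bullet> P j \<bullet> h)"
    if [simp]: "arr h" "src h = l" "trg h = k @ y" for h
  proof -
  \<comment> \<open>Bending the strand \<open>y\<close> back to \<open>W\<close> turns
    \<open>h\<close> into an arrow from \<open>l @ W\<close> to \<open>k\<close>, which the given
    decomposition expands.\<close>
  define g where "g = (\<iota> k \<odot> e) \<bullet> (h \<odot> \<iota> W)"
  have [simp]: "arr g" "src g = l @ W" "trg g = k" by (simp_all add: g_def)
  have hg: "h = (g \<odot> \<iota> y) \<bullet> (\<iota> l \<odot> c)"
  proof -
    have "(g \<odot> \<iota> y) \<bullet> (\<iota> l \<odot> c) = (\<iota> k \<odot> e \<odot> \<iota> y) \<bullet> (h \<odot> \<iota> (W @ y)) \<bullet> (\<iota> l \<odot> c)"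
      by (simp add: g_def)
    also have "(h \<odot> \<iota> (W @ y)) \<bullet> (\<iota> l \<odot> c) = (\<iota> (k @ y) \<odot> c) \<bullet> h"
      using slide[of h c l "W @ y" "k @ y" "[]"] by simp
    also have "(\<iota> k \<odot> e \<odot> \<iota> y) \<bullet> (\<iota> (k @ y) \<odot> c) \<bullet> h = h"
      using reassoc1[OF whisker_both[OF dual_pairD(8)[OF dp], of k "[]"], of h] by simp
    finally show ?thesis by simp
  qed
  define s where "s j = sc (g \<bullet> b j)" for j
  have gb: "g \<bullet> b j = (if r j = k then sm (s j) (\<iota> k) else zero (r j) k)" if [simp]: "j \<in> A" for j
    using schur[of "r j" k "g \<bullet> b j"] zero_eq[of "g \<bullet> b j"] k sc_eq[OF brick_R[OF k], of "g \<bullet> b j"]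
    by (auto simp: s_def)
  have "g = asum (l @ W) k A (\<lambda>j. g \<bullet> b j \<bullet> a j)" using decomp_expand_right[OF dc, of g] by simp
  also have "\<dots> = asum (l @ W) k ?A (\<lambda>j. g \<bullet> b j \<bullet> a j)"
  proof (rule asum_mono_neutral)
    fix j assume "j \<in> A - ?A"
    then have [simp]: "j \<in> A" and "r j \<noteq> k" by auto
    then show "g \<bullet> b j \<bullet> a j = zero (l @ W) k" using reassoc1[OF gb, of j "a j"] by simp
  qed auto
  also have "\<dots> = asum (l @ W) k ?A (\<lambda>j. sm (s j) (a j))"
  proof (rule asum_cong)
    fix j assume "j \<in> ?A"
    then have [simp]: "j \<in> A" "r j = k" by auto
    then show "g \<bullet> b j \<bullet> a j = sm (s j) (a j)" using reassoc1[OF gb, of j "a j"] by simp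
  qed
  finally have g: "g = asum (l @ W) k ?A (\<lambda>j. sm (s j) (a j))" .
  have hE: "h = asum l (k @ y) ?A (\<lambda>j. sm (s j) (E j))"
    unfolding hg g by (subst tens_asum_left, simp_all, subst comp_asum_left, simp_all, rule asum_cong, simp add: E_def)
  have Ph: "P i \<bullet> h = sm (s i) (\<iota> l)" if [simp]: "i \<in> A" "r i = k" for i
  proof (rule arr_eqI)
    have "P i \<bullet> h = asum l l ?A (\<lambda>j. sm (s j) (P i \<bullet> E j))"
      by (subst hE, subst comp_asum_right) (auto intro!: asum_cong)
    also have "\<dots> = asum l l ?A (\<lambda>j. if i = j then sm (s i) (\<iota> l) else zero l l)"
      by (rule asum_cong) (simp add: orth)
    also have "vec \<dots> = (\<Sum>j\<in>?A. if i = j then s i *s vec (\<iota> l) else 0)"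
      by (simp add: if_distrib cong: if_cong)
    also have "\<dots> = vec (sm (s i) (\<iota> l))" by simp
    finally show "vec (P i \<bullet> h) = vec (sm (s i) (\<iota> l))" .
  qed simp_all
  show "h = asum l (k @ y) ?A (\<lambda>j. E j \<bullet> P j \<bullet> h)"
    by (subst hE, rule asum_cong) (simp add: Ph)
  qed
  show ?thesis
    unfolding dual_bases_def E_def[symmetric] P_def[symmetric] using complete orth by simp
qed

text \<open>The sum of all \<open>e l j \<bullet> p l j\<close> acts as the identity on arrows out
  of simple objects. Since some decomposition factors \<open>\<iota> x\<close> through such arrows,
  the sum is \<open>\<iota> x\<close> itself.\<close>

lemma decomp_of_dual_bases:
  assumes F: "\<And>l. l \<in> R \<Longrightarrow> dual_bases x l (J l) (e l) (p l)"
  shows "decomp x (Sigma R J) fst (\<lambda>(l, j). e l j) (\<lambda>(l, j). p l j)"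
proof -
  have [simp]: "arr (e l j)" "src (e l j) = l" "trg (e l j) = x" "arr (p l j)" "src (p l j) = x" "trg (p l j) = l"
    if "l \<in> R" "j \<in> J l" for l j
    using dual_basesD[OF F[OF that(1)]] that by auto
  have finJ: "finite (J l)" if "l \<in> R" for l using dual_basesD(1)[OF F[OF that]] .
  let ?q = "asum x x (Sigma R J) (\<lambda>(l, j). e l j \<bullet> p l j)"
  have [simp]: "arr ?q" by (rule arr_asum) auto
  have qf: "?q \<bullet> f = f" if l: "l \<in> R" and [simp]: "arr f" "src f = l" "trg f = x" for f l
  proof (rule arr_eqI)
    have z: "e l' j \<bullet> p l' j \<bullet> f = zero l x" if "l' \<in> R" "j \<in> J l'" "l' \<noteq> l" for l' j
    proof -
      have "p l' j \<bullet> f = zero l l'"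
        using schur[OF l that(1), of "p l' j \<bullet> f"] zero_eq[of "p l' j \<bullet> f"] that by simp
      then show ?thesis using that by simp
    qed
    have "vec (?q \<bullet> f) = (\<Sum>(l', j)\<in>Sigma R J. vec (e l' j \<bullet> p l' j \<bullet> f))"
      by (subst vec_comp_asum_left) (auto intro!: sum.cong)
    also have "\<dots> = (\<Sum>l'\<in>R. \<Sum>j\<in>J l'. vec (e l' j \<bullet> p l' j \<bullet> f))"
      using finite_R finJ by (subst sum.Sigma) auto
    also have "\<dots> = (\<Sum>l'\<in>R. if l' = l then \<Sum>j\<in>J l. vec (e l j \<bullet> p l j \<bullet> f) else 0)"
      by (intro sum.cong) (auto simp: z)
    also have "\<dots> = vec (asum l x (J l) (\<lambda>j. e l j \<bullet> p l j \<bullet> f))"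
      using finite_R l by simp
    also have "asum l x (J l) (\<lambda>j. e l j \<bullet> p l j \<bullet> f) = f"
      using dual_basesD(9)[OF F[OF l], of f] by simp
    finally show "vec (?q \<bullet> f) = vec f" .
  qed simp_all
  obtain A :: "nat set" and r f g where dc: "decomp x A r f g" using ex_decomp by blast
  note [simp] = decompD(1-8)[OF dc]
  have "?q = asum x x A (\<lambda>j. ?q \<bullet> f j \<bullet> g j)" using decomp_expand_right[OF dc, of ?q] by simp
  also have "\<dots> = asum x x A (\<lambda>j. f j \<bullet> g j)"
  proof (rule asum_cong)
    fix j assume [simp]: "j \<in> A"
    have "?q \<bullet> f j = f j" by (rule qf[of "r j"]) auto
    from reassoc1[OF this, of "g j"] show "?q \<bullet> f j \<bullet> g j = f j \<bullet> g j" by simp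
  qed
  also have "\<dots> = \<iota> x" by (rule decompD(10)[OF dc])
  finally have q: "?q = \<iota> x" .
  have orth: "p l j \<bullet> e l' j' = (if (l, j) = (l', j') then \<iota> l else zero l' l)"
    if "l \<in> R" "l' \<in> R" "j \<in> J l" "j' \<in> J l'" for l l' j j'
  proof (cases "l = l'")
    case True
    then show ?thesis using dual_basesD(8)[OF F[OF that(1)]] that by auto
  next
    case False
    then show ?thesis using schur[of l' l "p l j \<bullet> e l' j'"] zero_eq[of "p l j \<bullet> e l' j'"] that by simp
  qed
  show ?thesis
    unfolding decomp_def using finite_R finJ q orth by (auto simp: case_prod_beta')
qed

section \<open>Duals among the representatives and fusion coefficients\<close>

lemma dual_pair_iso:
  assumes dp: "dual_pair x y e c" and [simp]: "arr i" "src i = y" "trg i = z" "arr i'" "src i' = z" "trg i' = y"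
    and inv: "i' \<bullet> i = \<iota> y" "i \<bullet> i' = \<iota> z"
  shows "dual_pair x z (e \<bullet> (i' \<odot> \<iota> x)) ((\<iota> x \<odot> i) \<bullet> c)"
proof -
  note [simp] = dual_pairD(1-6)[OF dp]
  have 1: "(\<iota> x \<odot> e) \<bullet> (\<iota> x \<odot> i' \<odot> \<iota> x) \<bullet> (\<iota> x \<odot> i \<odot> \<iota> x) \<bullet> (c \<odot> \<iota> x) = \<iota> x"
    using reassoc1[OF whisker_both[OF inv(1), of x x], of "c \<odot> \<iota> x"] dual_pairD(7)[OF dp] by simp
  have "(e \<odot> \<iota> z) \<bullet> (i' \<odot> \<iota> (x @ z)) \<bullet> (\<iota> (z @ x) \<odot> i) \<bullet> (\<iota> z \<odot> c)
      = (e \<odot> \<iota> z) \<bullet> (\<iota> (y @ x) \<odot> i) \<bullet> (i' \<odot> \<iota> (x @ y)) \<bullet> (\<iota> z \<odot> c)"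
    using reassoc[OF slide[of "i' \<odot> \<iota> x" i "z @ x" z "y @ x" y], of "\<iota> z \<odot> c"] by simp
  also have "(i' \<odot> \<iota> (x @ y)) \<bullet> (\<iota> z \<odot> c) = (\<iota> y \<odot> c) \<bullet> i'"
    using slide[of i' c z "x @ y" y "[]"] by simp
  also have "(e \<odot> \<iota> z) \<bullet> (\<iota> (y @ x) \<odot> i) \<bullet> (\<iota> y \<odot> c) \<bullet> i' = i \<bullet> (e \<odot> \<iota> y) \<bullet> (\<iota> y \<odot> c) \<bullet> i'"
    using reassoc[OF slide[of e i "y @ x" z "[]" y], of "(\<iota> y \<odot> c) \<bullet> i'"] by simp
  also have "(e \<odot> \<iota> y) \<bullet> (\<iota> y \<odot> c) \<bullet> i' = i'"
    using reassoc1[OF dual_pairD(8)[OF dp], of i'] by simp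
  finally show ?thesis using 1 inv by (simp add: dual_pair_def)
qed

text \<open>A dual of \<open>x\<close> is a brick, and a brick is isomorphic to any of its simple
  summands: the idempotent \<open>f j \<bullet> g j\<close> is a nonzero scalar, hence 1. So the
  dual can be replaced by a member of \<open>R\<close>, and naturality carries the twist
  along.\<close>

lemma ex_bar:
  assumes x: "x \<in> R"
  shows "\<exists>y\<in>R. (\<exists>e c. dual_pair x y e c) \<and> \<theta> y = \<theta> x"
proof -
  obtain y e c where dp: "dual_pair x y e c" and tw: "\<And>t. vec (tw x) = t *s vec (\<iota> x) \<Longrightarrow> vec (tw y) = t *s vec (\<iota> y)"
    using ex_dual_R[OF x] by blast
  have twy: "tw y = sm (\<theta> x) (\<iota> y)"
    using tw[of "\<theta> x"] tw_eq[OF x] by (intro arr_eqI) (auto dest: arg_cong[of _ _ vec])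
  have bry: "brick y" by (rule brick_dual[OF dp brick_R[OF x]])
  obtain A :: "nat set" and r f g where dc: "decomp y A r f g" using ex_decomp by blast
  have "A \<noteq> {}" using decompD(10)[OF dc] by (auto simp: asum_def) (metis brick_def bry vec_mk)
  then obtain j where j: "j \<in> A" by blast
  note [simp] = decompD(1-8)[OF dc] j
  have b: "brick (r j)" by (rule brick_R) simp
  have gf: "g j \<bullet> f j = \<iota> (r j)" using decompD(9)[OF dc j j] by simp
  obtain s where s: "f j \<bullet> g j = sm s (\<iota> y)" using bry by (force simp: brick_def)
  have "\<iota> (r j) = (g j \<bullet> f j) \<bullet> (g j \<bullet> f j)" by (simp add: gf)
  also have "\<dots> = g j \<bullet> (f j \<bullet> g j) \<bullet> f j" by simp
  also have "\<dots> = sm s (\<iota> (r j))" by (simp add: s gf)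
  finally have "s = 1" using sm_idt_inject[OF b, of 1 s] by simp
  then have fg: "f j \<bullet> g j = \<iota> y" by (simp add: s)
  have "tw (r j) = g j \<bullet> f j \<bullet> tw (r j)" using reassoc1[OF gf, of "tw (r j)"] by simp
  also have "f j \<bullet> tw (r j) = tw y \<bullet> f j" using tw_natural[of "f j"] by simp
  also have "g j \<bullet> tw y \<bullet> f j = sm (\<theta> x) (\<iota> (r j))" by (simp add: twy gf)
  finally have "\<theta> (r j) = \<theta> x" using b by (simp add: \<theta>_def)
  then show ?thesis
    using dual_pair_iso[OF dp, of "g j" "r j" "f j"] gf fg by (intro bexI[of _ "r j"]) auto
qed

definition bar :: "'o list \<Rightarrow> 'o list" where
  "bar x = (SOME y. y \<in> R \<and> (\<exists>e c. dual_pair x y e c) \<and> \<theta> y = \<theta> x)"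

lemma bar:
  assumes "x \<in> R"
  shows "bar x \<in> R" "\<exists>e c. dual_pair x (bar x) e c" "\<theta> (bar x) = \<theta> x"
  using someI_ex[of "\<lambda>y. y \<in> R \<and> (\<exists>e c. dual_pair x y e c) \<and> \<theta> y = \<theta> x"] ex_bar[OF assms]
  unfolding bar_def by blast+

text \<open>The flipped dual pair computes \<open>d (bar x)\<close> from the same crossed loop as
  \<open>d x\<close>, with the twist of \<open>bar x\<close> in place of that of \<open>x\<close>.
  Equality of the two twists is what makes the dimensions agree.\<close>

lemma d_bar:
  assumes x: "x \<in> R"
  shows "d (bar x) = d x"
proof -
  obtain e c where dp: "dual_pair x (bar x) e c" using bar(2)[OF x] by blast
  note [simp] = dual_pairD(1-6)[OF dp]
  have "tev (bar x) x (e \<bullet> br x (bar x)) \<bullet> ibr (bar x) x \<bullet> c = sm (\<theta> x) (e \<bullet> br x (bar x) \<bullet> c)"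
    using bar(3)[OF x] by (simp add: tev_def tw_eq[OF bar(1)[OF x]])
  also have "\<dots> = tev x (bar x) e \<bullet> c" by (simp add: tev_def tw_eq[OF x])
  finally show ?thesis
    using T_sc[OF dp, of "\<iota> x"] T_sc[OF dual_pair_flip[OF dp], of "\<iota> (bar x)"] by (simp add: d_def)
qed

text \<open>Structure constants of the fusion ring on \<open>R\<close>.\<close>

definition n :: "'o list \<Rightarrow> 'o list \<Rightarrow> 'o list \<Rightarrow> nat" where "n i j l = N (i @ j) l"

lemma n_commute: "l \<in> R \<Longrightarrow> n i j l = n j i l"
  unfolding n_def using N_iso[of "br i j" "i @ j" "j @ i" "ibr i j" l] by simp

text \<open>Frobenius reciprocity: moving a factor to the other side of an arrow replaces it by its
  dual.\<close>

lemma n_dual: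
  assumes "i \<in> R" "j \<in> R" "k \<in> R"
  shows "n i j k = n k (bar j) i"
proof -
  obtain e c where dp: "dual_pair j (bar j) e c" using bar(2) assms by blast
  obtain A :: "nat set" and r b a where dc: "decomp (i @ j) A r b a" using ex_decomp by blast
  show ?thesis
    using N_dual_bases[OF rotate_dual_bases[OF dp dc assms(1,3)] assms(1)] N_dual_bases[OF decomp_dual_bases[OF dc assms(3)] assms(3)]
    by (simp add: n_def)
qed

lemma d_tens: "d (x @ y) = d x * d y"
  unfolding d_def using T_tens[of "\<iota> x" x "\<iota> y" y] by simp

lemma d_sum: "d x = (\<Sum>l\<in>R. of_nat (N x l) * d l)"
proof -
  obtain A :: "nat set" and r b a where dc: "decomp x A r b a" using ex_decomp by blast
  note [simp] = decompD(1-8)[OF dc]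
  have "d x = (\<Sum>j\<in>A. d (r j))"
    using T_decomp0[OF dc, of "\<iota> x"] decompD(9)[OF dc] by (simp add: d_def)
  then show ?thesis using sum_decomp[OF dc, of d] by simp
qed

lemma d_mult: "d i * d j = (\<Sum>l\<in>R. of_nat (n i j l) * d l)"
  unfolding n_def d_sum[symmetric] d_tens by simp

section \<open>Hopf link invariants and characters of the fusion ring\<close>

definition S :: "'o list \<Rightarrow> 'o list \<Rightarrow> 'k" where "S x y = T (br y x \<bullet> br x y)"

lemma S_commute: "S x y = S y x"
  unfolding S_def by (rule T_cyclic[of _ "x @ y" "y @ x"]) auto

text \<open>The trace of the twist on \<open>i @ j\<close> is computed twice: through the double
  braiding by \<open>tw_tens\<close>, and through the simple summands by naturality.\<close>

lemma balancing:
  assumes "i \<in> R" "j \<in> R"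
  shows "\<theta> i * \<theta> j * S i j = (\<Sum>l\<in>R. of_nat (n i j l) * (\<theta> l * d l))"
proof -
  obtain A :: "nat set" and r b a where dc: "decomp (i @ j) A r b a" using ex_decomp by blast
  note [simp] = decompD(1-8)[OF dc]
  have "\<theta> i * \<theta> j * S i j = T (tw (i @ j))"
    by (simp add: tw_tens tw_eq[OF assms(1)] tw_eq[OF assms(2)] S_def)
  also have "\<dots> = (\<Sum>m\<in>A. T (a m \<bullet> tw (i @ j) \<bullet> b m))"
    by (rule T_decomp0[OF dc]) auto
  also have "\<dots> = (\<Sum>m\<in>A. \<theta> (r m) * d (r m))"
  proof (rule sum.cong[OF refl])
    fix m assume m [simp]: "m \<in> A"
    have "a m \<bullet> tw (i @ j) \<bullet> b m = a m \<bullet> b m \<bullet> tw (r m)" using tw_natural[of "b m"] by simp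
    also have "\<dots> = sm (\<theta> (r m)) (\<iota> (r m))" using decompD(9)[OF dc m m] by (simp add: tw_eq)
    finally show "T (a m \<bullet> tw (i @ j) \<bullet> b m) = \<theta> (r m) * d (r m)" by (simp add: d_def)
  qed
  finally show ?thesis using sum_decomp[OF dc, of "\<lambda>l. \<theta> l * d l"] by (simp add: n_def)
qed

text \<open>A circle \<open>X\<close> linked with both \<open>Y\<close> and \<open>Z\<close> is a
  connected sum of two Hopf links along \<open>X\<close>, so \<open>T_link\<close> applies.\<close>

lemma S_tens:
  assumes X: "X \<in> R"
  shows "S (Y @ Z) X * d X = S Y X * S Z X"
proof -
  let ?D = "br X Y \<bullet> br Y X" and ?E = "br Z X \<bullet> br X Z"
  have "br X (Y @ Z) \<bullet> br (Y @ Z) X = (\<iota> Y \<odot> br X Z) \<bullet> (?D \<odot> \<iota> Z) \<bullet> (\<iota> Y \<odot> br Z X)"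
    by (rule br_br_tens_left)
  then have "S (Y @ Z) X = T ((?D \<odot> \<iota> Z) \<bullet> (\<iota> Y \<odot> ?E))"
    unfolding S_def[of "Y @ Z" X] using T_cyclic[of "(?D \<odot> \<iota> Z) \<bullet> (\<iota> Y \<odot> br Z X)" "Y @ Z @ X" "Y @ X @ Z" "\<iota> Y \<odot> br X Z"] by simp
  moreover have "T ((?D \<odot> \<iota> Z) \<bullet> (\<iota> Y \<odot> ?E)) * d X = T ?D * T ?E"
    by (rule T_link[OF X]) auto
  moreover have "T ?D = S Y X" "T ?E = S Z X"
    by (simp_all add: S_def[symmetric] S_commute[of X Z])
  ultimately show ?thesis by simp
qed

text \<open>Additivity, by naturality of the double braiding. Together with \<open>S_tens\<close> it
  makes \<open>S _ X / d X\<close> a character of the fusion ring.\<close>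

lemma S_sum: "S x X = (\<Sum>l\<in>R. of_nat (N x l) * S l X)"
proof -
  obtain A :: "nat set" and r b a where dc: "decomp x A r b a" using ex_decomp by blast
  note [simp] = decompD(1-8)[OF dc]
  have "S x X = (\<Sum>j\<in>A. T ((a j \<odot> \<iota> X) \<bullet> (br X x \<bullet> br x X) \<bullet> (b j \<odot> \<iota> X)))"
    unfolding S_def by (rule T_decomp[OF dc]) auto
  also have "\<dots> = (\<Sum>j\<in>A. S (r j) X)"
  proof (rule sum.cong[OF refl])
    fix j assume j [simp]: "j \<in> A"
    have "(a j \<odot> \<iota> X) \<bullet> (br X x \<bullet> br x X) \<bullet> (b j \<odot> \<iota> X) = (a j \<odot> \<iota> X) \<bullet> (b j \<odot> \<iota> X) \<bullet> br X (r j) \<bullet> br (r j) X"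
      using br_br_natural[of "b j" "\<iota> X"] by simp
    also have "\<dots> = br X (r j) \<bullet> br (r j) X"
      using reassoc1[OF whisker_both[OF decompD(9)[OF dc j j], of "[]" X], of "br X (r j) \<bullet> br (r j) X"] by simp
    finally show "T ((a j \<odot> \<iota> X) \<bullet> (br X x \<bullet> br x X) \<bullet> (b j \<odot> \<iota> X)) = S (r j) X"
      by (simp add: S_def)
  qed
  finally show ?thesis using sum_decomp[OF dc, of "\<lambda>l. S l X"] by simp
qed

text \<open>Reciprocity rewrites \<open>n i j l\<close> as \<open>n l (bar i) j\<close>, so the sum
  over the second factor becomes an ordinary expansion of the product of \<open>d l\<close> and
  \<open>d (bar i)\<close>.\<close>

lemma n_sum_left:
  assumes "i \<in> R" "l \<in> R"
  shows "(\<Sum>j\<in>R. of_nat (n i j l) * d j) = d i * d l"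
proof -
  have "(\<Sum>j\<in>R. of_nat (n i j l) * d j) = (\<Sum>j\<in>R. of_nat (n l (bar i) j) * d j)"
    using assms n_commute[of l i] n_dual[of _ i l] by (intro sum.cong refl) metis
  then show ?thesis using d_bar[OF assms(1)] d_mult[of l "bar i"] by (simp add: mult.commute)
qed

lemma n_unit:
  assumes "j \<in> R" "l \<in> R"
  shows "n u j l = (if j = l then 1 else 0)"
proof -
  obtain i i' where i: "arr i" "src i = u" "trg i = []" "arr i'" "src i' = []" "trg i' = u" "i' \<bullet> i = \<iota> u" "i \<bullet> i' = \<iota> []"
    using unit_iso by blast
  have "N (u @ j) l = N j l"
    using i assms(2) whisker_both[OF i(7), of "[]" j] whisker_both[OF i(8), of "[]" j]
    by (intro N_iso[of "i \<odot> \<iota> j" _ _ "i' \<odot> \<iota> j"]) simp_all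
  moreover have "decomp j {0::nat} (\<lambda>_. j) (\<lambda>_. \<iota> j) (\<lambda>_. \<iota> j)"
    unfolding decomp_def asum_def using assms(1) by simp
  from N_dual_bases[OF decomp_dual_bases[OF this assms(2)] assms(2)] have "N j l = (if j = l then 1 else 0)" by simp
  ultimately show ?thesis by (simp add: n_def)
qed

text \<open>Needed for \<open>X = R\<close> and for the transparent simple objects. The two closure
  hypotheses allow the fusion sums over \<open>R\<close> to be restricted to
  \<open>X\<close>.\<close>

lemma sum_d_squared_nonzero:
  assumes X: "X \<subseteq> R" "u \<in> X"
    and mult: "\<And>i j l. \<lbrakk>i \<in> X; j \<in> X; l \<in> R - X\<rbrakk> \<Longrightarrow> n i j l = 0"
    and dual: "\<And>i l m. \<lbrakk>i \<in> X; l \<in> X; m \<in> R - X\<rbrakk> \<Longrightarrow> n i m l = 0"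
  shows "(\<Sum>i\<in>X. (d i)\<^sup>2) \<noteq> 0"
proof (rule sum_squares_character_nonzero[where n = n and u = u])
  show "finite X" using X(1) finite_R by (rule finite_subset)
  show "d u \<noteq> 0" using d_nonzero unit_R .
  show "n u j l = (if j = l then 1 else 0)" if "j \<in> X" "l \<in> X" for j l
    using that X n_unit by blast
  fix i j assume ij: "i \<in> X" "j \<in> X"
  show "(\<Sum>l\<in>X. of_nat (n i j l) * d l) = d i * d j"
    unfolding d_mult by (rule sum.mono_neutral_left) (use X ij mult finite_R in auto)
  have "(\<Sum>m\<in>X. of_nat (n i m j) * d m) = (\<Sum>m\<in>R. of_nat (n i m j) * d m)"
    by (rule sum.mono_neutral_left) (use X ij dual finite_R in auto)
  then show "(\<Sum>m\<in>X. of_nat (n i m j) * d m) = d i * d j"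
    using n_sum_left[of i j] X ij by auto
qed (use X in auto)

definition D :: 'k where "D = (\<Sum>j\<in>R. (d j)\<^sup>2)"

lemma D_nonzero: "D \<noteq> 0"
  unfolding D_def by (rule sum_d_squared_nonzero) (use unit_R in auto)

text \<open>Two different characters are compared. Multiplying the sum by \<open>S k X\<close>
  shifts the index by \<open>k\<close>; since the sum of \<open>d j\<close> times \<open>j\<close>
  is an eigenvector of that shift, the result is \<open>d k * d X\<close> times the sum.\<close>

lemma S_orthogonal:
  assumes X: "X \<in> R" and k: "k \<in> R" "S k X \<noteq> d k * d X"
  shows "(\<Sum>j\<in>R. d j * S j X) = 0"
proof -
  let ?Z = "\<Sum>j\<in>R. d j * S j X"
  have "S k X * ?Z = (\<Sum>j\<in>R. d j * (S k X * S j X))"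
    by (simp add: sum_distrib_left mult_ac)
  also have "\<dots> = (\<Sum>j\<in>R. d j * ((\<Sum>l\<in>R. of_nat (n k j l) * S l X) * d X))"
    by (simp add: S_tens[OF X, symmetric] S_sum[of "_ @ _"] n_def)
  also have "\<dots> = (\<Sum>j\<in>R. \<Sum>l\<in>R. d X * S l X * (of_nat (n k j l) * d j))"
    by (simp add: sum_distrib_left sum_distrib_right mult_ac)
  also have "\<dots> = (\<Sum>l\<in>R. d X * S l X * (\<Sum>j\<in>R. of_nat (n k j l) * d j))"
    unfolding sum_distrib_left by (rule sum.swap)
  also have "\<dots> = (\<Sum>l\<in>R. d X * S l X * (d k * d l))"
    by (simp add: n_sum_left k)
  also have "\<dots> = d k * d X * ?Z"
    by (simp add: sum_distrib_left mult_ac)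
  finally have "(S k X - d k * d X) * ?Z = 0" by (simp add: algebra_simps)
  then show ?thesis using k(2) by simp
qed

text \<open>The sliding property: a strand \<open>y\<close> passes through a circle labelled by the Kirby colour \<open>\<Sum>k. d k \<cdot> k\<close>.\<close>

lemma kirby_slide:
  assumes dp: "dual_pair W y e c"
    and \<psi>: "\<And>Y. arr (\<psi> Y)" "\<And>Y. src (\<psi> Y) = Y @ X" "\<And>Y. trg (\<psi> Y) = Y @ X"
    and nat: "\<And>f. arr f \<Longrightarrow> \<psi> (trg f) \<bullet> (f \<odot> \<iota> X) = (f \<odot> \<iota> X) \<bullet> \<psi> (src f)"
    and g: "arr g" "src g = y @ X" "trg g = y @ X"
  shows "(\<Sum>k\<in>R. d k * T ((\<iota> k \<odot> g) \<bullet> \<psi> (k @ y))) =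
    (\<Sum>l\<in>R. d l * T ((\<iota> l \<odot> ((tev W y e \<odot> \<iota> X) \<bullet> (\<iota> W \<odot> g) \<bullet> (c \<odot> \<iota> X))) \<bullet> \<psi> l))"
proof -
  note [simp] = dual_pairD(1-6)[OF dp] \<psi> g
  \<comment> \<open>A decomposition of \<open>l @ W\<close> is fixed for every \<open>l\<close>; the
    tuple serves to choose all its components at once.\<close>
  have "\<forall>l. \<exists>q :: nat set \<times> (nat \<Rightarrow> 'a) \<times> (nat \<Rightarrow> 'a) \<times> (nat \<Rightarrow> 'o list).
     decomp (l @ W) (fst q) (snd (snd (snd q))) (fst (snd q)) (fst (snd (snd q)))"
    using ex_decomp by (metis fst_conv snd_conv)
  then obtain q :: "'o list \<Rightarrow> nat set \<times> (nat \<Rightarrow> 'a) \<times> (nat \<Rightarrow> 'a) \<times> (nat \<Rightarrow> 'o list)" where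
    q: "\<And>l. decomp (l @ W) (fst (q l)) (snd (snd (snd (q l)))) (fst (snd (q l))) (fst (snd (snd (q l))))"
    by metis
  define A where "A l = fst (q l)" for l
  define b where "b l = fst (snd (q l))" for l
  define a where "a l = fst (snd (snd (q l)))" for l
  define r where "r l = snd (snd (snd (q l)))" for l
  have dc: "decomp (l @ W) (A l) (r l) (b l) (a l)" for l
    using q[of l] by (simp add: A_def b_def a_def r_def)
  note [simp] = decompD(1-8)[OF dc]
  define M where "M l = \<iota> l \<odot> tev W y e \<odot> \<iota> X" for l
  define C where "C l = \<iota> l \<odot> c \<odot> \<iota> X" for l
  have [simp]: "arr (M l)" "src (M l) = l @ W @ y @ X" "trg (M l) = l @ X"
    "arr (C l)" "src (C l) = l @ X" "trg (C l) = l @ W @ y @ X" for l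
    by (simp_all add: M_def C_def)
  \<comment> \<open>The diagram cut open on \<open>l @ W\<close>. Expanding its trace over the
    summands \<open>k\<close> of \<open>l @ W\<close> gives the terms \<open>t l j\<close> common to
    both sides.\<close>
  define Q where "Q l = (\<iota> (l @ W) \<odot> g) \<bullet> C l \<bullet> \<psi> l \<bullet> M l" for l
  have [simp]: "arr (Q l)" "src (Q l) = l @ W @ y @ X" "trg (Q l) = l @ W @ y @ X" for l
    by (simp_all add: Q_def)
  define t where "t l j = T ((a l j \<odot> \<iota> (y @ X)) \<bullet> Q l \<bullet> (b l j \<odot> \<iota> (y @ X)))" for l j
  define J where "J k l = {j \<in> A l. r l j = k}" for k l
  \<comment> \<open>Rotation turns the \<open>k\<close>-summands of \<open>l @ W\<close> into the
    \<open>l\<close>-summands of \<open>k @ y\<close>. Its factor \<open>d l / d k\<close> exchanges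
    the weights of the Kirby colour.\<close>
  have k_term: "d k * T ((\<iota> k \<odot> g) \<bullet> \<psi> (k @ y)) = (\<Sum>l\<in>R. \<Sum>j\<in>J k l. d l * t l j)" if k: "k \<in> R" for k
  proof -
    let ?E = "\<lambda>l j. (a l j \<odot> \<iota> y) \<bullet> (\<iota> l \<odot> c)"
    let ?P = "\<lambda>l j. sm (d l / d k) ((\<iota> l \<odot> tev W y e) \<bullet> (b l j \<odot> \<iota> y))"
    have dck: "decomp (k @ y) (Sigma R (J k)) fst (\<lambda>(l, j). ?E l j) (\<lambda>(l, j). ?P l j)"
      unfolding J_def by (rule decomp_of_dual_bases, rule rotate_dual_bases[OF dp dc _ k])
    have "T ((\<iota> k \<odot> g) \<bullet> \<psi> (k @ y)) = (\<Sum>p\<in>Sigma R (J k). T (((case p of (l, j) \<Rightarrow> ?P l j) \<odot> \<iota> X) \<bullet>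
        ((\<iota> k \<odot> g) \<bullet> \<psi> (k @ y)) \<bullet> ((case p of (l, j) \<Rightarrow> ?E l j) \<odot> \<iota> X)))"
      by (rule T_decomp[OF dck]) auto
    also have "\<dots> = (\<Sum>(l, j)\<in>Sigma R (J k). d l / d k * t l j)"
    proof (rule sum.cong[OF refl])
      fix p assume "p \<in> Sigma R (J k)"
      then obtain l j where p: "p = (l, j)" and [simp]: "l \<in> R" "j \<in> A l" "r l j = k" by (auto simp: J_def)
      have "((\<iota> k \<odot> g) \<bullet> \<psi> (k @ y)) \<bullet> (?E l j \<odot> \<iota> X) = (\<iota> k \<odot> g) \<bullet> (?E l j \<odot> \<iota> X) \<bullet> \<psi> l"
        using nat[of "?E l j"] by simp
      also have "\<dots> = (\<iota> k \<odot> g) \<bullet> (a l j \<odot> \<iota> (y @ X)) \<bullet> C l \<bullet> \<psi> l"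
        by (simp add: C_def)
      also have "\<dots> = (a l j \<odot> \<iota> (y @ X)) \<bullet> (\<iota> (l @ W) \<odot> g) \<bullet> C l \<bullet> \<psi> l"
        using reassoc[OF slide[of "a l j" g "l @ W" "y @ X" k "y @ X"], of "C l \<bullet> \<psi> l"] by simp
      finally have 1: "((\<iota> k \<odot> g) \<bullet> \<psi> (k @ y)) \<bullet> (?E l j \<odot> \<iota> X)
         = (a l j \<odot> \<iota> (y @ X)) \<bullet> (\<iota> (l @ W) \<odot> g) \<bullet> C l \<bullet> \<psi> l" .
      have 2: "?P l j \<odot> \<iota> X = sm (d l / d k) (M l \<bullet> (b l j \<odot> \<iota> (y @ X)))"
        by (simp add: M_def)
      have "T ((?P l j \<odot> \<iota> X) \<bullet> ((\<iota> k \<odot> g) \<bullet> \<psi> (k @ y)) \<bullet> (?E l j \<odot> \<iota> X))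
         = d l / d k * T ((M l \<bullet> (b l j \<odot> \<iota> (y @ X))) \<bullet> (a l j \<odot> \<iota> (y @ X)) \<bullet> (\<iota> (l @ W) \<odot> g) \<bullet> C l \<bullet> \<psi> l)"
        unfolding 1 2 by simp
      also have "T ((M l \<bullet> (b l j \<odot> \<iota> (y @ X))) \<bullet> (a l j \<odot> \<iota> (y @ X)) \<bullet> (\<iota> (l @ W) \<odot> g) \<bullet> C l \<bullet> \<psi> l) = t l j"
        unfolding t_def Q_def
        by (subst T_cyclic[of _ "l @ X" "k @ y @ X"]) simp_all
      finally show "T (((case p of (l, j) \<Rightarrow> ?P l j) \<odot> \<iota> X) \<bullet>
        ((\<iota> k \<odot> g) \<bullet> \<psi> (k @ y)) \<bullet> ((case p of (l, j) \<Rightarrow> ?E l j) \<odot> \<iota> X)) = (case p of (l, j) \<Rightarrow> d l / d k * t l j)"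
        by (simp add: p)
    qed
    also have "\<dots> = (\<Sum>l\<in>R. \<Sum>j\<in>J k l. d l / d k * t l j)"
      using finite_R by (subst sum.Sigma) (auto simp: J_def)
    finally show ?thesis
      using d_nonzero[OF k] by (simp add: sum_distrib_left)
  qed
  have "(\<Sum>k\<in>R. d k * T ((\<iota> k \<odot> g) \<bullet> \<psi> (k @ y))) = (\<Sum>k\<in>R. \<Sum>l\<in>R. \<Sum>j\<in>J k l. d l * t l j)"
    by (simp add: k_term)
  also have "\<dots> = (\<Sum>l\<in>R. \<Sum>k\<in>R. \<Sum>j\<in>J k l. d l * t l j)" by (rule sum.swap)
  \<comment> \<open>For fixed \<open>l\<close> the sets \<open>J k l\<close> partition the index set
    of the decomposition of \<open>l @ W\<close>.\<close>
  also have "\<dots> = (\<Sum>l\<in>R. \<Sum>j\<in>A l. d l * t l j)"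
    unfolding J_def using finite_R by (intro sum.cong[OF refl] sum.group) auto
  also have "\<dots> = (\<Sum>l\<in>R. d l * T (Q l))"
  proof (rule sum.cong[OF refl])
    fix l
    have "T (Q l) = (\<Sum>j\<in>A l. t l j)"
      unfolding t_def by (rule T_decomp[OF dc]) auto
    then show "(\<Sum>j\<in>A l. d l * t l j) = d l * T (Q l)" by (simp add: sum_distrib_left)
  qed
  also have "\<dots> = (\<Sum>l\<in>R. d l * T ((\<iota> l \<odot> ((tev W y e \<odot> \<iota> X) \<bullet> (\<iota> W \<odot> g) \<bullet> (c \<odot> \<iota> X))) \<bullet> \<psi> l))"
  proof (rule sum.cong[OF refl])
    fix l
    have "T (Q l) = T (M l \<bullet> (\<iota> (l @ W) \<odot> g) \<bullet> C l \<bullet> \<psi> l)"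
      unfolding Q_def using T_cyclic[of "M l" "l @ W @ y @ X" "l @ X" "(\<iota> (l @ W) \<odot> g) \<bullet> C l \<bullet> \<psi> l"] by simp
    then show "d l * T (Q l) = d l * T ((\<iota> l \<odot> ((tev W y e \<odot> \<iota> X) \<bullet> (\<iota> W \<odot> g) \<bullet> (c \<odot> \<iota> X))) \<bullet> \<psi> l)"
      by (simp add: M_def C_def)
  qed
  finally show ?thesis .
qed

lemma S_transp:
  assumes "is_transparent X"
  shows "S Y X = d Y * d X"
proof -
  have "S Y X = S X Y" by (rule S_commute)
  also have "\<dots> = T (\<iota> (X @ Y))" using assms by (simp add: S_def is_transparent_def)
  finally show ?thesis using d_tens[of X Y] by (simp add: d_def mult.commute)
qed

text \<open>By \<open>T_nondegenerate\<close> it suffices to compare the traces of \<open>g\<close>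
  and \<open>g \<bullet> f\<close>. After multiplication by \<open>D\<close>,
  \<open>kirby_slide\<close> closes off the strand \<open>y\<close> in both; what remains of
  \<open>g\<close> is the scalar \<open>\<gamma>\<close> on \<open>X\<close>, and the hypothesis on
  \<open>S\<close> makes the two results equal.\<close>

lemma is_transparent_if_S:
  assumes X: "X \<in> R" and S: "\<And>k. k \<in> R \<Longrightarrow> S k X = d k * d X"
  shows "is_transparent X"
  unfolding is_transparent_def
proof
  fix y
  \<comment> \<open>\<open>kirby_slide\<close> closes \<open>y\<close> on its left, which requires a
    \<open>W\<close> with dual \<open>y\<close>; flipping a dual pair of \<open>y\<close> provides
    it.\<close>
  obtain W e c where dp: "dual_pair W y e c"
    using ex_dual[of y] dual_pair_flip by blast
  note [simp] = dual_pairD(1-6)[OF dp]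
  define f where "f = br X y \<bullet> br y X"
  have [simp]: "arr f" "src f = y @ X" "trg f = y @ X" by (simp_all add: f_def)
  have "f = \<iota> (y @ X)"
  proof (rule T_nondegenerate[of f "y @ X"])
    fix g assume g [simp]: "arr g" "src g = y @ X" "trg g = y @ X"
    define G where "G = (tev W y e \<odot> \<iota> X) \<bullet> (\<iota> W \<odot> g) \<bullet> (c \<odot> \<iota> X)"
    have [simp]: "arr G" "src G = X" "trg G = X" by (simp_all add: G_def)
    obtain \<gamma> where \<gamma>: "G = sm \<gamma> (\<iota> X)" using sc_eq[OF brick_R[OF X], of G] by auto
    \<comment> \<open>Sliding without any braiding: the circle \<open>k\<close> is unlinked from
      \<open>g\<close> and contributes \<open>D\<close> in total.\<close>
    have 1: "D * T g = \<gamma> * d X * D"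
    proof -
      have "(\<Sum>k\<in>R. d k * T ((\<iota> k \<odot> g) \<bullet> \<iota> ((k @ y) @ X))) = (\<Sum>l\<in>R. d l * T ((\<iota> l \<odot> G) \<bullet> \<iota> (l @ X)))"
        unfolding G_def by (rule kirby_slide[OF dp, of "\<lambda>Y. \<iota> (Y @ X)"]) simp_all
      moreover have "T (\<iota> k \<odot> g) = d k * T g" for k
        using T_tens[of "\<iota> k" k g "y @ X"] by (simp add: d_def)
      moreover have "T (\<iota> l \<odot> G) = \<gamma> * (d l * d X)" for l
        using d_tens[of l X] by (simp add: \<gamma> d_def)
      ultimately show ?thesis
        by (simp add: D_def sum_distrib_left sum_distrib_right power2_eq_square mult_ac)
    qed
    \<comment> \<open>The same sliding, now with a circle that braids around
      \<open>X\<close>.\<close>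
    have 2: "D * T (g \<bullet> f) = \<gamma> * d X * D"
    proof -
      have "(\<Sum>k\<in>R. d k * T ((\<iota> k \<odot> g) \<bullet> (br X (k @ y) \<bullet> br (k @ y) X)))
          = (\<Sum>l\<in>R. d l * T ((\<iota> l \<odot> G) \<bullet> (br X l \<bullet> br l X)))"
        unfolding G_def
      proof (rule kirby_slide[OF dp, of "\<lambda>Y. br X Y \<bullet> br Y X"])
        fix h assume "arr h"
        then show "(br X (trg h) \<bullet> br (trg h) X) \<bullet> (h \<odot> \<iota> X) = (h \<odot> \<iota> X) \<bullet> br X (src h) \<bullet> br (src h) X"
          using br_br_natural[of h "\<iota> X"] by simp
      qed simp_all
      moreover have "T ((\<iota> l \<odot> G) \<bullet> (br X l \<bullet> br l X)) = \<gamma> * (d l * d X)" if "l \<in> R" for l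
      proof -
        have "T ((\<iota> l \<odot> G) \<bullet> (br X l \<bullet> br l X)) = \<gamma> * S l X" by (simp add: \<gamma> S_def)
        then show ?thesis using S[OF that] by simp
      qed
      \<comment> \<open>The diagram is a connected sum along \<open>X\<close> of the Hopf link of
        \<open>k\<close> and \<open>X\<close> with the closure of \<open>g \<bullet> f\<close>; the
        Hopf link has the value \<open>d k * d X\<close> by hypothesis.\<close>
      moreover have "T ((\<iota> k \<odot> g) \<bullet> (br X (k @ y) \<bullet> br (k @ y) X)) = d k * T (g \<bullet> f)" if k: "k \<in> R" for k
      proof -
        define F where "F = br y X \<bullet> g \<bullet> br X y"
        define E where "E = br X k \<bullet> br k X"
        have [simp]: "arr F" "src F = X @ y" "trg F = X @ y" "arr E" "src E = k @ X" "trg E = k @ X"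
          by (simp_all add: F_def E_def)
        have "(\<iota> k \<odot> g) \<bullet> (br X (k @ y) \<bullet> br (k @ y) X)
            = (\<iota> k \<odot> g) \<bullet> (\<iota> k \<odot> br X y) \<bullet> (E \<odot> \<iota> y) \<bullet> (\<iota> k \<odot> br y X)"
          unfolding br_br_tens_left E_def by simp
        then have "T ((\<iota> k \<odot> g) \<bullet> (br X (k @ y) \<bullet> br (k @ y) X)) = T ((\<iota> k \<odot> F) \<bullet> (E \<odot> \<iota> y))"
          using T_cyclic[of "\<iota> k \<odot> br y X" "k @ y @ X" "k @ X @ y" "(\<iota> k \<odot> g) \<bullet> (\<iota> k \<odot> br X y) \<bullet> (E \<odot> \<iota> y)"]
          by (simp add: F_def)
        moreover have "T ((\<iota> k \<odot> F) \<bullet> (E \<odot> \<iota> y)) = T ((E \<odot> \<iota> y) \<bullet> (\<iota> k \<odot> F))"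
          by (rule T_cyclic[of _ "k @ X @ y" "k @ X @ y"]) simp_all
        ultimately have "T ((\<iota> k \<odot> g) \<bullet> (br X (k @ y) \<bullet> br (k @ y) X)) * d X = S k X * T F"
          using T_link[OF X, of E k F y] by (simp add: S_def E_def)
        moreover have "T F = T (g \<bullet> f)"
          unfolding F_def f_def using T_cyclic[of "g \<bullet> br X y" "X @ y" "y @ X" "br y X"] by simp
        ultimately show ?thesis using S[OF k] d_nonzero[OF X] by simp
      qed
      ultimately show ?thesis
        by (simp add: D_def sum_distrib_left sum_distrib_right power2_eq_square mult_ac)
    qed
    show "T (g \<bullet> f) = T g" using 1 2 D_nonzero by simp
  qed simp_all
  then have "br y X \<bullet> (br X y \<bullet> br y X) \<bullet> ibr y X = \<iota> (X @ y)" by (simp add: f_def)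
  then show "br y X \<bullet> br X y = \<iota> (X @ y)" by simp
qed

section \<open>Gauss sums\<close>

lemma ex_summand:
  assumes "l \<in> R" "n i j l \<noteq> 0"
  obtains e p where "arr e" "src e = l" "trg e = i @ j" "arr p" "src p = i @ j" "trg p = l" "p \<bullet> e = \<iota> l"
proof -
  obtain A :: "nat set" and r b a where dc: "decomp (i @ j) A r b a" using ex_decomp by blast
  note F = decomp_dual_bases[OF dc assms(1)]
  have "{m\<in>A. r m = l} \<noteq> {}" using N_dual_bases[OF F assms(1)] assms(2) unfolding n_def by (metis card.empty)
  then obtain m where "m \<in> {m\<in>A. r m = l}" by blast
  then show ?thesis using dual_basesD(2-8)[OF F, of m] dual_basesD(8)[OF F, of m m] that by auto
qed

lemma is_transparent_summand:
  assumes "l \<in> R" "n i j l \<noteq> 0" "is_transparent i" "is_transparent j"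
  shows "is_transparent l"
  using ex_summand[OF assms(1,2)] is_transparent_retract[OF is_transparent_tens[OF assms(3,4)]] by metis

text \<open>For transparent \<open>i\<close> the double braiding drops out of
  \<open>tw_tens\<close>, so the twist of \<open>i @ j\<close> is a scalar, which every summand
  inherits by naturality.\<close>

lemma theta_transp:
  assumes R: "l \<in> R" "i \<in> R" "j \<in> R" and n: "n i j l \<noteq> 0" and i: "is_transparent i"
  shows "\<theta> l = \<theta> i * \<theta> j"
proof -
  obtain e p where [simp]: "arr e" "src e = l" "trg e = i @ j" "arr p" "src p = i @ j" "trg p = l" and pe: "p \<bullet> e = \<iota> l"
    using ex_summand[OF R(1) n] .
  have twij: "tw (i @ j) = sm (\<theta> i * \<theta> j) (\<iota> (i @ j))"
    using i by (simp add: tw_tens tw_eq R is_transparent_def mult.commute)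
  have "sm (\<theta> l) (\<iota> l) = p \<bullet> e \<bullet> tw l" by (simp add: tw_eq R pe)
  also have "\<dots> = p \<bullet> tw (i @ j) \<bullet> e" using tw_natural[of e] by simp
  also have "\<dots> = sm (\<theta> i * \<theta> j) (\<iota> l)" by (simp add: twij pe)
  finally show ?thesis using sm_idt_inject[OF brick_R[OF R(1)]] by simp
qed

text \<open>The weight \<open>w\<close> is abstract so that \<open>\<theta>\<close> and its inverse
  are treated by one computation.\<close>

lemma gauss_sum_zero:
  assumes i: "i \<in> R" "w i \<noteq> 0" "w i \<noteq> 1"
    and w: "\<And>j l. \<lbrakk>j \<in> R; l \<in> R; n i j l \<noteq> 0\<rbrakk> \<Longrightarrow> w l = w i * w j"
  shows "(\<Sum>j\<in>R. w j * (d j)\<^sup>2) = 0"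
proof -
  let ?G = "\<Sum>j\<in>R. w j * (d j)\<^sup>2"
  have nw: "of_nat (n i j l) * (w i * w j) = of_nat (n i j l) * w l" if "j \<in> R" "l \<in> R" for j l
    using w[OF that] by (cases "n i j l = 0") auto
  have "w i * (d i * ?G) = (\<Sum>j\<in>R. w i * w j * d j * (d i * d j))"
    by (simp add: sum_distrib_left power2_eq_square mult_ac)
  also have "\<dots> = (\<Sum>j\<in>R. \<Sum>l\<in>R. d j * d l * (of_nat (n i j l) * (w i * w j)))"
    unfolding d_mult[of i] by (simp add: sum_distrib_left mult_ac)
  also have "\<dots> = (\<Sum>j\<in>R. \<Sum>l\<in>R. w l * d l * (of_nat (n i j l) * d j))"
    by (intro sum.cong refl) (simp only: nw, simp add: mult_ac)
  also have "\<dots> = (\<Sum>l\<in>R. w l * d l * (\<Sum>j\<in>R. of_nat (n i j l) * d j))"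
    unfolding sum_distrib_left by (rule sum.swap)
  also have "\<dots> = d i * ?G"
    by (simp add: n_sum_left i sum_distrib_left power2_eq_square mult_ac)
  finally have "(w i - 1) * d i * ?G = 0" by (simp add: algebra_simps)
  then show ?thesis using i d_nonzero by simp
qed

definition gp :: 'k where "gp = (\<Sum>j\<in>R. \<theta> j * (d j)\<^sup>2)"
definition gm :: 'k where "gm = (\<Sum>j\<in>R. inverse (\<theta> j) * (d j)\<^sup>2)"

text \<open>Balancing, summed against \<open>d i\<close>: a circle \<open>j\<close> linked with a
  twisted Kirby circle comes free at the cost of the inverse of \<open>\<theta> j\<close> and a
  factor \<open>gp\<close>.\<close>

lemma gp_S:
  assumes j: "j \<in> R"
  shows "\<theta> j * (\<Sum>i\<in>R. \<theta> i * d i * S j i) = d j * gp"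
proof -
  have "\<theta> j * (\<Sum>i\<in>R. \<theta> i * d i * S j i) = (\<Sum>i\<in>R. d i * (\<theta> j * \<theta> i * S j i))"
    by (simp add: sum_distrib_left mult_ac)
  also have "\<dots> = (\<Sum>i\<in>R. \<Sum>l\<in>R. \<theta> l * d l * (of_nat (n j i l) * d i))"
    by (intro sum.cong refl) (simp only: balancing[OF j], simp add: sum_distrib_left mult_ac)
  also have "\<dots> = (\<Sum>l\<in>R. \<theta> l * d l * (\<Sum>i\<in>R. of_nat (n j i l) * d i))"
    unfolding sum_distrib_left by (rule sum.swap)
  also have "\<dots> = d j * gp"
    by (simp add: n_sum_left j gp_def sum_distrib_left power2_eq_square mult_ac)
  finally show ?thesis .
qed

lemma gauss_product: "gp * gm = D * (\<Sum>i\<in>{i\<in>R. is_transparent i}. \<theta> i * (d i)\<^sup>2)"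
proof -
  have Z: "(\<Sum>j\<in>R. d j * S j i) = (if is_transparent i then D * d i else 0)" if i: "i \<in> R" for i
  proof (cases "is_transparent i")
    case True
    then show ?thesis
      by (simp add: S_transp D_def sum_distrib_left power2_eq_square mult_ac)
  next
    case False
    then show ?thesis using S_orthogonal[OF i] is_transparent_if_S[OF i] by auto
  qed
  have "gp * gm = (\<Sum>j\<in>R. inverse (\<theta> j) * d j * (d j * gp))"
    by (simp add: gm_def sum_distrib_left power2_eq_square mult_ac)
  \<comment> \<open>\<open>gp_S\<close> absorbs the inverse twists of \<open>gm\<close>
    exactly.\<close>
  also have "\<dots> = (\<Sum>j\<in>R. d j * (\<Sum>i\<in>R. \<theta> i * d i * S j i))"
    by (intro sum.cong refl) (simp add: gp_S[symmetric] theta_nonzero)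
  also have "\<dots> = (\<Sum>i\<in>R. \<theta> i * d i * (\<Sum>j\<in>R. d j * S j i))"
    unfolding sum_distrib_left by (subst sum.swap) (simp add: mult_ac)
  also have "\<dots> = (\<Sum>i\<in>R. if is_transparent i then D * (\<theta> i * (d i)\<^sup>2) else 0)"
    by (intro sum.cong refl) (simp add: Z power2_eq_square mult_ac)
  also have "\<dots> = D * (\<Sum>i\<in>{i\<in>R. is_transparent i}. \<theta> i * (d i)\<^sup>2)"
    using finite_R by (auto simp: sum.inter_filter sum_distrib_left intro!: sum.cong)
  finally show ?thesis .
qed

lemma is_transparent_u: "is_transparent u"
  using unit_iso is_transparent_retract[OF is_transparent_unit, of _ _ u] by metis

lemma is_transparent_bar: "i \<in> R \<Longrightarrow> is_transparent i \<Longrightarrow> is_transparent (bar i)"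
  using bar(2)[of i] dual_pair_flip is_transparent_dual by blast

lemma sum_transp_nonzero: "(\<Sum>i\<in>{i\<in>R. is_transparent i}. (d i)\<^sup>2) \<noteq> 0"
proof (rule sum_d_squared_nonzero)
  show "u \<in> {i\<in>R. is_transparent i}" using unit_R is_transparent_u by simp
  show "n i j l = 0" if "i \<in> {i\<in>R. is_transparent i}" "j \<in> {i\<in>R. is_transparent i}" "l \<in> R - {i\<in>R. is_transparent i}" for i j l
    using that is_transparent_summand[of l i j] by blast
  \<comment> \<open>Reciprocity makes \<open>m\<close> a summand of \<open>l @ bar i\<close>, a
    product of transparent objects.\<close>
  show "n i m l = 0" if "i \<in> {i\<in>R. is_transparent i}" "l \<in> {i\<in>R. is_transparent i}" "m \<in> R - {i\<in>R. is_transparent i}" for i l m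
    using that is_transparent_summand[of m l "bar i"] is_transparent_bar[of i] n_commute[of l i m] n_dual[of m i l] by auto
qed auto

theorem gauss_sums:
  "(\<exists>i\<in>R. is_transparent i \<and> \<theta> i \<noteq> 1) \<longleftrightarrow> gp = 0" "(\<exists>i\<in>R. is_transparent i \<and> \<theta> i \<noteq> 1) \<longleftrightarrow> gm = 0"
proof -
  have "gp = 0 \<and> gm = 0" if i: "i \<in> R" "is_transparent i" "\<theta> i \<noteq> 1" for i
    unfolding gp_def gm_def
    using gauss_sum_zero[OF i(1), of \<theta>] gauss_sum_zero[OF i(1), of "\<lambda>x. inverse (\<theta> x)"] i
      theta_nonzero[OF i(1)] theta_transp by (auto simp: inverse_eq_1_iff)
  \<comment> \<open>A nonzero product excludes the vanishing of either sum, which makes the two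
    vanishing conditions equivalent.\<close>
  moreover have "gp * gm \<noteq> 0" if "\<forall>i\<in>R. is_transparent i \<longrightarrow> \<theta> i = 1"
  proof -
    have "(\<Sum>i\<in>{i\<in>R. is_transparent i}. \<theta> i * (d i)\<^sup>2) = (\<Sum>i\<in>{i\<in>R. is_transparent i}. (d i)\<^sup>2)"
      using that by (intro sum.cong) auto
    then show ?thesis using gauss_product sum_transp_nonzero D_nonzero by simp
  qed
  ultimately show "(\<exists>i\<in>R. is_transparent i \<and> \<theta> i \<noteq> 1) \<longleftrightarrow> gp = 0" "(\<exists>i\<in>R. is_transparent i \<and> \<theta> i \<noteq> 1) \<longleftrightarrow> gm = 0"
    by (metis mult_eq_0_iff)+
qed

end

section \<open>Strictification\<close>

text \<open>The original category, not assumed strict. Inverses of the structure isomorphisms are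
  parameters, so that they cancel by rewriting.\<close>

locale typed_monoidal =
  fixes arr :: "'b \<Rightarrow> bool" and src trg :: "'b \<Rightarrow> 'o"
    and comp :: "'b \<Rightarrow> 'b \<Rightarrow> 'b" (infixr "\<bullet>" 65)
    and tens :: "'b \<Rightarrow> 'b \<Rightarrow> 'b" (infixr "\<odot>" 70)
    and idt :: "'o \<Rightarrow> 'b" ("\<iota>")
    and tob :: "'o \<Rightarrow> 'o \<Rightarrow> 'o" (infixr "\<star>" 75) and J :: 'o
    and as ias :: "'o \<Rightarrow> 'o \<Rightarrow> 'o \<Rightarrow> 'b" and lu ilu ru iru :: "'o \<Rightarrow> 'b"
  assumes arr_idt [simp]: "arr (\<iota> x)" "src (\<iota> x) = x" "trg (\<iota> x) = x"
    and arr_comp [simp]: "\<lbrakk>arr g; arr f; src g = trg f\<rbrakk> \<Longrightarrow> arr (g \<bullet> f)"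
    and src_comp [simp]: "src (g \<bullet> f) = src f"
    and trg_comp [simp]: "trg (g \<bullet> f) = trg g"
    and arr_tens [simp]: "\<lbrakk>arr g; arr f\<rbrakk> \<Longrightarrow> arr (g \<odot> f)"
    and src_tens [simp]: "src (g \<odot> f) = src g \<star> src f"
    and trg_tens [simp]: "trg (g \<odot> f) = trg g \<star> trg f"
    and comp_assoc [simp]:
      "\<lbrakk>arr h; arr g; arr f; src h = trg g; src g = trg f\<rbrakk> \<Longrightarrow> (h \<bullet> g) \<bullet> f = h \<bullet> g \<bullet> f"
    and comp_idt_right [simp]: "\<lbrakk>arr f; src f = x\<rbrakk> \<Longrightarrow> f \<bullet> \<iota> x = f"
    and comp_idt_left [simp]: "\<lbrakk>arr f; trg f = x\<rbrakk> \<Longrightarrow> \<iota> x \<bullet> f = f"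
    and tens_idt [simp]: "\<iota> x \<odot> \<iota> y = \<iota> (x \<star> y)"
    and interchange:
      "\<lbrakk>arr g; arr f; arr g'; arr f'; src g = trg f; src g' = trg f'\<rbrakk> \<Longrightarrow>
        (g \<odot> g') \<bullet> (f \<odot> f') = (g \<bullet> f) \<odot> (g' \<bullet> f')"
    and arr_as [simp]: "arr (as x y z)" "src (as x y z) = (x \<star> y) \<star> z" "trg (as x y z) = x \<star> y \<star> z"
    and arr_ias [simp]: "arr (ias x y z)" "src (ias x y z) = x \<star> y \<star> z" "trg (ias x y z) = (x \<star> y) \<star> z"
    and as_ias [simp]: "as x y z \<bullet> ias x y z = \<iota> (x \<star> y \<star> z)"
    and ias_as [simp]: "ias x y z \<bullet> as x y z = \<iota> ((x \<star> y) \<star> z)"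
    and arr_lu [simp]: "arr (lu x)" "src (lu x) = J \<star> x" "trg (lu x) = x"
    and arr_ilu [simp]: "arr (ilu x)" "src (ilu x) = x" "trg (ilu x) = J \<star> x"
    and lu_ilu [simp]: "lu x \<bullet> ilu x = \<iota> x"
    and ilu_lu [simp]: "ilu x \<bullet> lu x = \<iota> (J \<star> x)"
    and arr_ru [simp]: "arr (ru x)" "src (ru x) = x \<star> J" "trg (ru x) = x"
    and arr_iru [simp]: "arr (iru x)" "src (iru x) = x" "trg (iru x) = x \<star> J"
    and ru_iru [simp]: "ru x \<bullet> iru x = \<iota> x"
    and iru_ru [simp]: "iru x \<bullet> ru x = \<iota> (x \<star> J)"
    and as_natural: "\<lbrakk>arr f; arr g; arr h\<rbrakk> \<Longrightarrow>
      as (trg f) (trg g) (trg h) \<bullet> ((f \<odot> g) \<odot> h) = (f \<odot> g \<odot> h) \<bullet> as (src f) (src g) (src h)"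
    and lu_natural: "arr f \<Longrightarrow> lu (trg f) \<bullet> (\<iota> J \<odot> f) = f \<bullet> lu (src f)"
    and ru_natural: "arr f \<Longrightarrow> ru (trg f) \<bullet> (f \<odot> \<iota> J) = f \<bullet> ru (src f)"
    and pentagon: "as w x (y \<star> z) \<bullet> as (w \<star> x) y z
      = (\<iota> w \<odot> as x y z) \<bullet> as w (x \<star> y) z \<bullet> (as w x y \<odot> \<iota> z)"
    and triangle: "(\<iota> x \<odot> lu y) \<bullet> as x J y = ru x \<odot> \<iota> y"
begin

lemma whisker_left [simp]:
  "\<lbrakk>arr g; arr f; src g = trg f\<rbrakk> \<Longrightarrow> \<iota> x \<odot> (g \<bullet> f) = (\<iota> x \<odot> g) \<bullet> (\<iota> x \<odot> f)"
  by (simp add: interchange)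

lemma whisker_right [simp]:
  "\<lbrakk>arr g; arr f; src g = trg f\<rbrakk> \<Longrightarrow> (g \<bullet> f) \<odot> \<iota> x = (g \<odot> \<iota> x) \<bullet> (f \<odot> \<iota> x)"
  by (simp add: interchange)

lemma slide:
  "\<lbrakk>arr f; arr g; src f = a; trg g = b; trg f = a'; src g = b'\<rbrakk> \<Longrightarrow>
     (f \<odot> \<iota> b) \<bullet> (\<iota> a \<odot> g) = (\<iota> a' \<odot> g) \<bullet> (f \<odot> \<iota> b')"
  by (simp add: interchange)

lemma tens_right_left:
  "\<lbrakk>arr f; arr g; src f = a; trg g = b\<rbrakk> \<Longrightarrow> (f \<odot> \<iota> b) \<bullet> (\<iota> a \<odot> g) = f \<odot> g"
  by (simp add: interchange)

lemma reassoc: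
  "\<lbrakk>g \<bullet> f = g' \<bullet> f'; arr g; arr f; arr g'; arr f'; arr h; src g = trg f; src g' = trg f'; src f = trg h; src f' = trg h\<rbrakk>
    \<Longrightarrow> g \<bullet> f \<bullet> h = g' \<bullet> f' \<bullet> h"
  by (metis comp_assoc)

lemma reassoc1:
  "\<lbrakk>g \<bullet> f = k; arr g; arr f; arr h; src g = trg f; src f = trg h\<rbrakk> \<Longrightarrow> g \<bullet> f \<bullet> h = k \<bullet> h"
  by (metis comp_assoc)

lemma cancel_comp [simp]:
  "\<lbrakk>arr f; trg f = x \<star> y \<star> z\<rbrakk> \<Longrightarrow> as x y z \<bullet> ias x y z \<bullet> f = f"
  "\<lbrakk>arr f; trg f = (x \<star> y) \<star> z\<rbrakk> \<Longrightarrow> ias x y z \<bullet> as x y z \<bullet> f = f"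
  "\<lbrakk>arr f; trg f = x\<rbrakk> \<Longrightarrow> lu x \<bullet> ilu x \<bullet> f = f"
  "\<lbrakk>arr f; trg f = J \<star> x\<rbrakk> \<Longrightarrow> ilu x \<bullet> lu x \<bullet> f = f"
  "\<lbrakk>arr f; trg f = x\<rbrakk> \<Longrightarrow> ru x \<bullet> iru x \<bullet> f = f"
  "\<lbrakk>arr f; trg f = x \<star> J\<rbrakk> \<Longrightarrow> iru x \<bullet> ru x \<bullet> f = f"
  using reassoc1[OF as_ias[of x y z], of f] reassoc1[OF ias_as[of x y z], of f] reassoc1[OF lu_ilu[of x], of f]
    reassoc1[OF ilu_lu[of x], of f] reassoc1[OF ru_iru[of x], of f] reassoc1[OF iru_ru[of x], of f]
  by simp_all

section \<open>Coherence of the unitors\<close>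

lemma comp_eq_cancel_right:
  assumes "f \<bullet> i = g \<bullet> i" "i \<bullet> i' = \<iota> y" and [simp]: "arr f" "arr g" "arr i" "arr i'" "src f = y" "src g = y" "trg i = y" "trg i' = src i"
  shows "f = g"
proof -
  have "f = (f \<bullet> i) \<bullet> i'" using assms(2) by simp
  also have "\<dots> = (g \<bullet> i) \<bullet> i'" by (simp only: assms(1))
  also have "\<dots> = g" using assms(2) by simp
  finally show ?thesis .
qed

lemma comp_eq_cancel_left:
  assumes "i \<bullet> f = i \<bullet> g" "i' \<bullet> i = \<iota> y" and [simp]: "arr f" "arr g" "arr i" "arr i'" "trg f = y" "trg g = y" "src i = y" "src i' = trg i"
  shows "f = g"
proof -
  have "f = i' \<bullet> (i \<bullet> f)" using reassoc1[OF assms(2), of f] by simp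
  also have "\<dots> = i' \<bullet> (i \<bullet> g)" by (simp only: assms(1))
  also have "\<dots> = g" using reassoc1[OF assms(2), of g] by simp
  finally show ?thesis .
qed

text \<open>Tensoring with the unit object is faithful because the unitor is a natural isomorphism.
  Hence unit coherences may be proved after tensoring with \<open>J\<close>.\<close>

lemma unit_tens_left_cancel:
  assumes "\<iota> J \<odot> f = \<iota> J \<odot> g" "arr f" "arr g" "src f = src g" "trg f = trg g"
  shows "f = g"
  using lu_natural[of f] lu_natural[of g] assms
  by - (rule comp_eq_cancel_right[of _ "lu (src f)" _ "ilu (src f)"], simp_all)

lemma unit_tens_right_cancel:
  assumes "f \<odot> \<iota> J = g \<odot> \<iota> J" "arr f" "arr g" "src f = src g" "trg f = trg g"
  shows "f = g"
  using ru_natural[of f] ru_natural[of g] assms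
  by - (rule comp_eq_cancel_right[of _ "ru (src f)" _ "iru (src f)"], simp_all)

text \<open>Kelly's argument: the pentagon for \<open>J\<close>, \<open>J\<close>, \<open>x\<close>,
  \<open>y\<close>, combined with two uses of the triangle, gives the identity tensored with
  \<open>J\<close> and composed with invertible associators. \<open>ru_tens\<close> uses the
  pentagon for \<open>x\<close>, \<open>y\<close>, \<open>J\<close>, \<open>J\<close>.\<close>

lemma lu_tens: "lu (x \<star> y) \<bullet> as J x y = lu x \<odot> \<iota> y"
proof (rule unit_tens_left_cancel)
  have Z: "(\<iota> J \<odot> (lu (x \<star> y) \<bullet> as J x y)) \<bullet> as J (J \<star> x) y \<bullet> (as J J x \<odot> \<iota> y)
      = (\<iota> J \<odot> lu x \<odot> \<iota> y) \<bullet> as J (J \<star> x) y \<bullet> (as J J x \<odot> \<iota> y)"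
  proof -
    have "(\<iota> J \<odot> (lu (x \<star> y) \<bullet> as J x y)) \<bullet> as J (J \<star> x) y \<bullet> (as J J x \<odot> \<iota> y)
        = (\<iota> J \<odot> lu (x \<star> y)) \<bullet> as J J (x \<star> y) \<bullet> as (J \<star> J) x y"
      by (simp add: pentagon)
    also have "\<dots> = (ru J \<odot> \<iota> (x \<star> y)) \<bullet> as (J \<star> J) x y"
      using reassoc1[OF triangle[of J "x \<star> y"], of "as (J \<star> J) x y"] by simp
    also have "\<dots> = as J x y \<bullet> ((ru J \<odot> \<iota> x) \<odot> \<iota> y)"
      using as_natural[of "ru J" "\<iota> x" "\<iota> y"] by simp
    also have "\<dots> = as J x y \<bullet> ((\<iota> J \<odot> lu x) \<odot> \<iota> y) \<bullet> (as J J x \<odot> \<iota> y)"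
      by (simp flip: triangle)
    also have "\<dots> = (\<iota> J \<odot> lu x \<odot> \<iota> y) \<bullet> as J (J \<star> x) y \<bullet> (as J J x \<odot> \<iota> y)"
      using reassoc[OF as_natural[of "\<iota> J" "lu x" "\<iota> y"], of "as J J x \<odot> \<iota> y"] by simp
    finally show ?thesis .
  qed
  have ZZ: "(as J (J \<star> x) y \<bullet> (as J J x \<odot> \<iota> y)) \<bullet> (ias J J x \<odot> \<iota> y) \<bullet> ias J (J \<star> x) y = \<iota> (J \<star> (J \<star> x) \<star> y)"
    using reassoc1[of "as J J x \<odot> \<iota> y" "ias J J x \<odot> \<iota> y" "\<iota> ((J \<star> J \<star> x) \<star> y)" "ias J (J \<star> x) y"] by (simp add: interchange del: whisker_right)
  show "\<iota> J \<odot> (lu (x \<star> y) \<bullet> as J x y) = \<iota> J \<odot> lu x \<odot> \<iota> y"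
    by (rule comp_eq_cancel_right[OF Z ZZ]) simp_all
qed simp_all

lemma ru_tens: "(\<iota> x \<odot> ru y) \<bullet> as x y J = ru (x \<star> y)"
proof (rule unit_tens_right_cancel)
  have "as x y J \<bullet> (((\<iota> x \<odot> ru y) \<bullet> as x y J) \<odot> \<iota> J) = as x y J \<bullet> ((\<iota> x \<odot> ru y) \<odot> \<iota> J) \<bullet> (as x y J \<odot> \<iota> J)"
    by simp
  also have "\<dots> = (\<iota> x \<odot> ru y \<odot> \<iota> J) \<bullet> as x (y \<star> J) J \<bullet> (as x y J \<odot> \<iota> J)"
    using reassoc[OF as_natural[of "\<iota> x" "ru y" "\<iota> J"], of "as x y J \<odot> \<iota> J"] by simp
  also have "\<dots> = (\<iota> x \<odot> \<iota> y \<odot> lu J) \<bullet> (\<iota> x \<odot> as y J J) \<bullet> as x (y \<star> J) J \<bullet> (as x y J \<odot> \<iota> J)"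
    by (simp flip: triangle del: tens_idt)
  also have "\<dots> = (\<iota> x \<odot> \<iota> y \<odot> lu J) \<bullet> as x y (J \<star> J) \<bullet> as (x \<star> y) J J"
    by (simp add: pentagon)
  also have "\<dots> = as x y J \<bullet> (\<iota> (x \<star> y) \<odot> lu J) \<bullet> as (x \<star> y) J J"
    using reassoc[OF as_natural[of "\<iota> x" "\<iota> y" "lu J"], of "as (x \<star> y) J J"] by simp
  also have "\<dots> = as x y J \<bullet> (ru (x \<star> y) \<odot> \<iota> J)"
    by (simp add: triangle)
  finally have Z: "as x y J \<bullet> (((\<iota> x \<odot> ru y) \<bullet> as x y J) \<odot> \<iota> J) = as x y J \<bullet> (ru (x \<star> y) \<odot> \<iota> J)" .
  show "((\<iota> x \<odot> ru y) \<bullet> as x y J) \<odot> \<iota> J = ru (x \<star> y) \<odot> \<iota> J"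
    by (rule comp_eq_cancel_left[OF Z ias_as]) simp_all
qed simp_all

lemma lu_unit: "lu J = ru J"
proof (rule unit_tens_right_cancel)
  have "lu J \<bullet> (\<iota> J \<odot> lu J) = lu J \<bullet> lu (J \<star> J)" using lu_natural[of "lu J"] by simp
  then have "\<iota> J \<odot> lu J = lu (J \<star> J)" by (rule comp_eq_cancel_left[OF _ ilu_lu]) simp_all
  then show "lu J \<odot> \<iota> J = ru J \<odot> \<iota> J" by (simp flip: lu_tens triangle)
qed simp_all

text \<open>The product of a word is nested to the right and ends in \<open>J\<close>, so a
  one-letter word stands for \<open>x \<star> J\<close> and not for \<open>x\<close>. Every
  comparison with the original category therefore passes through a right unitor.\<close>

fun TT :: "'o list \<Rightarrow> 'o" where
  "TT [] = J"
| "TT (x # l) = x \<star> TT l"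

text \<open>The comparison isomorphism from \<open>TT l \<star> TT m\<close> to
  \<open>TT (l @ m)\<close>; \<open>imu\<close> is its inverse.\<close>

fun mu :: "'o list \<Rightarrow> 'o list \<Rightarrow> 'b" where
  "mu [] m = lu (TT m)"
| "mu (x # l) m = (\<iota> x \<odot> mu l m) \<bullet> as x (TT l) (TT m)"

fun imu :: "'o list \<Rightarrow> 'o list \<Rightarrow> 'b" where
  "imu [] m = ilu (TT m)"
| "imu (x # l) m = ias x (TT l) (TT m) \<bullet> (\<iota> x \<odot> imu l m)"

lemma arr_mu [simp]: "arr (mu l m)" "src (mu l m) = TT l \<star> TT m" "trg (mu l m) = TT (l @ m)"
proof -
  have "arr (mu l m) \<and> src (mu l m) = TT l \<star> TT m \<and> trg (mu l m) = TT (l @ m)" by (induction l) simp_all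
  then show "arr (mu l m)" "src (mu l m) = TT l \<star> TT m" "trg (mu l m) = TT (l @ m)" by simp_all
qed

lemma arr_imu [simp]: "arr (imu l m)" "trg (imu l m) = TT l \<star> TT m" "src (imu l m) = TT (l @ m)"
proof -
  have "arr (imu l m) \<and> trg (imu l m) = TT l \<star> TT m \<and> src (imu l m) = TT (l @ m)" by (induction l) simp_all
  then show "arr (imu l m)" "trg (imu l m) = TT l \<star> TT m" "src (imu l m) = TT (l @ m)" by simp_all
qed

lemma mu_imu [simp]: "mu l m \<bullet> imu l m = \<iota> (TT (l @ m))"
  by (induction l) (simp_all add: interchange del: whisker_left)

lemma imu_mu [simp]: "imu l m \<bullet> mu l m = \<iota> (TT l \<star> TT m)"
proof (induction l)
  case (Cons x l)
  have "(\<iota> x \<odot> imu l m) \<bullet> (\<iota> x \<odot> mu l m) = \<iota> (x \<star> TT l \<star> TT m)"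
    by (simp add: interchange Cons.IH del: whisker_left)
  from reassoc1[OF this, of "as x (TT l) (TT m)"] show ?case by simp
qed simp

lemma mu_imu_comp [simp]:
  "\<lbrakk>arr f; trg f = TT (l @ m)\<rbrakk> \<Longrightarrow> mu l m \<bullet> imu l m \<bullet> f = f"
  "\<lbrakk>arr f; trg f = TT l \<star> TT m\<rbrakk> \<Longrightarrow> imu l m \<bullet> mu l m \<bullet> f = f"
  using reassoc1[OF mu_imu[of l m], of f] reassoc1[OF imu_mu[of l m], of f] by simp_all

text \<open>Compatibility of the comparison with the associator: the empty word is the case
  \<open>lu_tens\<close>, and prefixing a letter is the pentagon.\<close>

lemma mu_assoc:
  "mu (l @ m) n \<bullet> (mu l m \<odot> \<iota> (TT n)) = mu l (m @ n) \<bullet> (\<iota> (TT l) \<odot> mu m n) \<bullet> as (TT l) (TT m) (TT n)"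
proof (induction l)
  case Nil
  have "mu m n \<bullet> (lu (TT m) \<odot> \<iota> (TT n)) = mu m n \<bullet> lu (TT m \<star> TT n) \<bullet> as J (TT m) (TT n)"
    by (simp add: lu_tens)
  also have "\<dots> = lu (TT (m @ n)) \<bullet> (\<iota> J \<odot> mu m n) \<bullet> as J (TT m) (TT n)"
    using reassoc[OF lu_natural[of "mu m n"], of "as J (TT m) (TT n)"] by simp
  finally show ?case by simp
next
  case (Cons x l)
  let ?L = "TT l" and ?M = "TT m" and ?N = "TT n"
  have "mu ((x # l) @ m) n \<bullet> (mu (x # l) m \<odot> \<iota> ?N)
      = (\<iota> x \<odot> mu (l @ m) n) \<bullet> as x (TT (l @ m)) ?N \<bullet> ((\<iota> x \<odot> mu l m) \<odot> \<iota> ?N) \<bullet> (as x ?L ?M \<odot> \<iota> ?N)"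
    by simp
  also have "as x (TT (l @ m)) ?N \<bullet> ((\<iota> x \<odot> mu l m) \<odot> \<iota> ?N) \<bullet> (as x ?L ?M \<odot> \<iota> ?N)
      = (\<iota> x \<odot> mu l m \<odot> \<iota> ?N) \<bullet> as x (?L \<star> ?M) ?N \<bullet> (as x ?L ?M \<odot> \<iota> ?N)"
    using reassoc[OF as_natural[of "\<iota> x" "mu l m" "\<iota> ?N"], of "as x ?L ?M \<odot> \<iota> ?N"] by simp
  also have "(\<iota> x \<odot> mu (l @ m) n) \<bullet> (\<iota> x \<odot> mu l m \<odot> \<iota> ?N) \<bullet> as x (?L \<star> ?M) ?N \<bullet> (as x ?L ?M \<odot> \<iota> ?N)
      = (\<iota> x \<odot> (mu (l @ m) n \<bullet> (mu l m \<odot> \<iota> ?N))) \<bullet> as x (?L \<star> ?M) ?N \<bullet> (as x ?L ?M \<odot> \<iota> ?N)"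
    by simp
  also have "\<dots> = (\<iota> x \<odot> mu l (m @ n)) \<bullet> (\<iota> x \<odot> \<iota> ?L \<odot> mu m n) \<bullet> (\<iota> x \<odot> as ?L ?M ?N) \<bullet> as x (?L \<star> ?M) ?N \<bullet> (as x ?L ?M \<odot> \<iota> ?N)"
    unfolding Cons.IH by simp
  also have "\<dots> = (\<iota> x \<odot> mu l (m @ n)) \<bullet> (\<iota> x \<odot> \<iota> ?L \<odot> mu m n) \<bullet> as x ?L (?M \<star> ?N) \<bullet> as (x \<star> ?L) ?M ?N"
    by (simp add: pentagon)
  also have "(\<iota> x \<odot> \<iota> ?L \<odot> mu m n) \<bullet> as x ?L (?M \<star> ?N) \<bullet> as (x \<star> ?L) ?M ?N
     = as x ?L (TT (m @ n)) \<bullet> (\<iota> (x \<star> ?L) \<odot> mu m n) \<bullet> as (x \<star> ?L) ?M ?N"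
    using reassoc[OF as_natural[of "\<iota> x" "\<iota> ?L" "mu m n"], of "as (x \<star> ?L) ?M ?N"] by simp
  finally show ?case by simp
qed

lemma mu_Nil_right: "mu l [] = ru (TT l)"
  by (induction l) (simp_all add: lu_unit ru_tens)

lemma mu_single: "mu [x] m = ru x \<odot> \<iota> (TT m)"
  by (simp add: triangle)

lemma cancel_whisker_left:
  assumes "g \<bullet> f = \<iota> (src f)" and [simp]: "arr g" "arr f" "src g = trg f" "arr h" "trg h = x \<star> src f"
  shows "(\<iota> x \<odot> g) \<bullet> (\<iota> x \<odot> f) \<bullet> h = h"
  using reassoc1[of "\<iota> x \<odot> g" "\<iota> x \<odot> f" "\<iota> (x \<star> src f)" h] assms(1) by (simp add: interchange del: whisker_left)

lemma cancel_whisker_right: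
  assumes "g \<bullet> f = \<iota> (src f)" and [simp]: "arr g" "arr f" "src g = trg f" "arr h" "trg h = src f \<star> x"
  shows "(g \<odot> \<iota> x) \<bullet> (f \<odot> \<iota> x) \<bullet> h = h"
  using reassoc1[of "g \<odot> \<iota> x" "f \<odot> \<iota> x" "\<iota> (src f \<star> x)" h] assms(1) by (simp add: interchange del: whisker_right)

lemma imu_assoc:
  "as (TT l) (TT m) (TT n) \<bullet> (imu l m \<odot> \<iota> (TT n)) \<bullet> imu (l @ m) n = (\<iota> (TT l) \<odot> imu m n) \<bullet> imu l (m @ n)"
proof -
  let ?B = "as (TT l) (TT m) (TT n) \<bullet> (imu l m \<odot> \<iota> (TT n)) \<bullet> imu (l @ m) n"
  have "mu l (m @ n) \<bullet> (\<iota> (TT l) \<odot> mu m n) \<bullet> ?B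
      = mu (l @ m) n \<bullet> (mu l m \<odot> \<iota> (TT n)) \<bullet> (imu l m \<odot> \<iota> (TT n)) \<bullet> imu (l @ m) n"
    using reassoc1[OF mu_assoc[of l m n], of "(imu l m \<odot> \<iota> (TT n)) \<bullet> imu (l @ m) n"] by simp
  also have "\<dots> = \<iota> (TT (l @ m @ n))" by (simp add: cancel_whisker_right)
  finally have 1: "mu l (m @ n) \<bullet> (\<iota> (TT l) \<odot> mu m n) \<bullet> ?B = \<iota> (TT (l @ m @ n))" .
  have "?B = (\<iota> (TT l) \<odot> imu m n) \<bullet> (\<iota> (TT l) \<odot> mu m n) \<bullet> ?B" by (simp add: cancel_whisker_left)
  also have "\<dots> = (\<iota> (TT l) \<odot> imu m n) \<bullet> imu l (m @ n) \<bullet> (mu l (m @ n) \<bullet> (\<iota> (TT l) \<odot> mu m n) \<bullet> ?B)"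
    by simp
  finally show ?thesis unfolding 1 by simp
qed

lemma imu_mu_assoc:
  "imu l (m @ n) \<bullet> mu (l @ m) n = (\<iota> (TT l) \<odot> mu m n) \<bullet> as (TT l) (TT m) (TT n) \<bullet> (imu l m \<odot> \<iota> (TT n))"
proof -
  have "imu l (m @ n) \<bullet> mu (l @ m) n = imu l (m @ n) \<bullet> mu (l @ m) n \<bullet> (mu l m \<odot> \<iota> (TT n)) \<bullet> (imu l m \<odot> \<iota> (TT n))"
    using cancel_whisker_right[of "mu l m" "imu l m" "\<iota> (TT (l @ m) \<star> TT n)" "TT n"] by simp
  also have "mu (l @ m) n \<bullet> (mu l m \<odot> \<iota> (TT n)) \<bullet> (imu l m \<odot> \<iota> (TT n))
     = mu l (m @ n) \<bullet> (\<iota> (TT l) \<odot> mu m n) \<bullet> as (TT l) (TT m) (TT n) \<bullet> (imu l m \<odot> \<iota> (TT n))"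
    using reassoc1[OF mu_assoc[of l m n], of "imu l m \<odot> \<iota> (TT n)"] by simp
  finally show ?thesis by simp
qed

lemma imu_mu_assoc':
  "imu (l @ m) n \<bullet> mu l (m @ n) = (mu l m \<odot> \<iota> (TT n)) \<bullet> ias (TT l) (TT m) (TT n) \<bullet> (\<iota> (TT l) \<odot> imu m n)"
proof -
  have "(\<iota> (TT l) \<odot> imu m n) \<bullet> imu l (m @ n) \<bullet> mu l (m @ n) = \<iota> (TT l) \<odot> imu m n" by simp
  then have "as (TT l) (TT m) (TT n) \<bullet> (imu l m \<odot> \<iota> (TT n)) \<bullet> imu (l @ m) n \<bullet> mu l (m @ n) = \<iota> (TT l) \<odot> imu m n"
    using reassoc1[OF imu_assoc[of l m n, symmetric], of "mu l (m @ n)"] by simp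
  then have "(mu l m \<odot> \<iota> (TT n)) \<bullet> ias (TT l) (TT m) (TT n) \<bullet> as (TT l) (TT m) (TT n) \<bullet> (imu l m \<odot> \<iota> (TT n)) \<bullet> imu (l @ m) n \<bullet> mu l (m @ n)
     = (mu l m \<odot> \<iota> (TT n)) \<bullet> ias (TT l) (TT m) (TT n) \<bullet> (\<iota> (TT l) \<odot> imu m n)"
    by (simp only:)
  then show ?thesis by (simp add: cancel_whisker_right)
qed

text \<open>Both words are stored because \<open>TT\<close> need not be injective; the composition
  and identities are inherited.\<close>

definition sarr :: "'o list \<times> 'b \<times> 'o list \<Rightarrow> bool" where
  "sarr = (\<lambda>(l, f, m). arr f \<and> src f = TT l \<and> trg f = TT m)"
definition ssrc :: "'o list \<times> 'b \<times> 'o list \<Rightarrow> 'o list" where "ssrc = (\<lambda>(l, f, m). l)"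
definition strg :: "'o list \<times> 'b \<times> 'o list \<Rightarrow> 'o list" where "strg = (\<lambda>(l, f, m). m)"
definition scomp :: "'o list \<times> 'b \<times> 'o list \<Rightarrow> 'o list \<times> 'b \<times> 'o list \<Rightarrow> 'o list \<times> 'b \<times> 'o list" where
  "scomp = (\<lambda>(l', g, m') (l, f, m). (l, g \<bullet> f, m'))"
definition stens :: "'o list \<times> 'b \<times> 'o list \<Rightarrow> 'o list \<times> 'b \<times> 'o list \<Rightarrow> 'o list \<times> 'b \<times> 'o list" where
  "stens = (\<lambda>(l, f, m) (l', g, m'). (l @ l', mu m m' \<bullet> (f \<odot> g) \<bullet> imu l l', m @ m'))"
definition sidt :: "'o list \<Rightarrow> 'o list \<times> 'b \<times> 'o list" where "sidt l = (l, \<iota> (TT l), l)"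

lemmas s_defs = sarr_def ssrc_def strg_def scomp_def stens_def sidt_def

text \<open>The product of arrows is conjugated by comparison isomorphisms, and
  \<open>mu_assoc\<close> with \<open>imu_assoc\<close> absorbs the associators at both ends. This
  turns associativity up to isomorphism into equality.\<close>

lemma strict_monoidal: "strict_monoidal sarr ssrc strg scomp stens sidt"
proof
  fix h g f :: "'o list \<times> 'b \<times> 'o list"
  obtain l1 h' m1 where h: "h = (l1, h', m1)" by (cases h)
  obtain l2 g' m2 where g: "g = (l2, g', m2)" by (cases g)
  obtain l3 f' m3 where f: "f = (l3, f', m3)" by (cases f)
  assume "sarr h" "sarr g" "sarr f"
  then have [simp]: "arr h'" "src h' = TT l1" "trg h' = TT m1" "arr g'" "src g' = TT l2" "trg g' = TT m2"
    "arr f'" "src f' = TT l3" "trg f' = TT m3"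
    by (auto simp: s_defs h g f)
  have "mu (m1 @ m2) m3 \<bullet> ((mu m1 m2 \<bullet> (h' \<odot> g') \<bullet> imu l1 l2) \<odot> f') \<bullet> imu (l1 @ l2) l3
    = mu (m1 @ m2) m3 \<bullet> (mu m1 m2 \<odot> \<iota> (TT m3)) \<bullet> ((h' \<odot> g') \<odot> f') \<bullet> (imu l1 l2 \<odot> \<iota> (TT l3)) \<bullet> imu (l1 @ l2) l3"
  proof -
    have "(mu m1 m2 \<bullet> (h' \<odot> g') \<bullet> imu l1 l2) \<odot> f' = (mu m1 m2 \<odot> \<iota> (TT m3)) \<bullet> ((h' \<odot> g') \<odot> f') \<bullet> (imu l1 l2 \<odot> \<iota> (TT l3))"
      by (simp add: interchange)
    then show ?thesis by simp
  qed
  also have "\<dots> = mu m1 (m2 @ m3) \<bullet> (\<iota> (TT m1) \<odot> mu m2 m3) \<bullet> as (TT m1) (TT m2) (TT m3) \<bullet> ((h' \<odot> g') \<odot> f') \<bullet> (imu l1 l2 \<odot> \<iota> (TT l3)) \<bullet> imu (l1 @ l2) l3"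
    using reassoc1[OF mu_assoc[of m1 m2 m3], of "((h' \<odot> g') \<odot> f') \<bullet> (imu l1 l2 \<odot> \<iota> (TT l3)) \<bullet> imu (l1 @ l2) l3"] by simp
  also have "as (TT m1) (TT m2) (TT m3) \<bullet> ((h' \<odot> g') \<odot> f') \<bullet> (imu l1 l2 \<odot> \<iota> (TT l3)) \<bullet> imu (l1 @ l2) l3
     = (h' \<odot> g' \<odot> f') \<bullet> as (TT l1) (TT l2) (TT l3) \<bullet> (imu l1 l2 \<odot> \<iota> (TT l3)) \<bullet> imu (l1 @ l2) l3"
    using reassoc[OF as_natural[of h' g' f'], of "(imu l1 l2 \<odot> \<iota> (TT l3)) \<bullet> imu (l1 @ l2) l3"] by simp
  also have "as (TT l1) (TT l2) (TT l3) \<bullet> (imu l1 l2 \<odot> \<iota> (TT l3)) \<bullet> imu (l1 @ l2) l3 = (\<iota> (TT l1) \<odot> imu l2 l3) \<bullet> imu l1 (l2 @ l3)"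
    by (rule imu_assoc)
  also have "mu m1 (m2 @ m3) \<bullet> (\<iota> (TT m1) \<odot> mu m2 m3) \<bullet> (h' \<odot> g' \<odot> f') \<bullet> (\<iota> (TT l1) \<odot> imu l2 l3) \<bullet> imu l1 (l2 @ l3)
     = mu m1 (m2 @ m3) \<bullet> (h' \<odot> (mu m2 m3 \<bullet> (g' \<odot> f') \<bullet> imu l2 l3)) \<bullet> imu l1 (l2 @ l3)"
  proof -
    have "h' \<odot> (mu m2 m3 \<bullet> (g' \<odot> f') \<bullet> imu l2 l3) = (\<iota> (TT m1) \<odot> mu m2 m3) \<bullet> (h' \<odot> g' \<odot> f') \<bullet> (\<iota> (TT l1) \<odot> imu l2 l3)"
      by (simp add: interchange)
    then show ?thesis by simp
  qed
  finally show "stens (stens h g) f = stens h (stens g f)"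
    by (simp add: s_defs h g f)
next
  fix f :: "'o list \<times> 'b \<times> 'o list"
  obtain l f' m where f: "f = (l, f', m)" by (cases f)
  assume "sarr f"
  then have [simp]: "arr f'" "src f' = TT l" "trg f' = TT m" by (auto simp: s_defs f)
  \<comment> \<open>Strict unitality on the right needs both comparisons with the empty word to be
    right unitors.\<close>
  have "imu l [] = iru (TT l)"
  proof -
    have "imu l [] = imu l [] \<bullet> ru (TT l) \<bullet> iru (TT l)" by simp
    also have "\<dots> = iru (TT l)" unfolding mu_Nil_right[symmetric] by simp
    finally show ?thesis .
  qed
  then show "stens f (sidt []) = f"
    using reassoc[OF ru_natural[of f'], of "iru (TT l)"] by (simp add: s_defs f mu_Nil_right)
  show "stens (sidt []) f = f"
    using reassoc[OF lu_natural[of f'], of "ilu (TT l)"] by (simp add: s_defs f)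
next
  fix g f g' f' :: "'o list \<times> 'b \<times> 'o list"
  obtain l1 h1 m1 where 1: "g = (l1, h1, m1)" by (cases g)
  obtain l2 h2 m2 where 2: "f = (l2, h2, m2)" by (cases f)
  obtain l3 h3 m3 where 3: "g' = (l3, h3, m3)" by (cases g')
  obtain l4 h4 m4 where 4: "f' = (l4, h4, m4)" by (cases f')
  assume "sarr g" "sarr f" "sarr g'" "sarr f'" "ssrc g = strg f" "ssrc g' = strg f'"
  then show "scomp (stens g g') (stens f f') = stens (scomp g f) (scomp g' f')"
    using reassoc1[OF interchange[of h1 h2 h3 h4], of "imu l2 l4"]
    by (auto simp: s_defs 1 2 3 4)
qed (auto simp: s_defs)

end

section \<open>Braiding, twist and duals of the strict model\<close>

locale typed_ribbon = typed_monoidal arr src trg comp tens idt tob J as ias lu ilu ru iru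
  for arr :: "'b \<Rightarrow> bool" and src trg :: "'b \<Rightarrow> 'o"
    and comp :: "'b \<Rightarrow> 'b \<Rightarrow> 'b" (infixr "\<bullet>" 65)
    and tens :: "'b \<Rightarrow> 'b \<Rightarrow> 'b" (infixr "\<odot>" 70)
    and idt :: "'o \<Rightarrow> 'b" ("\<iota>")
    and tob :: "'o \<Rightarrow> 'o \<Rightarrow> 'o" (infixr "\<star>" 75) and J :: 'o
    and as ias :: "'o \<Rightarrow> 'o \<Rightarrow> 'o \<Rightarrow> 'b" and lu ilu ru iru :: "'o \<Rightarrow> 'b" +
  fixes br ibr :: "'o \<Rightarrow> 'o \<Rightarrow> 'b" and tw :: "'o \<Rightarrow> 'b"
  assumes arr_br [simp]: "arr (br x y)" "src (br x y) = x \<star> y" "trg (br x y) = y \<star> x"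
    and arr_ibr [simp]: "arr (ibr x y)" "src (ibr x y) = y \<star> x" "trg (ibr x y) = x \<star> y"
    and ibr_br [simp]: "ibr x y \<bullet> br x y = \<iota> (x \<star> y)"
    and br_ibr [simp]: "br x y \<bullet> ibr x y = \<iota> (y \<star> x)"
    and br_natural: "\<lbrakk>arr f; arr g\<rbrakk> \<Longrightarrow> br (trg f) (trg g) \<bullet> (f \<odot> g) = (g \<odot> f) \<bullet> br (src f) (src g)"
    and hexagon: "as y z x \<bullet> br x (y \<star> z) \<bullet> as x y z = (\<iota> y \<odot> br x z) \<bullet> as y x z \<bullet> (br x y \<odot> \<iota> z)"
    and hexagon_inv: "ias z x y \<bullet> br (x \<star> y) z \<bullet> ias x y z = (br x z \<odot> \<iota> y) \<bullet> ias x z y \<bullet> (\<iota> x \<odot> br y z)"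
    and arr_tw [simp]: "arr (tw x)" "src (tw x) = x" "trg (tw x) = x"
    and tw_natural: "arr f \<Longrightarrow> tw (trg f) \<bullet> f = f \<bullet> tw (src f)"
    and tw_tens: "tw (x \<star> y) = br y x \<bullet> br x y \<bullet> (tw x \<odot> tw y)"
begin

definition sbr :: "'o list \<Rightarrow> 'o list \<Rightarrow> 'o list \<times> 'b \<times> 'o list" where
  "sbr l m = (l @ m, mu m l \<bullet> br (TT l) (TT m) \<bullet> imu l m, m @ l)"
definition sibr :: "'o list \<Rightarrow> 'o list \<Rightarrow> 'o list \<times> 'b \<times> 'o list" where
  "sibr l m = (m @ l, mu l m \<bullet> ibr (TT l) (TT m) \<bullet> imu m l, l @ m)"
definition stw :: "'o list \<Rightarrow> 'o list \<times> 'b \<times> 'o list" where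
  "stw l = (l, tw (TT l), l)"

lemma strict_ribbon: "strict_ribbon sarr ssrc strg scomp stens sidt sbr sibr stw"
proof -
  have [simp]: "ibr x y \<bullet> br x y \<bullet> f = f" if "arr f" "trg f = x \<star> y" for x y f
    using reassoc1[OF ibr_br[of x y], of f] that by simp
  have [simp]: "br x y \<bullet> ibr x y \<bullet> f = f" if "arr f" "trg f = y \<star> x" for x y f
    using reassoc1[OF br_ibr[of x y], of f] that by simp
  show ?thesis
  proof (intro strict_ribbon.intro strict_ribbon_axioms.intro strict_monoidal)
    fix f g :: "'o list \<times> 'b \<times> 'o list"
    obtain l1 f' m1 where f: "f = (l1, f', m1)" by (cases f)
    obtain l2 g' m2 where g: "g = (l2, g', m2)" by (cases g)
    assume "sarr f" "sarr g"
    then show "scomp (sbr (strg f) (strg g)) (stens f g) = scomp (stens g f) (sbr (ssrc f) (ssrc g))"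
      using reassoc[OF br_natural[of f' g'], of "imu l1 l2"] by (auto simp: s_defs sbr_def f g)
  next
    fix x y z :: "'o list"
    let ?x = "TT x" and ?y = "TT y" and ?z = "TT z"
    let ?E = "(imu x y \<odot> \<iota> ?z) \<bullet> imu (x @ y) z"
    \<comment> \<open>The right side is unfolded, its inner rebracketing collapses to one associator
      by \<open>imu_mu_assoc\<close>, and the hexagon of the original category applies.\<close>
    have "mu y (z @ x) \<bullet> (\<iota> ?y \<odot> (mu z x \<bullet> br ?x ?z \<bullet> imu x z)) \<bullet> imu y (x @ z) \<bullet> mu (y @ x) z
        \<bullet> ((mu y x \<bullet> br ?x ?y \<bullet> imu x y) \<odot> \<iota> ?z) \<bullet> imu (x @ y) z
      = mu y (z @ x) \<bullet> (\<iota> ?y \<odot> mu z x) \<bullet> (\<iota> ?y \<odot> br ?x ?z) \<bullet> (\<iota> ?y \<odot> imu x z) \<bullet> (imu y (x @ z) \<bullet> mu (y @ x) z)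
        \<bullet> (mu y x \<odot> \<iota> ?z) \<bullet> (br ?x ?y \<odot> \<iota> ?z) \<bullet> ?E"
      by simp
    also have "\<dots> = mu y (z @ x) \<bullet> (\<iota> ?y \<odot> mu z x) \<bullet> (\<iota> ?y \<odot> br ?x ?z) \<bullet> as ?y ?x ?z \<bullet> (br ?x ?y \<odot> \<iota> ?z) \<bullet> ?E"
      unfolding imu_mu_assoc by (simp add: cancel_whisker_left cancel_whisker_right)
    also have "(\<iota> ?y \<odot> br ?x ?z) \<bullet> as ?y ?x ?z \<bullet> (br ?x ?y \<odot> \<iota> ?z) \<bullet> ?E
        = as ?y ?z ?x \<bullet> br ?x (?y \<star> ?z) \<bullet> as ?x ?y ?z \<bullet> ?E"
    proof -
      have "((\<iota> ?y \<odot> br ?x ?z) \<bullet> as ?y ?x ?z \<bullet> (br ?x ?y \<odot> \<iota> ?z)) \<bullet> ?E = (as ?y ?z ?x \<bullet> br ?x (?y \<star> ?z) \<bullet> as ?x ?y ?z) \<bullet> ?E"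
        by (simp only: hexagon)
      then show ?thesis by simp
    qed
    also have "as ?x ?y ?z \<bullet> ?E = (\<iota> ?x \<odot> imu y z) \<bullet> imu x (y @ z)"
      by (rule imu_assoc)
    also have "br ?x (?y \<star> ?z) \<bullet> (\<iota> ?x \<odot> imu y z) \<bullet> imu x (y @ z) = (imu y z \<odot> \<iota> ?x) \<bullet> br ?x (TT (y @ z)) \<bullet> imu x (y @ z)"
      using reassoc[OF br_natural[of "\<iota> ?x" "imu y z"], of "imu x (y @ z)"] by simp
    also have "mu y (z @ x) \<bullet> (\<iota> ?y \<odot> mu z x) \<bullet> as ?y ?z ?x \<bullet> (imu y z \<odot> \<iota> ?x) \<bullet> br ?x (TT (y @ z)) \<bullet> imu x (y @ z)
      = mu (y @ z) x \<bullet> (mu y z \<odot> \<iota> ?x) \<bullet> (imu y z \<odot> \<iota> ?x) \<bullet> br ?x (TT (y @ z)) \<bullet> imu x (y @ z)"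
      using reassoc1[OF mu_assoc[of y z x], of "(imu y z \<odot> \<iota> ?x) \<bullet> br ?x (TT (y @ z)) \<bullet> imu x (y @ z)"] by simp
    finally show "sbr x (y @ z) = scomp (stens (sidt y) (sbr x z)) (stens (sbr x y) (sidt z))"
      by (simp add: s_defs sbr_def cancel_whisker_right)
  next
    fix x y z :: "'o list"
    let ?x = "TT x" and ?y = "TT y" and ?z = "TT z"
    let ?E = "(\<iota> ?x \<odot> imu y z) \<bullet> imu x (y @ z)"
    have "mu (z @ x) y \<bullet> ((mu z x \<bullet> br ?x ?z \<bullet> imu x z) \<odot> \<iota> ?y) \<bullet> imu (x @ z) y \<bullet> mu x (z @ y)
        \<bullet> (\<iota> ?x \<odot> (mu z y \<bullet> br ?y ?z \<bullet> imu y z)) \<bullet> imu x (y @ z)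
      = mu (z @ x) y \<bullet> (mu z x \<odot> \<iota> ?y) \<bullet> (br ?x ?z \<odot> \<iota> ?y) \<bullet> (imu x z \<odot> \<iota> ?y) \<bullet> (imu (x @ z) y \<bullet> mu x (z @ y))
        \<bullet> (\<iota> ?x \<odot> mu z y) \<bullet> (\<iota> ?x \<odot> br ?y ?z) \<bullet> ?E"
      by simp
    also have "\<dots> = mu (z @ x) y \<bullet> (mu z x \<odot> \<iota> ?y) \<bullet> (br ?x ?z \<odot> \<iota> ?y) \<bullet> ias ?x ?z ?y \<bullet> (\<iota> ?x \<odot> br ?y ?z) \<bullet> ?E"
      unfolding imu_mu_assoc' by (simp add: cancel_whisker_left cancel_whisker_right)
    also have "(br ?x ?z \<odot> \<iota> ?y) \<bullet> ias ?x ?z ?y \<bullet> (\<iota> ?x \<odot> br ?y ?z) \<bullet> ?E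
        = ias ?z ?x ?y \<bullet> br (?x \<star> ?y) ?z \<bullet> ias ?x ?y ?z \<bullet> ?E"
    proof -
      have "((br ?x ?z \<odot> \<iota> ?y) \<bullet> ias ?x ?z ?y \<bullet> (\<iota> ?x \<odot> br ?y ?z)) \<bullet> ?E = (ias ?z ?x ?y \<bullet> br (?x \<star> ?y) ?z \<bullet> ias ?x ?y ?z) \<bullet> ?E"
        by (simp only: hexagon_inv)
      then show ?thesis by simp
    qed
    also have "ias ?x ?y ?z \<bullet> ?E = (imu x y \<odot> \<iota> ?z) \<bullet> imu (x @ y) z"
      by (subst imu_assoc[symmetric]) simp
    also have "br (?x \<star> ?y) ?z \<bullet> (imu x y \<odot> \<iota> ?z) \<bullet> imu (x @ y) z = (\<iota> ?z \<odot> imu x y) \<bullet> br (TT (x @ y)) ?z \<bullet> imu (x @ y) z"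
      using reassoc[OF br_natural[of "imu x y" "\<iota> ?z"], of "imu (x @ y) z"] by simp
    also have "mu (z @ x) y \<bullet> (mu z x \<odot> \<iota> ?y) \<bullet> ias ?z ?x ?y \<bullet> (\<iota> ?z \<odot> imu x y) \<bullet> br (TT (x @ y)) ?z \<bullet> imu (x @ y) z
      = mu z (x @ y) \<bullet> br (TT (x @ y)) ?z \<bullet> imu (x @ y) z"
      using reassoc1[OF mu_assoc[of z x y], of "ias ?z ?x ?y \<bullet> (\<iota> ?z \<odot> imu x y) \<bullet> br (TT (x @ y)) ?z \<bullet> imu (x @ y) z"]
      by (simp add: cancel_whisker_left)
    finally show "sbr (x @ y) z = scomp (stens (sbr x z) (sidt y)) (stens (sidt x) (sbr y z))"
      by (simp add: s_defs sbr_def)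
  next
    fix x y :: "'o list"
    let ?x = "TT x" and ?y = "TT y"
    have "tw (TT (x @ y)) = mu x y \<bullet> imu x y \<bullet> tw (TT (x @ y))" by simp
    also have "imu x y \<bullet> tw (TT (x @ y)) = tw (?x \<star> ?y) \<bullet> imu x y" using tw_natural[of "imu x y"] by simp
    finally show "stw (x @ y) = scomp (sbr y x) (scomp (sbr x y) (stens (stw x) (stw y)))"
      by (simp add: s_defs sbr_def stw_def tw_tens)
  next
    fix f :: "'o list \<times> 'b \<times> 'o list"
    assume "sarr f"
    then show "scomp (stw (strg f)) f = scomp f (stw (ssrc f))"
      using tw_natural[of "fst (snd f)"] by (auto simp: s_defs stw_def)
  qed (auto simp: s_defs sbr_def sibr_def stw_def)
qed

context
  fixes x y e c
  assumes e [simp]: "arr e" "src e = y \<star> x" "trg e = J"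
    and c [simp]: "arr c" "src c = J" "trg c = x \<star> y"
begin

text \<open>The word \<open>[y, x]\<close> stands for \<open>y \<star> x \<star> J\<close>, so a
  right unitor removes the trailing \<open>J\<close> before evaluating; \<open>scoev\<close> inserts
  it after coevaluating.\<close>

definition sev :: "'o list \<times> 'b \<times> 'o list" where "sev = ([y, x], e \<bullet> (\<iota> y \<odot> ru x), [])"
definition scoev :: "'o list \<times> 'b \<times> 'o list" where "scoev = ([], (\<iota> x \<odot> iru y) \<bullet> c, [x, y])"

lemma imu_single: "imu [a] m = iru a \<odot> \<iota> (TT m)"
proof -
  have "imu [a] m = imu [a] m \<bullet> mu [a] m \<bullet> (iru a \<odot> \<iota> (TT m))"
    unfolding mu_single by (simp add: interchange del: mu.simps imu.simps)
  then show ?thesis by (simp del: mu.simps imu.simps)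
qed

lemma stens_single_left:
  assumes [simp]: "arr f" "src f = TT l" "trg f = TT m"
  shows "stens (sidt [a]) (l, f, m) = (a # l, \<iota> a \<odot> f, a # m)"
proof -
  have "mu [a] m \<bullet> (\<iota> (a \<star> J) \<odot> f) \<bullet> imu [a] l = \<iota> a \<odot> f"
    unfolding mu_single imu_single by (simp add: interchange del: mu.simps imu.simps)
  then show ?thesis by (simp add: s_defs del: mu.simps imu.simps)
qed

text \<open>The trailing units are moved aside by naturality until the zigzag identities of the
  original category apply in the middle.\<close>

lemma dual_pair_single:
  assumes z1: "ru x \<bullet> (\<iota> x \<odot> e) \<bullet> as x y x \<bullet> (c \<odot> \<iota> x) = lu x"
    and z2: "lu y \<bullet> (e \<odot> \<iota> y) \<bullet> ias y x y \<bullet> (\<iota> y \<odot> c) = ru y"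
  shows "strict_monoidal.dual_pair sarr ssrc strg scomp stens sidt [x] [y] sev scoev"
proof -
  have 1: "(\<iota> x \<odot> (e \<bullet> (\<iota> y \<odot> ru x))) \<bullet> mu [x, y] [x] \<bullet> (((\<iota> x \<odot> iru y) \<bullet> c) \<odot> \<iota> (x \<star> J)) \<bullet> ilu (x \<star> J) = \<iota> (x \<star> J)"
  proof -
    have "mu [x, y] [x] = (\<iota> x \<odot> ru y \<odot> \<iota> (x \<star> J)) \<bullet> as x (y \<star> J) (x \<star> J)"
      using mu_single[of y "[x]"] by simp
    moreover have "as x (y \<star> J) (x \<star> J) \<bullet> ((\<iota> x \<odot> iru y) \<odot> \<iota> (x \<star> J)) \<bullet> (c \<odot> \<iota> (x \<star> J)) \<bullet> ilu (x \<star> J)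
       = (\<iota> x \<odot> iru y \<odot> \<iota> (x \<star> J)) \<bullet> as x y (x \<star> J) \<bullet> (c \<odot> \<iota> (x \<star> J)) \<bullet> ilu (x \<star> J)"
      using reassoc[OF as_natural[of "\<iota> x" "iru y" "\<iota> (x \<star> J)"], of "(c \<odot> \<iota> (x \<star> J)) \<bullet> ilu (x \<star> J)"] by simp
    moreover have "(\<iota> x \<odot> ru y \<odot> \<iota> (x \<star> J)) \<bullet> (\<iota> x \<odot> iru y \<odot> \<iota> (x \<star> J)) \<bullet> h = h"
      if "arr h" "trg h = x \<star> y \<star> x \<star> J" for h
      using cancel_whisker_left[of "ru y \<odot> \<iota> (x \<star> J)" "iru y \<odot> \<iota> (x \<star> J)" h x] that
      by (simp add: interchange del: whisker_left whisker_right)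
    ultimately have "mu [x, y] [x] \<bullet> (((\<iota> x \<odot> iru y) \<bullet> c) \<odot> \<iota> (x \<star> J)) \<bullet> ilu (x \<star> J)
       = as x y (x \<star> J) \<bullet> (c \<odot> \<iota> (x \<star> J)) \<bullet> ilu (x \<star> J)"
      by (simp del: mu.simps)
    moreover have "(\<iota> x \<odot> \<iota> y \<odot> ru x) \<bullet> as x y (x \<star> J) \<bullet> (c \<odot> \<iota> (x \<star> J)) \<bullet> ilu (x \<star> J)
       = as x y x \<bullet> (\<iota> (x \<star> y) \<odot> ru x) \<bullet> (c \<odot> \<iota> (x \<star> J)) \<bullet> ilu (x \<star> J)"
      using reassoc[OF as_natural[of "\<iota> x" "\<iota> y" "ru x"], of "(c \<odot> \<iota> (x \<star> J)) \<bullet> ilu (x \<star> J)"] by simp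
    moreover have "(\<iota> (x \<star> y) \<odot> ru x) \<bullet> (c \<odot> \<iota> (x \<star> J)) \<bullet> ilu (x \<star> J) = (c \<odot> \<iota> x) \<bullet> (\<iota> J \<odot> ru x) \<bullet> ilu (x \<star> J)"
      using reassoc[OF slide[of c "ru x" J x "x \<star> y" "x \<star> J", symmetric], of "ilu (x \<star> J)"] by simp
    moreover have "(\<iota> x \<odot> e) \<bullet> as x y x \<bullet> (c \<odot> \<iota> x) \<bullet> (\<iota> J \<odot> ru x) \<bullet> ilu (x \<star> J) = iru x \<bullet> lu x \<bullet> (\<iota> J \<odot> ru x) \<bullet> ilu (x \<star> J)"
    proof -
      have "iru x \<bullet> ru x \<bullet> (\<iota> x \<odot> e) \<bullet> as x y x \<bullet> (c \<odot> \<iota> x) = iru x \<bullet> lu x" by (simp only: z1)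
      then have X: "(\<iota> x \<odot> e) \<bullet> as x y x \<bullet> (c \<odot> \<iota> x) = iru x \<bullet> lu x" by simp
      have "((\<iota> x \<odot> e) \<bullet> as x y x \<bullet> (c \<odot> \<iota> x)) \<bullet> (\<iota> J \<odot> ru x) \<bullet> ilu (x \<star> J) = (iru x \<bullet> lu x) \<bullet> (\<iota> J \<odot> ru x) \<bullet> ilu (x \<star> J)"
        by (simp only: X)
      then show ?thesis by simp
    qed
    moreover have "lu x \<bullet> (\<iota> J \<odot> ru x) \<bullet> ilu (x \<star> J) = ru x"
      using reassoc[OF lu_natural[of "ru x"], of "ilu (x \<star> J)"] by simp
    ultimately show ?thesis by (simp del: mu.simps)
  qed
  have 2: "lu (y \<star> J) \<bullet> ((e \<bullet> (\<iota> y \<odot> ru x)) \<odot> \<iota> (y \<star> J)) \<bullet> imu [y, x] [y] \<bullet> (\<iota> y \<odot> ((\<iota> x \<odot> iru y) \<bullet> c)) = \<iota> (y \<star> J)"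
  proof -
    have "imu [y, x] [y] = ias y (x \<star> J) (y \<star> J) \<bullet> (\<iota> y \<odot> iru x \<odot> \<iota> (y \<star> J))"
      using imu_single[of x "[y]"] by simp
    moreover have "((\<iota> y \<odot> ru x) \<odot> \<iota> (y \<star> J)) \<bullet> ias y (x \<star> J) (y \<star> J) = ias y x (y \<star> J) \<bullet> (\<iota> y \<odot> ru x \<odot> \<iota> (y \<star> J))"
    proof -
      have "((\<iota> y \<odot> ru x) \<odot> \<iota> (y \<star> J)) \<bullet> ias y (x \<star> J) (y \<star> J)
        = ias y x (y \<star> J) \<bullet> (as y x (y \<star> J) \<bullet> ((\<iota> y \<odot> ru x) \<odot> \<iota> (y \<star> J))) \<bullet> ias y (x \<star> J) (y \<star> J)" by simp
      also have "as y x (y \<star> J) \<bullet> ((\<iota> y \<odot> ru x) \<odot> \<iota> (y \<star> J)) = (\<iota> y \<odot> ru x \<odot> \<iota> (y \<star> J)) \<bullet> as y (x \<star> J) (y \<star> J)"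
        using as_natural[of "\<iota> y" "ru x" "\<iota> (y \<star> J)"] by simp
      finally show ?thesis by simp
    qed
    ultimately have "((\<iota> y \<odot> ru x) \<odot> \<iota> (y \<star> J)) \<bullet> imu [y, x] [y]
        = ias y x (y \<star> J) \<bullet> (\<iota> y \<odot> ru x \<odot> \<iota> (y \<star> J)) \<bullet> (\<iota> y \<odot> iru x \<odot> \<iota> (y \<star> J))"
      using reassoc[of "(\<iota> y \<odot> ru x) \<odot> \<iota> (y \<star> J)" "ias y (x \<star> J) (y \<star> J)" "ias y x (y \<star> J)" "\<iota> y \<odot> ru x \<odot> \<iota> (y \<star> J)" "\<iota> y \<odot> iru x \<odot> \<iota> (y \<star> J)"] by (simp del: imu.simps)
    also have "\<dots> = ias y x (y \<star> J)" by (simp add: interchange del: whisker_left whisker_right)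
    finally have I: "((\<iota> y \<odot> ru x) \<odot> \<iota> (y \<star> J)) \<bullet> imu [y, x] [y] = ias y x (y \<star> J)" .
    have "lu (y \<star> J) \<bullet> ((e \<bullet> (\<iota> y \<odot> ru x)) \<odot> \<iota> (y \<star> J)) \<bullet> imu [y, x] [y] \<bullet> (\<iota> y \<odot> ((\<iota> x \<odot> iru y) \<bullet> c))
      = lu (y \<star> J) \<bullet> (e \<odot> \<iota> (y \<star> J)) \<bullet> ias y x (y \<star> J) \<bullet> (\<iota> y \<odot> \<iota> x \<odot> iru y) \<bullet> (\<iota> y \<odot> c)"
      using reassoc1[OF I, of "(\<iota> y \<odot> \<iota> x \<odot> iru y) \<bullet> (\<iota> y \<odot> c)"] by (simp del: imu.simps)
    also have "ias y x (y \<star> J) \<bullet> (\<iota> y \<odot> \<iota> x \<odot> iru y) \<bullet> (\<iota> y \<odot> c) = (\<iota> (y \<star> x) \<odot> iru y) \<bullet> ias y x y \<bullet> (\<iota> y \<odot> c)"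
    proof -
      have "ias y x (y \<star> J) \<bullet> (\<iota> y \<odot> \<iota> x \<odot> iru y) \<bullet> (\<iota> y \<odot> c)
        = ias y x (y \<star> J) \<bullet> (\<iota> y \<odot> \<iota> x \<odot> iru y) \<bullet> as y x y \<bullet> ias y x y \<bullet> (\<iota> y \<odot> c)" by simp
      also have "(\<iota> y \<odot> \<iota> x \<odot> iru y) \<bullet> as y x y \<bullet> ias y x y \<bullet> (\<iota> y \<odot> c)
         = as y x (y \<star> J) \<bullet> (\<iota> (y \<star> x) \<odot> iru y) \<bullet> ias y x y \<bullet> (\<iota> y \<odot> c)"
        using reassoc[OF as_natural[of "\<iota> y" "\<iota> x" "iru y", symmetric], of "ias y x y \<bullet> (\<iota> y \<odot> c)"] by simp
      finally show ?thesis by simp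
    qed
    also have "(e \<odot> \<iota> (y \<star> J)) \<bullet> (\<iota> (y \<star> x) \<odot> iru y) \<bullet> ias y x y \<bullet> (\<iota> y \<odot> c)
       = (\<iota> J \<odot> iru y) \<bullet> (e \<odot> \<iota> y) \<bullet> ias y x y \<bullet> (\<iota> y \<odot> c)"
      using reassoc[OF slide[of e "iru y" "y \<star> x" "y \<star> J" J y], of "ias y x y \<bullet> (\<iota> y \<odot> c)"] by simp
    also have "lu (y \<star> J) \<bullet> (\<iota> J \<odot> iru y) \<bullet> (e \<odot> \<iota> y) \<bullet> ias y x y \<bullet> (\<iota> y \<odot> c) = iru y \<bullet> lu y \<bullet> (e \<odot> \<iota> y) \<bullet> ias y x y \<bullet> (\<iota> y \<odot> c)"
      using reassoc[OF lu_natural[of "iru y"], of "(e \<odot> \<iota> y) \<bullet> ias y x y \<bullet> (\<iota> y \<odot> c)"] by simp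
    also have "\<dots> = \<iota> (y \<star> J)" by (simp add: z2)
    finally show ?thesis .
  qed
  have L1: "stens (sidt [x]) sev = ([x, y, x], \<iota> x \<odot> (e \<bullet> (\<iota> y \<odot> ru x)), [x])"
    unfolding sev_def by (subst stens_single_left) simp_all
  have L2: "stens (sidt [y]) scoev = ([y], \<iota> y \<odot> ((\<iota> x \<odot> iru y) \<bullet> c), [y, x, y])"
    unfolding scoev_def by (subst stens_single_left) simp_all
  have "scomp (stens (sidt [x]) sev) (stens scoev (sidt [x])) = sidt [x]"
    unfolding L1 using 1 by (simp add: scoev_def s_defs del: mu.simps whisker_left whisker_right)
  moreover have "scomp (stens sev (sidt [y])) (stens (sidt [y]) scoev) = sidt [y]"
    unfolding L2 using 2 by (simp add: sev_def s_defs del: imu.simps whisker_left whisker_right)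
  moreover have "sarr sev" "ssrc sev = [y] @ [x]" "strg sev = []" "sarr scoev" "ssrc scoev = []" "strg scoev = [x] @ [y]"
    by (simp_all add: sev_def scoev_def s_defs)
  ultimately show ?thesis
    unfolding strict_monoidal.dual_pair_def[OF strict_monoidal] by simp
qed

text \<open>All unitors of the strict loop cancel, so dimensions in the strict model can be
  identified with values of \<open>unknot\<close>.\<close>

lemma strace_single:
  "scomp (strict_ribbon.tev scomp stens sidt sbr stw [x] [y] sev) scoev
    = ([], e \<bullet> br x y \<bullet> (tw x \<odot> \<iota> y) \<bullet> c, [])"
proof -
  have tws: "stens (stw [x]) (sidt [y]) = ([x, y], tw x \<odot> \<iota> (y \<star> J), [x, y])"
  proof -
    have "mu [x] [y] \<bullet> (tw (x \<star> J) \<odot> \<iota> (y \<star> J)) \<bullet> imu [x] [y] = (ru x \<bullet> tw (x \<star> J) \<bullet> iru x) \<odot> \<iota> (y \<star> J)"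
      unfolding mu_single imu_single by (simp del: mu.simps imu.simps)
    also have "ru x \<bullet> tw (x \<star> J) \<bullet> iru x = tw x"
      using reassoc[OF tw_natural[of "ru x"], of "iru x"] by simp
    finally show ?thesis by (simp add: stw_def s_defs del: mu.simps imu.simps)
  qed
  have "(e \<bullet> (\<iota> y \<odot> ru x)) \<bullet> (mu [y] [x] \<bullet> br (x \<star> J) (y \<star> J) \<bullet> imu [x] [y]) \<bullet> (tw x \<odot> \<iota> (y \<star> J)) \<bullet> (\<iota> x \<odot> iru y) \<bullet> c
     = e \<bullet> ((\<iota> y \<odot> ru x) \<bullet> (ru y \<odot> \<iota> (x \<star> J))) \<bullet> br (x \<star> J) (y \<star> J) \<bullet> (iru x \<odot> \<iota> (y \<star> J)) \<bullet> ((tw x \<odot> \<iota> (y \<star> J)) \<bullet> (\<iota> x \<odot> iru y)) \<bullet> c"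
    unfolding mu_single imu_single by (simp del: mu.simps imu.simps)
  also have "(\<iota> y \<odot> ru x) \<bullet> (ru y \<odot> \<iota> (x \<star> J)) = ru y \<odot> ru x"
    by (simp add: interchange)
  also have "(tw x \<odot> \<iota> (y \<star> J)) \<bullet> (\<iota> x \<odot> iru y) = (\<iota> x \<odot> iru y) \<bullet> (tw x \<odot> \<iota> y)"
    by (simp add: slide)
  also have "e \<bullet> (ru y \<odot> ru x) \<bullet> br (x \<star> J) (y \<star> J) \<bullet> (iru x \<odot> \<iota> (y \<star> J)) \<bullet> ((\<iota> x \<odot> iru y) \<bullet> (tw x \<odot> \<iota> y)) \<bullet> c
     = e \<bullet> ((ru y \<odot> ru x) \<bullet> br (x \<star> J) (y \<star> J)) \<bullet> ((iru x \<odot> \<iota> (y \<star> J)) \<bullet> (\<iota> x \<odot> iru y)) \<bullet> (tw x \<odot> \<iota> y) \<bullet> c"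
    by simp
  also have "(ru y \<odot> ru x) \<bullet> br (x \<star> J) (y \<star> J) = br x y \<bullet> (ru x \<odot> ru y)"
    using br_natural[of "ru x" "ru y"] by simp
  also have "(iru x \<odot> \<iota> (y \<star> J)) \<bullet> (\<iota> x \<odot> iru y) = iru x \<odot> iru y"
    by (simp add: interchange)
  also have "e \<bullet> (br x y \<bullet> (ru x \<odot> ru y)) \<bullet> (iru x \<odot> iru y) \<bullet> (tw x \<odot> \<iota> y) \<bullet> c = e \<bullet> br x y \<bullet> (tw x \<odot> \<iota> y) \<bullet> c"
    using reassoc1[of "ru x \<odot> ru y" "iru x \<odot> iru y" "\<iota> (x \<star> y)" "(tw x \<odot> \<iota> y) \<bullet> c"] by (simp add: interchange)
  finally have *: "(e \<bullet> (\<iota> y \<odot> ru x)) \<bullet> (mu [y] [x] \<bullet> br (x \<star> J) (y \<star> J) \<bullet> imu [x] [y]) \<bullet> (tw x \<odot> \<iota> (y \<star> J)) \<bullet> (\<iota> x \<odot> iru y) \<bullet> c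
    = e \<bullet> br x y \<bullet> (tw x \<odot> \<iota> y) \<bullet> c" .
  show ?thesis
    unfolding strict_ribbon.tev_def[OF strict_ribbon] tws
    using * by (simp add: sev_def scoev_def sbr_def scomp_def del: mu.simps imu.simps)
qed

end

lemma br_br_natural:
  assumes [simp]: "arr f" "arr g"
  shows "br (trg g) (trg f) \<bullet> br (trg f) (trg g) \<bullet> (f \<odot> g) = (f \<odot> g) \<bullet> br (src g) (src f) \<bullet> br (src f) (src g)"
proof -
  have "br (trg g) (trg f) \<bullet> br (trg f) (trg g) \<bullet> (f \<odot> g) = br (trg g) (trg f) \<bullet> (g \<odot> f) \<bullet> br (src f) (src g)"
    by (simp add: br_natural)
  also have "\<dots> = (f \<odot> g) \<bullet> br (src g) (src f) \<bullet> br (src f) (src g)"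
    using reassoc[OF br_natural[of g f], of "br (src f) (src g)"] by simp
  finally show ?thesis .
qed

lemma br_br_iso:
  assumes D: "br z x \<bullet> br x z = \<iota> (x \<star> z)"
    and [simp]: "arr f" "src f = x" "trg f = x'" "arr f'" "src f' = x'" "trg f' = x"
    and [simp]: "arr g" "src g = z" "trg g = z'" "arr g'" "src g' = z'" "trg g' = z"
    and inv: "f \<bullet> f' = \<iota> x'" "g \<bullet> g' = \<iota> z'"
  shows "br z' x' \<bullet> br x' z' = \<iota> (x' \<star> z')"
proof -
  have "br z' x' \<bullet> br x' z' = (br z' x' \<bullet> br x' z' \<bullet> (f \<odot> g)) \<bullet> (f' \<odot> g')"
    by (simp add: interchange inv)
  also have "br z' x' \<bullet> br x' z' \<bullet> (f \<odot> g) = (f \<odot> g) \<bullet> br z x \<bullet> br x z"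
    using br_br_natural[of f g] by simp
  also have "\<dots> \<bullet> (f' \<odot> g') = \<iota> (x' \<star> z')"
    unfolding D by (simp add: interchange inv)
  finally show ?thesis .
qed

text \<open>One side quantifies over words, the other over objects. A word \<open>l\<close> stands
  for the object \<open>TT l\<close>, and \<open>[y]\<close> for an object isomorphic to
  \<open>y\<close>; naturality of the double braiding absorbs the isomorphisms.\<close>

lemma is_transparent_single:
  "strict_ribbon.is_transparent scomp sidt sbr [x] \<longleftrightarrow> (\<forall>y. br y x \<bullet> br x y = \<iota> (x \<star> y))"
proof -
  have "strict_ribbon.is_transparent scomp sidt sbr [x] \<longleftrightarrow> (\<forall>l. br (TT l) (x \<star> J) \<bullet> br (x \<star> J) (TT l) = \<iota> ((x \<star> J) \<star> TT l))"
    (is "_ \<longleftrightarrow> (\<forall>l. ?D l)")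
  proof -
    have "scomp (sbr l [x]) (sbr [x] l) = sidt ([x] @ l) \<longleftrightarrow> ?D l" for l
    proof -
      let ?d = "br (TT l) (x \<star> J) \<bullet> br (x \<star> J) (TT l)"
      have "scomp (sbr l [x]) (sbr [x] l) = sidt ([x] @ l) \<longleftrightarrow> mu [x] l \<bullet> ?d \<bullet> imu [x] l = \<iota> (TT ([x] @ l))"
        by (simp add: sbr_def s_defs del: mu.simps imu.simps)
      also have "\<dots> \<longleftrightarrow> ?d = \<iota> ((x \<star> J) \<star> TT l)"
      proof
        assume *: "mu [x] l \<bullet> ?d \<bullet> imu [x] l = \<iota> (TT ([x] @ l))"
        have "?d = imu [x] l \<bullet> (mu [x] l \<bullet> ?d \<bullet> imu [x] l) \<bullet> mu [x] l" by (simp del: mu.simps imu.simps)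
        also have "\<dots> = \<iota> ((x \<star> J) \<star> TT l)" unfolding * by (simp del: mu.simps imu.simps)
        finally show "?d = \<iota> ((x \<star> J) \<star> TT l)" .
      next
        assume *: "?d = \<iota> ((x \<star> J) \<star> TT l)"
        have "mu [x] l \<bullet> ?d \<bullet> imu [x] l = \<iota> (TT ([x] @ l))"
          unfolding * by (simp del: mu.simps imu.simps)
        then show "mu [x] l \<bullet> ?d \<bullet> imu [x] l = \<iota> (TT ([x] @ l))" .
      qed
      finally show ?thesis .
    qed
    then show ?thesis unfolding strict_ribbon.is_transparent_def[OF strict_ribbon] by simp
  qed
  also have "\<dots> \<longleftrightarrow> (\<forall>y. br y x \<bullet> br x y = \<iota> (x \<star> y))"
  proof (intro iffI allI)
    fix y assume *: "\<forall>l. ?D l"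
    show "br y x \<bullet> br x y = \<iota> (x \<star> y)"
      by (rule br_br_iso[of "y \<star> J" "x \<star> J" "ru x" _ "iru x" "ru y" _ "iru y"]) (use *[rule_format, of "[y]"] in simp_all)
  next
    fix l assume *: "\<forall>y. br y x \<bullet> br x y = \<iota> (x \<star> y)"
    show "?D l"
      by (rule br_br_iso[of "TT l" x "iru x" _ "ru x" "\<iota> (TT l)" _ "\<iota> (TT l)"]) (use *[rule_format, of "TT l"] in simp_all)
  qed
  finally show ?thesis .
qed

end

section \<open>Semisimple linear categories\<close>

context linear_category
begin

lemma zero_in_Hom: "0 \<in> Hom C x y"
  using subspace_Hom by (rule subspace_0)

lemma smult_in_Hom: "f \<in> Hom C x y \<Longrightarrow> smult C a f \<in> Hom C x y"
  using subspace_Hom by (rule subspace_scale)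

lemma add_in_Hom: "f \<in> Hom C x y \<Longrightarrow> g \<in> Hom C x y \<Longrightarrow> f + g \<in> Hom C x y"
  using subspace_Hom by (rule subspace_add)

lemma diff_in_Hom: "f \<in> Hom C x y \<Longrightarrow> g \<in> Hom C x y \<Longrightarrow> f - g \<in> Hom C x y"
  using subspace_Hom by (rule subspace_diff)

lemma compose_zero_left: "f \<in> Hom C x y \<Longrightarrow> 0 \<cdot> f = 0"
  using compose_smult_left[OF zero_in_Hom, where a = 0 and f = f and x = x and y = y] by simp

lemma compose_zero_right: "g \<in> Hom C y z \<Longrightarrow> g \<cdot> 0 = 0"
  using compose_smult_right[OF _ zero_in_Hom, where a = 0 and g = g and z = z and y = y] by simp

lemma compose_diff_right:
  assumes "g \<in> Hom C y z" "f \<in> Hom C x y" "f' \<in> Hom C x y"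
  shows "g \<cdot> (f - f') = g \<cdot> f - g \<cdot> f'"
  using compose_add_right[OF assms(1) diff_in_Hom[OF assms(2,3)] assms(3)] by simp

lemma compose_diff_left:
  assumes "f \<in> Hom C y z" "f' \<in> Hom C y z" "g \<in> Hom C x y"
  shows "(f - f') \<cdot> g = f \<cdot> g - f' \<cdot> g"
  using compose_add_left[OF diff_in_Hom[OF assms(1,2)] assms(2,3)] by simp

lemma inverse_arrows_unique:
  assumes "inverse_arrows C x y f g" "inverse_arrows C x y f h"
  shows "g = h"
proof -
  have "g = g \<cdot> (f \<cdot> h)" using assms ident_right[of g y x] by (simp add: inverse_arrows_def)
  also have "\<dots> = (g \<cdot> f) \<cdot> h" using assms compose_assoc[of g y x f x h y] by (simp add: inverse_arrows_def)
  also have "\<dots> = h" using assms ident_left[of h y x] by (simp add: inverse_arrows_def)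
  finally show ?thesis .
qed

lemma inv_arrow:
  assumes "iso_arrow C x y f"
  shows "inverse_arrows C x y f (inv_arrow C x y f)"
  unfolding inv_arrow_def using assms inverse_arrows_unique unfolding iso_arrow_def by (metis theI)

lemma ident_zero_imp_zero_object:
  assumes "ident C x = 0"
  shows "zero_object C x"
proof -
  have "f = 0" if "f \<in> Hom C x y" for f y
    using ident_right[OF that] compose_zero_right[OF that] assms by simp
  moreover have "f = 0" if "f \<in> Hom C y x" for f y
    using ident_left[OF that] compose_zero_left[OF that] assms by simp
  ultimately show ?thesis using zero_in_Hom unfolding zero_object_def by blast
qed

lemma simple_ident_nonzero: "simple_object C x \<Longrightarrow> ident C x \<noteq> 0"
  using ident_zero_imp_zero_object by (auto simp: simple_object_def)

lemma isomorphic_sym: "isomorphic C x y \<Longrightarrow> isomorphic C y x"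
  unfolding isomorphic_def iso_arrow_def inverse_arrows_def by metis

lemma isomorphic_refl: "isomorphic C x x"
  unfolding isomorphic_def iso_arrow_def inverse_arrows_def using ident_in_Hom ident_left by metis

lemma isomorphic_trans:
  assumes "isomorphic C x y" "isomorphic C y z"
  shows "isomorphic C x z"
proof -
  obtain f f' g g' where f: "f \<in> Hom C x y" "f' \<in> Hom C y x" "f' \<cdot> f = ident C x" "f \<cdot> f' = ident C y"
    and g: "g \<in> Hom C y z" "g' \<in> Hom C z y" "g' \<cdot> g = ident C y" "g \<cdot> g' = ident C z"
    using assms unfolding isomorphic_def iso_arrow_def inverse_arrows_def by metis
  have "(f' \<cdot> g') \<cdot> (g \<cdot> f) = f' \<cdot> ((g' \<cdot> g) \<cdot> f)"
    using compose_assoc[OF f(2) g(2) compose_in_Hom[OF g(1) f(1)]] compose_assoc[OF g(2) g(1) f(1)] by simp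
  then have 1: "(f' \<cdot> g') \<cdot> (g \<cdot> f) = ident C x" using f g ident_left by simp
  have "(g \<cdot> f) \<cdot> (f' \<cdot> g') = g \<cdot> ((f \<cdot> f') \<cdot> g')"
    using compose_assoc[OF g(1) f(1) compose_in_Hom[OF f(2) g(2)]] compose_assoc[OF f(1) f(2) g(2)] by simp
  then have 2: "(g \<cdot> f) \<cdot> (f' \<cdot> g') = ident C z" using f g ident_left by simp
  show ?thesis
    unfolding isomorphic_def iso_arrow_def inverse_arrows_def using 1 2 f g compose_in_Hom by metis
qed

text \<open>Horner evaluation of a polynomial at \<open>f\<close>. It is written out because
  composition has ring laws only on \<open>Hom C x x\<close>.\<close>

definition poly_End :: "'o \<Rightarrow> 'm \<Rightarrow> 'k poly \<Rightarrow> 'm" where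
  "poly_End x f p = fold_coeffs (\<lambda>c g. smult C c (ident C x) + f \<cdot> g) p 0"

context
  fixes x f assumes f: "f \<in> Hom C x x"
begin

lemma poly_End_0: "poly_End x f 0 = 0"
  by (simp add: poly_End_def)

lemma poly_End_pCons: "poly_End x f (pCons c p) = smult C c (ident C x) + f \<cdot> poly_End x f p"
  by (cases "c = 0 \<and> p = 0") (auto simp: poly_End_def compose_zero_right[OF f])

lemma poly_End_in_Hom: "poly_End x f p \<in> Hom C x x"
  by (induction p) (auto simp: poly_End_0 poly_End_pCons zero_in_Hom intro!: add_in_Hom smult_in_Hom ident_in_Hom compose_in_Hom[OF f])

lemma poly_End_add: "poly_End x f (p + q) = poly_End x f p + poly_End x f q"
  by (induction p q rule: poly_induct2)
    (simp_all add: poly_End_0 poly_End_pCons compose_add_right[OF f poly_End_in_Hom poly_End_in_Hom] scale_left_distrib algebra_simps)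

lemma poly_End_smult: "poly_End x f (Polynomial.smult c p) = smult C c (poly_End x f p)"
  by (induction p) (simp_all add: poly_End_0 poly_End_pCons scale_right_distrib compose_smult_right[OF f poly_End_in_Hom])

lemma poly_End_sum: "poly_End x f (\<Sum>i\<in>A. p i) = (\<Sum>i\<in>A. poly_End x f (p i))"
  by (induction A rule: infinite_finite_induct) (simp_all add: poly_End_0 poly_End_add)

lemma poly_End_linear_factor:
  "poly_End x f ([:- a, 1:] * q) = (f - smult C a (ident C x)) \<cdot> poly_End x f q"
proof -
  have *: "[:- a, 1:] * q = pCons 0 q + Polynomial.smult (- a) q" by simp
  show ?thesis
    unfolding * poly_End_add poly_End_smult poly_End_pCons
    using compose_diff_left[OF f smult_in_Hom[OF ident_in_Hom] poly_End_in_Hom, of a q]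
      compose_smult_left[OF ident_in_Hom poly_End_in_Hom, of a q] ident_left[OF poly_End_in_Hom, of q]
    by simp
qed

text \<open>The powers of \<open>f\<close> up to the size of a spanning set are linearly
  dependent.\<close>

lemma ex_annihilating_poly:
  assumes B: "finite B" "Hom C x x \<subseteq> span B"
  shows "\<exists>p. p \<noteq> 0 \<and> poly_End x f p = 0"
proof -
  define w where "w i = poly_End x f (monom 1 i)" for i :: nat
  have p: "poly_End x f (monom c i) = smult C c (w i)" for c i
    unfolding w_def by (simp flip: poly_End_smult add: smult_monom)
  show ?thesis
  \<comment> \<open>Linear dependence speaks about sets of vectors, so coinciding powers are treated
    apart; there a difference of two monomials annihilates \<open>f\<close>.\<close>
  proof (cases "inj_on w {..card B}")
    case False
    then obtain i j where ij: "i \<noteq> j" "w i = w j" by (auto simp: inj_on_def)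
    have "poly_End x f (monom 1 i + monom (-1) j) = 0"
      using ij by (simp add: poly_End_add p)
    moreover have "coeff (monom 1 i + monom (-1) j) i \<noteq> (0 :: 'k)" using ij by simp
    ultimately show ?thesis by (metis coeff_0)
  next
    case True
    have "dependent (w ` {..card B})"
    proof (rule ccontr)
      assume "\<not> ?thesis"
      moreover have "w ` {..card B} \<subseteq> span B" using B(2) poly_End_in_Hom by (auto simp: w_def)
      ultimately have "card (w ` {..card B}) \<le> card B" using independent_span_bound[OF B(1)] by blast
      then show False using card_image[OF True] by simp
    qed
    then obtain t v where t: "finite t" "t \<subseteq> w ` {..card B}" "(\<Sum>a\<in>t. smult C (v a) a) = 0" "\<exists>a\<in>t. v a \<noteq> 0"
      unfolding dependent_explicit by blast
    then obtain t' where t': "t' \<subseteq> {..card B}" "t = w ` t'" by (meson subset_imageE)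
    have inj: "inj_on w t'" using True t'(1) by (rule inj_on_subset)
    have fin: "finite t'" using t'(1) by (rule finite_subset) simp
    define q where "q = (\<Sum>i\<in>t'. monom (v (w i)) i)"
    have "poly_End x f q = (\<Sum>i\<in>t'. smult C (v (w i)) (w i))"
      by (simp add: q_def poly_End_sum p)
    also have "\<dots> = 0" using t(3) sum.reindex[OF inj, of "\<lambda>a. smult C (v a) a"] by (simp add: t'(2))
    finally have "poly_End x f q = 0" .
    moreover obtain i where i: "i \<in> t'" "v (w i) \<noteq> 0" using t(4) t'(2) by auto
    have "coeff q i = v (w i)" using i(1) fin by (simp add: q_def coeff_sum)
    then have "q \<noteq> 0" using i(2) by auto
    ultimately show ?thesis by blast
  qed
qed

end

end

section \<open>Schur's lemma and scalar endomorphisms\<close>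

context abelian_linear_category
begin

text \<open>Simplicity is expressed through monomorphisms. The kernel of \<open>f\<close> is not all
  of \<open>x\<close>, so it is zero and \<open>f\<close> is mono; simplicity of \<open>y\<close>
  then makes \<open>f\<close> invertible.\<close>

lemma schur_iso:
  assumes x: "simple_object C x" and y: "simple_object C y" and f: "f \<in> Hom C x y" "f \<noteq> 0"
  shows "iso_arrow C x y f"
proof -
  obtain k i where k: "is_kernel C x y f k i" using has_kernels[OF f(1)] by blast
  then have i: "i \<in> Hom C k x" "f \<cdot> i = 0" by (auto simp: is_kernel_def)
  have uniq: "\<exists>!h. h \<in> Hom C w k \<and> i \<cdot> h = g" if "g \<in> Hom C w x" "f \<cdot> g = 0" for w g
    using k that by (auto simp: is_kernel_def)
  have mono_i: "mono_arrow C k x i"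
    unfolding mono_arrow_def
  proof (intro conjI allI ballI impI i)
    fix w g h assume g: "g \<in> Hom C w k" and h: "h \<in> Hom C w k" and eq: "i \<cdot> g = i \<cdot> h"
    have "f \<cdot> i \<cdot> g = 0" using compose_assoc[OF f(1) i(1) g] i(2) compose_zero_left[OF g] by simp
    from uniq[OF compose_in_Hom[OF i(1) g] this] show "g = h" using g h eq by metis
  qed
  have "\<not> iso_arrow C k x i"
  proof
    assume "iso_arrow C k x i"
    then obtain j where j: "j \<in> Hom C x k" "i \<cdot> j = ident C x" by (auto simp: iso_arrow_def inverse_arrows_def)
    have "f = (f \<cdot> i) \<cdot> j" using compose_assoc[OF f(1) i(1) j(1)] j(2) ident_right[OF f(1)] by simp
    then show False using i(2) f(2) compose_zero_left[OF j(1)] by simp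
  qed
  then have k0: "zero_object C k" using x mono_i by (auto simp: simple_object_def)
  have "mono_arrow C x y f"
    unfolding mono_arrow_def
  proof (intro conjI allI ballI impI f)
    fix w g h assume g: "g \<in> Hom C w x" and h: "h \<in> Hom C w x" and eq: "f \<cdot> g = f \<cdot> h"
    have gh: "g - h \<in> Hom C w x" using g h by (rule diff_in_Hom)
    have "f \<cdot> (g - h) = 0" using compose_diff_right[OF f(1) g h] eq by simp
    from uniq[OF gh this] obtain m where m: "m \<in> Hom C w k" "i \<cdot> m = g - h" by blast
    then have "m = 0" using k0 by (auto simp: zero_object_def)
    then show "g = h" using m compose_zero_right[OF i(1)] by simp
  qed
  then show ?thesis using x y by (auto simp: simple_object_def)
qed

end

context finite_semisimple_category
begin

text \<open>Linear factors of an annihilating polynomial are removed one at a time. For a root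
  \<open>a\<close>, either \<open>f\<close> minus the scalar \<open>a\<close> is zero, or it is
  invertible by Schur's lemma and the factor cancels.\<close>

lemma End_simple_scalar:
  assumes root: "\<And>p :: 'k poly. degree p > 0 \<Longrightarrow> \<exists>a. poly p a = 0"
    and x: "simple_object C x" and f: "f \<in> Hom C x x"
  shows "\<exists>a. f = smult C a (ident C x)"
proof -
  have main: "poly_End x f p = 0 \<Longrightarrow> p \<noteq> 0 \<Longrightarrow> \<exists>a. f = smult C a (ident C x)" for p
  proof (induction "degree p" arbitrary: p rule: less_induct)
    case less
    show ?case
    proof (cases "degree p = 0")
      case True
      then obtain c where c: "p = [:c:]" by (metis degree_eq_zeroE)
      then have "smult C c (ident C x) = 0"
        using less.prems(1) by (simp add: poly_End_pCons[OF f] poly_End_0[OF f] compose_zero_right[OF f])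
      then show ?thesis using c less.prems(2) simple_ident_nonzero[OF x] by simp
    next
      case False
      then obtain a where "poly p a = 0" using root by blast
      then obtain q where q: "p = [:- a, 1:] * q" by (auto simp: poly_eq_0_iff_dvd dvd_def)
      have q0: "q \<noteq> 0" using q less.prems(2) by auto
      let ?g = "f - smult C a (ident C x)"
      have g: "?g \<in> Hom C x x" by (intro diff_in_Hom f smult_in_Hom ident_in_Hom)
      have gq: "?g \<cdot> poly_End x f q = 0" using less.prems(1) poly_End_linear_factor[OF f] q by simp
      show ?thesis
      proof (cases "?g = 0")
        case True
        then show ?thesis by auto
      next
        case False
        then have "iso_arrow C x x ?g" using schur_iso[OF x x g] by simp
        then obtain h where h: "h \<in> Hom C x x" "h \<cdot> ?g = ident C x"
          by (auto simp: iso_arrow_def inverse_arrows_def)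
        have "poly_End x f q = h \<cdot> ?g \<cdot> poly_End x f q"
          using compose_assoc[OF h(1) g poly_End_in_Hom[OF f]] h(2) ident_left[OF poly_End_in_Hom[OF f]] by simp
        then have "poly_End x f q = 0" using gq compose_zero_right[OF h(1)] by simp
        moreover have "degree q < degree p" unfolding q using q0 by (subst degree_mult_eq) auto
        ultimately show ?thesis using less.hyps q0 by blast
      qed
    qed
  qed
  then show ?thesis using ex_annihilating_poly[OF f] Hom_finite_dimensional[of x x] by metis
qed

lemma finite_Irr:
  assumes "is_Irr C R"
  shows "finite R"
proof -
  obtain F where F: "finite F" "\<forall>x. simple_object C x \<longrightarrow> (\<exists>y\<in>F. isomorphic C x y)"
    using finitely_many_simples by blast
  then obtain g where g: "\<And>x. x \<in> R \<Longrightarrow> g x \<in> F \<and> isomorphic C x (g x)"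
    using assms unfolding is_Irr_def by metis
  have "inj_on g R"
  proof (rule inj_onI)
    fix x y assume xy: "x \<in> R" "y \<in> R" "g x = g y"
    then have "isomorphic C x y" using g[OF xy(1)] g[OF xy(2)] isomorphic_sym isomorphic_trans by metis
    then show "x = y" using assms xy isomorphic_refl unfolding is_Irr_def by metis
  qed
  then show ?thesis using g F(1) by (meson finite_subset finite_image_iff image_subsetI)
qed

text \<open>Semisimplicity yields arbitrary simple summands; conjugating with isomorphisms replaces
  them by representatives.\<close>

lemma Irr_decomposition:
  assumes R: "is_Irr C R"
  shows "\<exists>(n::nat) r e p. (\<forall>j<n. r j \<in> R \<and> e j \<in> Hom C (r j) x \<and> p j \<in> Hom C x (r j)) \<and>
     (\<forall>j<n. \<forall>l<n. p j \<cdot> e l = (if j = l then ident C (r j) else 0)) \<and> (\<Sum>j<n. e j \<cdot> p j) = ident C x"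
proof -
  obtain n and S :: "nat \<Rightarrow> 'o" where S: "\<And>j. j < n \<Longrightarrow> simple_object C (S j)" and "is_direct_sum C x n S"
    using semisimple[of x] by metis
  then obtain i p where *: "(\<forall>j<n. i j \<in> Hom C (S j) x \<and> p j \<in> Hom C x (S j)) \<and>
     (\<forall>j<n. \<forall>l<n. p j \<cdot> i l = (if j = l then ident C (S j) else 0)) \<and> (\<Sum>j<n. i j \<cdot> p j) = ident C x"
    unfolding is_direct_sum_def by (elim exE)
  then have ip: "\<And>j. j < n \<Longrightarrow> i j \<in> Hom C (S j) x" "\<And>j. j < n \<Longrightarrow> p j \<in> Hom C x (S j)"
    and orth: "\<And>j l. j < n \<Longrightarrow> l < n \<Longrightarrow> p j \<cdot> i l = (if j = l then ident C (S j) else 0)"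
    and compl: "(\<Sum>j<n. i j \<cdot> p j) = ident C x"
    by auto
  have "\<forall>j<n. \<exists>y f g. y \<in> R \<and> inverse_arrows C (S j) y f g"
    using S R unfolding is_Irr_def isomorphic_def iso_arrow_def by metis
  then obtain r f g where r: "\<And>j. j < n \<Longrightarrow> r j \<in> R" and fg: "\<And>j. j < n \<Longrightarrow> inverse_arrows C (S j) (r j) (f j) (g j)"
    by metis
  have f: "f j \<in> Hom C (S j) (r j)" "g j \<in> Hom C (r j) (S j)" "g j \<cdot> f j = ident C (S j)" "f j \<cdot> g j = ident C (r j)"
    if "j < n" for j
    using fg[OF that] by (auto simp: inverse_arrows_def)
  have 1: "(f j \<cdot> p j) \<cdot> (i l \<cdot> g l) = (if j = l then ident C (r j) else 0)" if "j < n" "l < n" for j l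
  proof -
    have "(f j \<cdot> p j) \<cdot> (i l \<cdot> g l) = f j \<cdot> ((p j \<cdot> i l) \<cdot> g l)"
      using compose_assoc[OF f(1)[OF that(1)] ip(2)[OF that(1)] compose_in_Hom[OF ip(1)[OF that(2)] f(2)[OF that(2)]]]
        compose_assoc[OF ip(2)[OF that(1)] ip(1)[OF that(2)] f(2)[OF that(2)]] by simp
    then show ?thesis
      using that f[OF that(1)] f[OF that(2)] orth[OF that] ident_left compose_zero_left compose_zero_right by simp
  qed
  have 2: "(i j \<cdot> g j) \<cdot> (f j \<cdot> p j) = i j \<cdot> p j" if "j < n" for j
  proof -
    have "(i j \<cdot> g j) \<cdot> (f j \<cdot> p j) = i j \<cdot> ((g j \<cdot> f j) \<cdot> p j)"
      using compose_assoc[OF ip(1)[OF that] f(2)[OF that] compose_in_Hom[OF f(1)[OF that] ip(2)[OF that]]]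
        compose_assoc[OF f(2)[OF that] f(1)[OF that] ip(2)[OF that]] by simp
    then show ?thesis using f[OF that] ip(2)[OF that] ident_left by simp
  qed
  have 3: "(\<Sum>j<n. (i j \<cdot> g j) \<cdot> (f j \<cdot> p j)) = ident C x"
    using compl 2 by simp
  have 4: "\<forall>j<n. r j \<in> R \<and> i j \<cdot> g j \<in> Hom C (r j) x \<and> f j \<cdot> p j \<in> Hom C x (r j)"
    using r ip f compose_in_Hom by blast
  show ?thesis
    using 1 3 4
    by (intro exI[of _ n] exI[of _ r] exI[of _ "\<lambda>j. i j \<cdot> g j"] exI[of _ "\<lambda>j. f j \<cdot> p j"]) simp
qed

end

section \<open>The strictification of a ribbon fusion category\<close>

context rigid_linear_monoidal_category
begin

text \<open>The scalar comes out in front and the rest is a zigzag. With \<open>twist_dual\<close>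
  it shows that a simple object and its dual have the same twist scalar.\<close>

lemma dual_arrow_scalar:
  "dual_arrow C x x (smult C t (ident C x)) = smult C t (ident C (dual C x))"
proof -
  let ?y = "dual C x" and ?i = "ident C (dual C x)"
  let ?ri = "inv_arrow C (?y \<otimes> I) ?y (runit C ?y)"
  have ev: "ev C x \<in> Hom C (?y \<otimes> x) I" and coev: "coev C x \<in> Hom C I (x \<otimes> ?y)"
    and z: "lunit C ?y \<cdot> (ev C x \<otimes>\<^sub>m ?i) \<cdot> assoc_inv C ?y x ?y \<cdot> (?i \<otimes>\<^sub>m coev C x) = runit C ?y"
    using left_dual[of x] by (auto simp: left_duality_def)
  have ri: "?ri \<in> Hom C ?y (?y \<otimes> I)" "runit C ?y \<cdot> ?ri = ?i"
    using inv_arrow[OF runit_iso[of ?y]] by (auto simp: inverse_arrows_def)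
  have l: "lunit C ?y \<in> Hom C (I \<otimes> ?y) ?y"
    using lunit_iso[of ?y] by (auto simp: iso_arrow_def inverse_arrows_def)
  have ai: "assoc_inv C ?y x ?y \<in> Hom C (?y \<otimes> (x \<otimes> ?y)) ((?y \<otimes> x) \<otimes> ?y)"
    unfolding assoc_inv_def using inv_arrow[OF assoc_iso] by (auto simp: inverse_arrows_def)
  have e1: "ev C x \<otimes>\<^sub>m ?i \<in> Hom C ((?y \<otimes> x) \<otimes> ?y) (I \<otimes> ?y)" by (rule tensor_in_Hom[OF ev ident_in_Hom])
  have c1: "?i \<otimes>\<^sub>m coev C x \<in> Hom C (?y \<otimes> I) (?y \<otimes> (x \<otimes> ?y))" by (rule tensor_in_Hom[OF ident_in_Hom coev])
  note t1 = compose_in_Hom[OF c1 ri(1)]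
  note t2 = compose_in_Hom[OF ai t1]
  note t3 = compose_in_Hom[OF e1 t2]
  have "(?i \<otimes>\<^sub>m smult C t (ident C x)) \<otimes>\<^sub>m ?i = smult C t (ident C ((?y \<otimes> x) \<otimes> ?y))"
    using tensor_smult_right[OF ident_in_Hom[of ?y] ident_in_Hom[of x], of t]
      tensor_smult_left[OF ident_in_Hom[of "?y \<otimes> x"] ident_in_Hom[of ?y], of t] by (simp add: tensor_ident)
  then have "dual_arrow C x x (smult C t (ident C x)) =
      lunit C ?y \<cdot> (ev C x \<otimes>\<^sub>m ?i) \<cdot> smult C t (ident C ((?y \<otimes> x) \<otimes> ?y)) \<cdot> assoc_inv C ?y x ?y \<cdot> (?i \<otimes>\<^sub>m coev C x) \<cdot> ?ri"
    by (simp add: dual_arrow_def)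
  also have "smult C t (ident C ((?y \<otimes> x) \<otimes> ?y)) \<cdot> assoc_inv C ?y x ?y \<cdot> (?i \<otimes>\<^sub>m coev C x) \<cdot> ?ri
      = smult C t (assoc_inv C ?y x ?y \<cdot> (?i \<otimes>\<^sub>m coev C x) \<cdot> ?ri)"
    using compose_smult_left[OF ident_in_Hom t2] ident_left[OF t2] by simp
  also have "lunit C ?y \<cdot> (ev C x \<otimes>\<^sub>m ?i) \<cdot> \<dots> = smult C t (lunit C ?y \<cdot> (ev C x \<otimes>\<^sub>m ?i) \<cdot> assoc_inv C ?y x ?y \<cdot> (?i \<otimes>\<^sub>m coev C x) \<cdot> ?ri)"
    using compose_smult_right[OF e1 t2] compose_smult_right[OF l t3] by simp
  also have "lunit C ?y \<cdot> (ev C x \<otimes>\<^sub>m ?i) \<cdot> assoc_inv C ?y x ?y \<cdot> (?i \<otimes>\<^sub>m coev C x) \<cdot> ?ri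
      = (lunit C ?y \<cdot> (ev C x \<otimes>\<^sub>m ?i) \<cdot> assoc_inv C ?y x ?y \<cdot> (?i \<otimes>\<^sub>m coev C x)) \<cdot> ?ri"
    using compose_assoc[OF ai c1 ri(1)] compose_assoc[OF e1 compose_in_Hom[OF ai c1] ri(1)]
      compose_assoc[OF l compose_in_Hom[OF e1 compose_in_Hom[OF ai c1]] ri(1)] by simp
  also have "\<dots> = ?i" unfolding z by (rule ri(2))
  finally show ?thesis .
qed

end

context ribbon_fusion_category
begin

text \<open>Hom-spaces share vectors, so an arrow is recorded as a triple with its source and
  target.\<close>

definition carr :: "'o \<times> 'm \<times> 'o \<Rightarrow> bool" where "carr f \<longleftrightarrow> fst (snd f) \<in> Hom C (fst f) (snd (snd f))"
definition csrc :: "'o \<times> 'm \<times> 'o \<Rightarrow> 'o" where "csrc f = fst f"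
definition ctrg :: "'o \<times> 'm \<times> 'o \<Rightarrow> 'o" where "ctrg f = snd (snd f)"
definition ccomp :: "'o \<times> 'm \<times> 'o \<Rightarrow> 'o \<times> 'm \<times> 'o \<Rightarrow> 'o \<times> 'm \<times> 'o" where
  "ccomp g f = (fst f, fst (snd g) \<cdot> fst (snd f), snd (snd g))"
definition ctens :: "'o \<times> 'm \<times> 'o \<Rightarrow> 'o \<times> 'm \<times> 'o \<Rightarrow> 'o \<times> 'm \<times> 'o" where
  "ctens f g = (fst f \<otimes> fst g, fst (snd f) \<otimes>\<^sub>m fst (snd g), snd (snd f) \<otimes> snd (snd g))"
definition cidt :: "'o \<Rightarrow> 'o \<times> 'm \<times> 'o" where "cidt x = (x, ident C x, x)"
definition cas :: "'o \<Rightarrow> 'o \<Rightarrow> 'o \<Rightarrow> 'o \<times> 'm \<times> 'o" where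
  "cas x y z = ((x \<otimes> y) \<otimes> z, assoc C x y z, x \<otimes> y \<otimes> z)"
definition cias :: "'o \<Rightarrow> 'o \<Rightarrow> 'o \<Rightarrow> 'o \<times> 'm \<times> 'o" where
  "cias x y z = (x \<otimes> y \<otimes> z, assoc_inv C x y z, (x \<otimes> y) \<otimes> z)"
definition clu :: "'o \<Rightarrow> 'o \<times> 'm \<times> 'o" where "clu x = (I \<otimes> x, lunit C x, x)"
definition cilu :: "'o \<Rightarrow> 'o \<times> 'm \<times> 'o" where "cilu x = (x, inv_arrow C (I \<otimes> x) x (lunit C x), I \<otimes> x)"
definition cru :: "'o \<Rightarrow> 'o \<times> 'm \<times> 'o" where "cru x = (x \<otimes> I, runit C x, x)"
definition ciru :: "'o \<Rightarrow> 'o \<times> 'm \<times> 'o" where "ciru x = (x, inv_arrow C (x \<otimes> I) x (runit C x), x \<otimes> I)"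
definition cbr :: "'o \<Rightarrow> 'o \<Rightarrow> 'o \<times> 'm \<times> 'o" where "cbr x y = (x \<otimes> y, braid C x y, y \<otimes> x)"
definition cibr :: "'o \<Rightarrow> 'o \<Rightarrow> 'o \<times> 'm \<times> 'o" where
  "cibr x y = (y \<otimes> x, inv_arrow C (x \<otimes> y) (y \<otimes> x) (braid C x y), x \<otimes> y)"
definition ctw :: "'o \<Rightarrow> 'o \<times> 'm \<times> 'o" where "ctw x = (x, twist C x, x)"

lemmas c_defs = carr_def csrc_def ctrg_def ccomp_def ctens_def cidt_def cas_def cias_def clu_def cilu_def cru_def
  ciru_def cbr_def cibr_def ctw_def

lemma iso_Homs:
  "assoc C x y z \<in> Hom C ((x \<otimes> y) \<otimes> z) (x \<otimes> y \<otimes> z)" "assoc_inv C x y z \<in> Hom C (x \<otimes> y \<otimes> z) ((x \<otimes> y) \<otimes> z)"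
  "assoc_inv C x y z \<cdot> assoc C x y z = ident C ((x \<otimes> y) \<otimes> z)" "assoc C x y z \<cdot> assoc_inv C x y z = ident C (x \<otimes> y \<otimes> z)"
  "lunit C x \<in> Hom C (I \<otimes> x) x" "inv_arrow C (I \<otimes> x) x (lunit C x) \<in> Hom C x (I \<otimes> x)"
  "inv_arrow C (I \<otimes> x) x (lunit C x) \<cdot> lunit C x = ident C (I \<otimes> x)" "lunit C x \<cdot> inv_arrow C (I \<otimes> x) x (lunit C x) = ident C x"
  "runit C x \<in> Hom C (x \<otimes> I) x" "inv_arrow C (x \<otimes> I) x (runit C x) \<in> Hom C x (x \<otimes> I)"
  "inv_arrow C (x \<otimes> I) x (runit C x) \<cdot> runit C x = ident C (x \<otimes> I)" "runit C x \<cdot> inv_arrow C (x \<otimes> I) x (runit C x) = ident C x"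
  "braid C x y \<in> Hom C (x \<otimes> y) (y \<otimes> x)" "inv_arrow C (x \<otimes> y) (y \<otimes> x) (braid C x y) \<in> Hom C (y \<otimes> x) (x \<otimes> y)"
  "inv_arrow C (x \<otimes> y) (y \<otimes> x) (braid C x y) \<cdot> braid C x y = ident C (x \<otimes> y)"
  "braid C x y \<cdot> inv_arrow C (x \<otimes> y) (y \<otimes> x) (braid C x y) = ident C (y \<otimes> x)"
  "twist C x \<in> Hom C x x"
  using inv_arrow[OF assoc_iso[of x y z], folded assoc_inv_def] inv_arrow[OF lunit_iso[of x]] inv_arrow[OF runit_iso[of x]]
    inv_arrow[OF braid_iso[of x y]] inv_arrow[OF twist_iso[of x]]
  unfolding inverse_arrows_def by auto

sublocale typed: typed_ribbon carr csrc ctrg ccomp ctens cidt "tensor C" "unit_object C" cas cias clu cilu cru ciru cbr cibr ctw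
proof (unfold_locales, goal_cases)
qed (auto simp: c_defs iso_Homs ident_in_Hom ident_left ident_right tensor_ident assoc_natural lunit_natural
  runit_natural pentagon triangle braid_natural hexagon hexagon_inv twist_natural twist_tensor
  compose_assoc intro: compose_in_Hom tensor_in_Hom tensor_compose[symmetric])

abbreviation ri :: "'o \<Rightarrow> 'm" where "ri x \<equiv> inv_arrow C (x \<otimes> I) x (runit C x)"

section \<open>Arrows of the strict model as typed vectors\<close>

definition smk :: "'o list \<Rightarrow> 'o list \<Rightarrow> 'm \<Rightarrow> 'o list \<times> ('o \<times> 'm \<times> 'o) \<times> 'o list" where
  "smk l m v = (l, (typed.TT l, v, typed.TT m), m)"
definition svec :: "'o list \<times> ('o \<times> 'm \<times> 'o) \<times> 'o list \<Rightarrow> 'm" where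
  "svec = (\<lambda>(l, (x, v, y), m). v)"
definition cvec :: "'o \<times> 'm \<times> 'o \<Rightarrow> 'm" where "cvec f = fst (snd f)"

lemma smk_simps:
  "svec (smk l m v) = v" "typed.ssrc (smk l m v) = l" "typed.strg (smk l m v) = m"
  "typed.sarr (smk l m v) \<longleftrightarrow> v \<in> Hom C (typed.TT l) (typed.TT m)"
  "typed.scomp (smk m' n w) (smk l m v) = smk l n (w \<cdot> v)"
  "typed.sidt l = smk l l (ident C (typed.TT l))"
  "typed.stw l = smk l l (twist C (typed.TT l))"
  by (auto simp: smk_def svec_def typed.s_defs typed.stw_def c_defs)

lemma smk_svec: "typed.sarr F \<Longrightarrow> smk (typed.ssrc F) (typed.strg F) (svec F) = F"
  by (auto simp: smk_def svec_def typed.s_defs c_defs)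

lemma sarr_smk:
  assumes "typed.sarr F"
  obtains v where "F = smk (typed.ssrc F) (typed.strg F) v" "v \<in> Hom C (typed.TT (typed.ssrc F)) (typed.TT (typed.strg F))"
  using smk_svec[OF assms] assms smk_simps(4) by metis

lemma mu_cvec:
  "cvec (typed.mu l m) \<in> Hom C (typed.TT l \<otimes> typed.TT m) (typed.TT (l @ m))"
  "cvec (typed.imu l m) \<in> Hom C (typed.TT (l @ m)) (typed.TT l \<otimes> typed.TT m)"
  using typed.arr_mu[of l m] typed.arr_imu[of l m] by (auto simp: cvec_def c_defs)

lemma stens_smk:
  "typed.stens (smk l m v) (smk l' m' w)
    = smk (l @ l') (m @ m') (cvec (typed.mu m m') \<cdot> (v \<otimes>\<^sub>m w) \<cdot> cvec (typed.imu l l'))"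
proof -
  have mu: "typed.mu m m' = (typed.TT m \<otimes> typed.TT m', cvec (typed.mu m m'), typed.TT (m @ m'))"
    using typed.arr_mu[of m m'] by (simp add: cvec_def c_defs prod_eq_iff)
  have imu: "typed.imu l l' = (typed.TT (l @ l'), cvec (typed.imu l l'), typed.TT l \<otimes> typed.TT l')"
    using typed.arr_imu[of l l'] by (simp add: cvec_def c_defs prod_eq_iff)
  have "ccomp (typed.mu m m') (ccomp (ctens (typed.TT l, v, typed.TT m) (typed.TT l', w, typed.TT m')) (typed.imu l l'))
      = (typed.TT (l @ l'), cvec (typed.mu m m') \<cdot> (v \<otimes>\<^sub>m w) \<cdot> cvec (typed.imu l l'), typed.TT (m @ m'))"
    using mu imu by (simp add: ccomp_def ctens_def prod_eq_iff cvec_def)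
  then show ?thesis by (simp add: typed.stens_def smk_def)
qed

lemma svec_stens:
  assumes "v \<in> Hom C (typed.TT l) (typed.TT m)" "w \<in> Hom C (typed.TT l') (typed.TT m')"
  shows "v' \<in> Hom C (typed.TT l) (typed.TT m) \<Longrightarrow>
      svec (typed.stens (smk l m (v + v')) (smk l' m' w)) = svec (typed.stens (smk l m v) (smk l' m' w)) + svec (typed.stens (smk l m v') (smk l' m' w))"
    "svec (typed.stens (smk l m (smult C a v)) (smk l' m' w)) = smult C a (svec (typed.stens (smk l m v) (smk l' m' w)))"
    "svec (typed.stens (smk l m v) (smk l' m' (smult C a w))) = smult C a (svec (typed.stens (smk l m v) (smk l' m' w)))"
proof -
  note vw = tensor_in_Hom[OF assms]
  note vwi = compose_in_Hom[OF vw mu_cvec(2)]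
  show "svec (typed.stens (smk l m (smult C a v)) (smk l' m' w)) = smult C a (svec (typed.stens (smk l m v) (smk l' m' w)))"
    by (simp add: stens_smk smk_simps tensor_smult_left[OF assms] compose_smult_left[OF vw mu_cvec(2)]
      compose_smult_right[OF mu_cvec(1) vwi])
  show "svec (typed.stens (smk l m v) (smk l' m' (smult C a w))) = smult C a (svec (typed.stens (smk l m v) (smk l' m' w)))"
    by (simp add: stens_smk smk_simps tensor_smult_right[OF assms] compose_smult_left[OF vw mu_cvec(2)]
      compose_smult_right[OF mu_cvec(1) vwi])
  assume v': "v' \<in> Hom C (typed.TT l) (typed.TT m)"
  note vw' = tensor_in_Hom[OF v' assms(2)]
  show "svec (typed.stens (smk l m (v + v')) (smk l' m' w)) = svec (typed.stens (smk l m v) (smk l' m' w)) + svec (typed.stens (smk l m v') (smk l' m' w))"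
    by (simp add: stens_smk smk_simps tensor_add_left[OF assms(1) v' assms(2)] compose_add_left[OF vw vw' mu_cvec(2)]
      compose_add_right[OF mu_cvec(1) vwi compose_in_Hom[OF vw' mu_cvec(2)]])
qed

lemma ri_Hom: "runit C x \<in> Hom C (x \<otimes> I) x" "ri x \<in> Hom C x (x \<otimes> I)"
  "ri x \<cdot> runit C x = ident C (x \<otimes> I)" "runit C x \<cdot> ri x = ident C x"
  using iso_Homs by auto

text \<open>Since \<open>[x]\<close> stands for \<open>x \<otimes> I\<close>, conjugation with right
  unitors passes between arrows of one-letter words and arrows of \<open>C\<close>.\<close>

lemma conj_runit:
  assumes v: "v \<in> Hom C (x \<otimes> I) (y \<otimes> I)"
  shows "runit C y \<cdot> v \<cdot> ri x \<in> Hom C x y" "v = ri y \<cdot> (runit C y \<cdot> v \<cdot> ri x) \<cdot> runit C x"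
proof -
  note vr = compose_in_Hom[OF v ri_Hom(2)]
  note rvr = compose_in_Hom[OF ri_Hom(1) vr]
  show "runit C y \<cdot> v \<cdot> ri x \<in> Hom C x y" by (rule rvr)
  have "(runit C y \<cdot> v \<cdot> ri x) \<cdot> runit C x = runit C y \<cdot> v"
    using compose_assoc[OF ri_Hom(1) vr ri_Hom(1)] compose_assoc[OF v ri_Hom(2) ri_Hom(1)] ri_Hom(3) ident_right[OF v] by simp
  then show "v = ri y \<cdot> (runit C y \<cdot> v \<cdot> ri x) \<cdot> runit C x"
    using compose_assoc[OF ri_Hom(2) ri_Hom(1) v] ri_Hom(3) ident_left[OF v] by simp
qed

lemma conj_runit_scalar:
  assumes v: "v \<in> Hom C (x \<otimes> I) (x \<otimes> I)" and a: "runit C x \<cdot> v \<cdot> ri x = smult C a (ident C x)"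
  shows "v = smult C a (ident C (x \<otimes> I))"
proof -
  have "v = ri x \<cdot> smult C a (ident C x) \<cdot> runit C x" using conj_runit(2)[OF v] a by simp
  then show ?thesis
    using compose_smult_left[OF ident_in_Hom ri_Hom(1)] ident_left[OF ri_Hom(1)] compose_smult_right[OF ri_Hom(2) ri_Hom(1)] ri_Hom(3)
    by simp
qed

lemma twist_scalar_runit:
  "twist C (x \<otimes> I) = smult C t (ident C (x \<otimes> I)) \<longleftrightarrow> twist C x = smult C t (ident C x)"
proof -
  have "runit C x \<cdot> twist C (x \<otimes> I) \<cdot> ri x = twist C x \<cdot> runit C x \<cdot> ri x"
    using compose_assoc[OF ri_Hom(1) iso_Homs(17) ri_Hom(2), of x] compose_assoc[OF iso_Homs(17) ri_Hom(1) ri_Hom(2), of x]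
      twist_natural[OF ri_Hom(1)[of x]] by metis
  also have "\<dots> = twist C x" using ri_Hom(4) ident_right[OF iso_Homs(17)] by simp
  finally have *: "runit C x \<cdot> twist C (x \<otimes> I) \<cdot> ri x = twist C x" .
  show ?thesis
  proof
    assume "twist C (x \<otimes> I) = smult C t (ident C (x \<otimes> I))"
    then show "twist C x = smult C t (ident C x)"
      using * compose_smult_left[OF ident_in_Hom ri_Hom(2)] ident_left[OF ri_Hom(2)]
        compose_smult_right[OF ri_Hom(1) ri_Hom(2)] ri_Hom(4) by simp
  next
    assume "twist C x = smult C t (ident C x)"
    then show "twist C (x \<otimes> I) = smult C t (ident C (x \<otimes> I))"
      using conj_runit_scalar[OF iso_Homs(17)] * by simp
  qed
qed

lemma ident_runit_nonzero: "ident C x \<noteq> 0 \<Longrightarrow> ident C (x \<otimes> I) \<noteq> 0"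
  using ri_Hom compose_zero_left[OF ri_Hom(2)] compose_zero_right[OF ri_Hom(1)] ident_left[OF ri_Hom(2)] by metis

abbreviation sdual_pair where
  "sdual_pair \<equiv> strict_monoidal.dual_pair typed.sarr typed.ssrc typed.strg typed.scomp typed.stens typed.sidt"

lemma sdual_pair_single:
  "sdual_pair [x] [dual C x] (typed.sev x (dual C x) (dual C x \<otimes> x, ev C x, I)) (typed.scoev x (dual C x) (I, coev C x, x \<otimes> dual C x))"
  using left_dual[of x]
  by (intro typed.dual_pair_single) (auto simp: left_duality_def c_defs)

text \<open>Duals of words are assembled letter by letter from the given duals.\<close>

lemma ex_sdual_pair: "\<exists>m e c. sdual_pair l m e c"
proof (induction l)
  case Nil
  have "sdual_pair [] [] (typed.sidt []) (typed.sidt [])"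
    unfolding strict_monoidal.dual_pair_def[OF typed.strict_monoidal]
    using strict_monoidal.arr_idt[OF typed.strict_monoidal] strict_monoidal.src_idt[OF typed.strict_monoidal] strict_monoidal.trg_idt[OF typed.strict_monoidal]
      strict_monoidal.tens_idt[OF typed.strict_monoidal] strict_monoidal.comp_idt_left[OF typed.strict_monoidal] by simp
  then show ?case by blast
next
  case (Cons x l)
  then obtain m e c where "sdual_pair l m e c" by blast
  from strict_monoidal.dual_pair_tens[OF typed.strict_monoidal sdual_pair_single[of x] this]
  have "\<exists>m e c. sdual_pair ([x] @ l) m e c" by (intro exI)
  then show ?case by simp
qed

end

locale char_0_ribbon_fusion_category = ribbon_fusion_category C
  for C :: "('o, 'm::ab_group_add, 'k::{alg_closed_field, field_char_0}, 'z) ribbon_cat_scheme" (structure)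
begin

lemma End_scalar: "simple_object C x \<Longrightarrow> f \<in> Hom C x x \<Longrightarrow> \<exists>a. f = smult C a (ident C x)"
  by (rule End_simple_scalar) (auto intro: alg_closed_imp_poly_has_root)

text \<open>Simple objects are represented by one-letter words over \<open>R\<close>; their
  properties come from those of the letters by conjugation with the right unitor.\<close>

lemma strict_fusion:
  assumes R: "is_Irr C R" and u: "u \<in> R" "isomorphic C u I"
  shows "strict_ribbon_fusion typed.sarr typed.ssrc typed.strg typed.scomp typed.stens typed.sidt typed.sbr typed.sibr typed.stw
    (smult C) smk svec ((\<lambda>x. [x]) ` R) [u]"
proof (intro strict_ribbon_fusion.intro strict_ribbon_fusion_axioms.intro typed.strict_ribbon)
  show "vector_space (smult C)" by unfold_locales
  have simple: "simple_object C x" if "x \<in> R" for x using R that by (auto simp: is_Irr_def)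
  fix x :: "'o list" and y :: "'o list" and z :: "'o list" and v w :: 'm and f g :: "'o list \<times> ('o \<times> 'm \<times> 'o) \<times> 'o list" and a :: 'k
  show "svec (smk x y v) = v" "typed.ssrc (smk x y v) = x" "typed.strg (smk x y v) = y" by (simp_all add: smk_simps)
  show "typed.sarr f \<Longrightarrow> smk (typed.ssrc f) (typed.strg f) (svec f) = f" by (rule smk_svec)
  show "typed.sarr (smk x y 0)" by (simp add: smk_simps zero_in_Hom)
  show "typed.sarr (smk x y v) \<Longrightarrow> typed.sarr (smk x y w) \<Longrightarrow> typed.sarr (smk x y (v + w))" by (simp add: smk_simps add_in_Hom)
  show "typed.sarr (smk x y v) \<Longrightarrow> typed.sarr (smk x y (smult C a v))" by (simp add: smk_simps smult_in_Hom)
  { assume f: "typed.sarr f" "typed.strg f = y" and v: "typed.sarr (smk y z v)"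
    obtain f' where f': "f = smk (typed.ssrc f) y f'" "f' \<in> Hom C (typed.TT (typed.ssrc f)) (typed.TT y)" using sarr_smk[OF f(1)] f(2) by metis
    show "svec (typed.scomp (smk y z (smult C a v)) f) = smult C a (svec (typed.scomp (smk y z v) f))"
      using v by (subst (1 2) f'(1)) (simp add: smk_simps compose_smult_left[OF _ f'(2)])
    assume w: "typed.sarr (smk y z w)"
    show "svec (typed.scomp (smk y z (v + w)) f) = svec (typed.scomp (smk y z v) f) + svec (typed.scomp (smk y z w) f)"
      using v w by (subst (1 2 3) f'(1)) (simp add: smk_simps compose_add_left[OF _ _ f'(2)]) }
  { assume g: "typed.sarr g" "typed.ssrc g = y" and v: "typed.sarr (smk x y v)"
    obtain g' where g': "g = smk y (typed.strg g) g'" "g' \<in> Hom C (typed.TT y) (typed.TT (typed.strg g))" using sarr_smk[OF g(1)] g(2) by metis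
    show "svec (typed.scomp g (smk x y (smult C a v))) = smult C a (svec (typed.scomp g (smk x y v)))"
      using v by (subst (1 2) g'(1)) (simp add: smk_simps compose_smult_right[OF g'(2)])
    assume w: "typed.sarr (smk x y w)"
    show "svec (typed.scomp g (smk x y (v + w))) = svec (typed.scomp g (smk x y v)) + svec (typed.scomp g (smk x y w))"
      using v w by (subst (1 2 3) g'(1)) (simp add: smk_simps compose_add_right[OF g'(2)]) }
  { assume f: "typed.sarr f" and v: "typed.sarr (smk y z v)"
    obtain f' where f': "f = smk (typed.ssrc f) (typed.strg f) f'" "f' \<in> Hom C (typed.TT (typed.ssrc f)) (typed.TT (typed.strg f))"
      using sarr_smk[OF f] by metis
    note v' = v[unfolded smk_simps]
    show "svec (typed.stens (smk y z (smult C a v)) f) = smult C a (svec (typed.stens (smk y z v) f))"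
      by (subst (1 2) f'(1)) (rule svec_stens(2)[OF v' f'(2)])
    assume w: "typed.sarr (smk y z w)"
    show "svec (typed.stens (smk y z (v + w)) f) = svec (typed.stens (smk y z v) f) + svec (typed.stens (smk y z w) f)"
      by (subst (1 2 3) f'(1)) (rule svec_stens(1)[OF v' f'(2) w[unfolded smk_simps]]) }
  { assume g: "typed.sarr g" and v: "typed.sarr (smk x y v)"
    obtain g' where g': "g = smk (typed.ssrc g) (typed.strg g) g'" "g' \<in> Hom C (typed.TT (typed.ssrc g)) (typed.TT (typed.strg g))"
      using sarr_smk[OF g] by metis
    show "svec (typed.stens g (smk x y (smult C a v))) = smult C a (svec (typed.stens g (smk x y v)))"
      by (subst (1 2) g'(1)) (rule svec_stens(3)[OF g'(2) v[unfolded smk_simps]]) }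
  show "finite ((\<lambda>x. [x]) ` R)" using finite_Irr[OF R] by simp
  { assume x: "x \<in> (\<lambda>x. [x]) ` R"
    then obtain x0 where x0: "x = [x0]" "x0 \<in> R" by blast
    show "svec (typed.sidt x) \<noteq> 0"
      using ident_runit_nonzero[OF simple_ident_nonzero[OF simple[OF x0(2)]]] x0 by (simp add: smk_simps)
    show "svec (typed.stw x) \<noteq> 0"
    proof
      assume "svec (typed.stw x) = 0"
      then have "twist C (x0 \<otimes> I) = smult C 0 (ident C (x0 \<otimes> I))" using x0 by (simp add: smk_simps)
      then have "twist C x0 = 0" unfolding twist_scalar_runit by simp
      then obtain t where "t \<in> Hom C x0 x0" "t \<cdot> 0 = ident C x0" using twist_iso[of x0] by (auto simp: iso_arrow_def inverse_arrows_def)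
      then show False using compose_zero_right simple_ident_nonzero[OF simple[OF x0(2)]] by metis
    qed
    \<comment> \<open>The given dual of the letter is used, since \<open>twist_dual\<close> controls
      precisely its twist.\<close>
    show "\<exists>y e c. sdual_pair x y e c \<and> (\<forall>t. svec (typed.stw x) = smult C t (svec (typed.sidt x)) \<longrightarrow>
        svec (typed.stw y) = smult C t (svec (typed.sidt y)))"
    proof (intro exI conjI allI impI)
      show "sdual_pair x [dual C x0] (typed.sev x0 (dual C x0) (dual C x0 \<otimes> x0, ev C x0, I)) (typed.scoev x0 (dual C x0) (I, coev C x0, x0 \<otimes> dual C x0))"
        unfolding x0(1) by (rule sdual_pair_single)
      fix t assume "svec (typed.stw x) = smult C t (svec (typed.sidt x))"
      then have "twist C x0 = smult C t (ident C x0)" using x0 twist_scalar_runit by (simp add: smk_simps)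
      then have "twist C (dual C x0) = smult C t (ident C (dual C x0))" using twist_dual[of x0] dual_arrow_scalar by simp
      then show "svec (typed.stw [dual C x0]) = smult C t (svec (typed.sidt [dual C x0]))"
        using twist_scalar_runit by (simp add: smk_simps)
    qed
    { assume f: "typed.sarr f" "typed.ssrc f = x" "typed.strg f = x"
      obtain v where v: "f = smk x x v" "v \<in> Hom C (x0 \<otimes> I) (x0 \<otimes> I)"
        using sarr_smk[OF f(1)] f(2,3) x0(1) by (metis typed.TT.simps)
      obtain b where "runit C x0 \<cdot> v \<cdot> ri x0 = smult C b (ident C x0)"
        using End_scalar[OF simple[OF x0(2)] conj_runit(1)[OF v(2)]] by blast
      then show "\<exists>a. svec f = smult C a (svec (typed.sidt x))"
        using conj_runit_scalar[OF v(2)] v(1) x0(1) by (auto simp: smk_simps) }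
    assume y: "y \<in> (\<lambda>x. [x]) ` R" "x \<noteq> y" and f: "typed.sarr f" "typed.ssrc f = x" "typed.strg f = y"
    then obtain y0 where y0: "y = [y0]" "y0 \<in> R" by blast
    obtain v where v: "f = smk x y v" "v \<in> Hom C (x0 \<otimes> I) (y0 \<otimes> I)"
      using sarr_smk[OF f(1)] f(2,3) x0(1) y0(1) by (metis typed.TT.simps)
    have "runit C y0 \<cdot> v \<cdot> ri x0 = 0"
    proof (rule ccontr)
      assume "\<not> ?thesis"
      then have "isomorphic C x0 y0"
        using schur_iso[OF simple[OF x0(2)] simple[OF y0(2)] conj_runit(1)[OF v(2)]] by (auto simp: isomorphic_def)
      then show False using R x0 y0 y(2) isomorphic_refl simple unfolding is_Irr_def by metis
    qed
    then have "v = 0" using conj_runit(2)[OF v(2)] compose_zero_left[OF ri_Hom(1)] compose_zero_right[OF ri_Hom(2)] by simp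
    then show "svec f = 0" using v by (simp add: smk_simps) }
  show "[u] \<in> (\<lambda>x. [x]) ` R" using u by simp
  show "\<exists>i i'. typed.sarr i \<and> typed.ssrc i = [u] \<and> typed.strg i = [] \<and> typed.sarr i' \<and> typed.ssrc i' = [] \<and> typed.strg i' = [u] \<and>
    typed.scomp i' i = typed.sidt [u] \<and> typed.scomp i i' = typed.sidt []"
  proof -
    obtain h h' where h: "h \<in> Hom C u I" "h' \<in> Hom C I u" "h' \<cdot> h = ident C u" "h \<cdot> h' = ident C I"
      using u(2) by (auto simp: isomorphic_def iso_arrow_def inverse_arrows_def)
    have "(ri u \<cdot> h') \<cdot> (h \<cdot> runit C u) = ri u \<cdot> (h' \<cdot> h) \<cdot> runit C u"
      using compose_assoc[OF ri_Hom(2) h(2) compose_in_Hom[OF h(1) ri_Hom(1)]] compose_assoc[OF h(2) h(1) ri_Hom(1)] by simp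
    then have 1: "(ri u \<cdot> h') \<cdot> (h \<cdot> runit C u) = ident C (u \<otimes> I)" using h(3) ident_left[OF ri_Hom(1)] ri_Hom(3) by simp
    have "(h \<cdot> runit C u) \<cdot> (ri u \<cdot> h') = h \<cdot> (runit C u \<cdot> ri u) \<cdot> h'"
      using compose_assoc[OF h(1) ri_Hom(1) compose_in_Hom[OF ri_Hom(2) h(2)]] compose_assoc[OF ri_Hom(1) ri_Hom(2) h(2)] by simp
    then have 2: "(h \<cdot> runit C u) \<cdot> (ri u \<cdot> h') = ident C I" using h(4) ident_left[OF h(2)] ri_Hom(4) by simp
    show ?thesis
      using 1 2 compose_in_Hom[OF h(1) ri_Hom(1)] compose_in_Hom[OF ri_Hom(2) h(2)]
      by (intro exI[of _ "smk [u] [] (h \<cdot> runit C u)"] exI[of _ "smk [] [u] (ri u \<cdot> h')"]) (simp add: smk_simps)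
  qed
  show "\<exists>y e c. sdual_pair x y e c" by (rule ex_sdual_pair)
  show "\<exists>(n::nat) r e p. (\<forall>j<n. r j \<in> (\<lambda>x. [x]) ` R \<and> typed.sarr (e j) \<and> typed.ssrc (e j) = r j \<and> typed.strg (e j) = x \<and>
        typed.sarr (p j) \<and> typed.ssrc (p j) = x \<and> typed.strg (p j) = r j) \<and>
      (\<forall>j<n. \<forall>k<n. svec (typed.scomp (p j) (e k)) = (if j = k then svec (typed.sidt (r j)) else 0)) \<and>
      (\<Sum>j<n. svec (typed.scomp (e j) (p j))) = svec (typed.sidt x)"
  proof -
    \<comment> \<open>The object underlying the word is decomposed in \<open>C\<close>; unitors then
      turn its summands into one-letter words.\<close>
    obtain n :: nat and r e p where "(\<forall>j<n. r j \<in> R \<and> e j \<in> Hom C (r j) (typed.TT x) \<and> p j \<in> Hom C (typed.TT x) (r j)) \<and>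
       (\<forall>j<n. \<forall>l<n. p j \<cdot> e l = (if j = l then ident C (r j) else 0)) \<and> (\<Sum>j<n. e j \<cdot> p j) = ident C (typed.TT x)"
      using Irr_decomposition[OF R, of "typed.TT x"] by (elim exE)
    then have r: "\<And>j. j < n \<Longrightarrow> r j \<in> R" and ep: "\<And>j. j < n \<Longrightarrow> e j \<in> Hom C (r j) (typed.TT x)" "\<And>j. j < n \<Longrightarrow> p j \<in> Hom C (typed.TT x) (r j)"
      and orth: "\<And>j l. j < n \<Longrightarrow> l < n \<Longrightarrow> p j \<cdot> e l = (if j = l then ident C (r j) else 0)"
      and compl: "(\<Sum>j<n. e j \<cdot> p j) = ident C (typed.TT x)" by auto
    have 1: "(ri (r j) \<cdot> p j) \<cdot> (e k \<cdot> runit C (r k)) = (if j = k then ident C (r j \<otimes> I) else 0)" if "j < n" "k < n" for j k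
    proof -
      have "(ri (r j) \<cdot> p j) \<cdot> (e k \<cdot> runit C (r k)) = ri (r j) \<cdot> (p j \<cdot> e k) \<cdot> runit C (r k)"
        using compose_assoc[OF ri_Hom(2) ep(2)[OF that(1)] compose_in_Hom[OF ep(1)[OF that(2)] ri_Hom(1)]]
          compose_assoc[OF ep(2)[OF that(1)] ep(1)[OF that(2)] ri_Hom(1)] by simp
      then show ?thesis
        using orth[OF that] ident_left[OF ri_Hom(1)] ri_Hom(3) compose_zero_left[OF ri_Hom(1)] compose_zero_right[OF ri_Hom(2)] by simp
    qed
    have 2: "(e j \<cdot> runit C (r j)) \<cdot> (ri (r j) \<cdot> p j) = e j \<cdot> p j" if "j < n" for j
    proof -
      have "(e j \<cdot> runit C (r j)) \<cdot> (ri (r j) \<cdot> p j) = e j \<cdot> (runit C (r j) \<cdot> ri (r j)) \<cdot> p j"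
        using compose_assoc[OF ep(1)[OF that] ri_Hom(1) compose_in_Hom[OF ri_Hom(2) ep(2)[OF that]]]
          compose_assoc[OF ri_Hom(1) ri_Hom(2) ep(2)[OF that]] by simp
      then show ?thesis using ri_Hom(4) ident_left[OF ep(2)[OF that]] by simp
    qed
    show ?thesis
      using r ep 1 2 compl compose_in_Hom[OF ep(1) ri_Hom(1)] compose_in_Hom[OF ri_Hom(2) ep(2)]
      by (intro exI[of _ n] exI[of _ "\<lambda>j. [r j]"] exI[of _ "\<lambda>j. smk [r j] x (e j \<cdot> runit C (r j))"]
          exI[of _ "\<lambda>j. smk x [r j] (ri (r j) \<cdot> p j)"]) (simp add: smk_simps)
  qed
qed

section \<open>Comparison with the original category\<close>

lemma twist_scalar_eq:
  assumes "simple_object C x" "twist C x = smult C a (ident C x)"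
  shows "twist_scalar C x = a"
  unfolding twist_scalar_def using assms simple_ident_nonzero[OF assms(1)] by (intro the_equality) auto

lemma twist_eq_scalar:
  assumes "simple_object C x"
  shows "twist C x = smult C (twist_scalar C x) (ident C x)"
  using End_scalar[OF assms iso_Homs(17)] twist_scalar_eq[OF assms] by auto

text \<open>The existence statement ranges over all simple objects, the Gauss sums over
  representatives; invariance under isomorphism links them.\<close>

lemma isomorphic_twist_transparent:
  assumes x: "simple_object C x" and y: "simple_object C y" and iso: "isomorphic C x y"
  shows "twist_scalar C x = twist_scalar C y" and "transparent C x \<Longrightarrow> transparent C y"
proof -
  obtain f g where f: "f \<in> Hom C x y" and g: "g \<in> Hom C y x" and gf: "g \<cdot> f = ident C x" and fg: "f \<cdot> g = ident C y"
    using iso by (auto simp: isomorphic_def iso_arrow_def inverse_arrows_def)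
  have "f \<noteq> 0" using gf compose_zero_right[OF g] simple_ident_nonzero[OF x] by auto
  moreover have "smult C (twist_scalar C y) f = smult C (twist_scalar C x) f"
    using twist_natural[OF f] twist_eq_scalar[OF x] twist_eq_scalar[OF y] ident_left[OF f] ident_right[OF f]
      compose_smult_left[OF ident_in_Hom f] compose_smult_right[OF f ident_in_Hom] by simp
  ultimately show "twist_scalar C x = twist_scalar C y" using scale_right_imp_eq by metis
  assume t: "transparent C x"
  show "transparent C y"
    unfolding transparent_def
  proof
    fix z
    have "ccomp (cbr z y) (cbr y z) = cidt (y \<otimes> z)"
      using t f g gf fg
      by (intro typed.br_br_iso[of z x "(x, f, y)" y "(y, g, x)" "cidt z" z "cidt z"])
        (auto simp: transparent_def c_defs ident_in_Hom ident_left[OF ident_in_Hom])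
    then show "braid C z y \<cdot> braid C y z = ident C (y \<otimes> z)" by (simp add: c_defs)
  qed
qed

theorem gauss_sums_vanish:
  assumes R: "is_Irr C R"
  shows "(\<exists>x. simple_object C x \<and> transparent C x \<and> twist_scalar C x \<noteq> 1) \<longleftrightarrow> gauss_plus C R = 0"
    and "(\<exists>x. simple_object C x \<and> transparent C x \<and> twist_scalar C x \<noteq> 1) \<longleftrightarrow> gauss_minus C R = 0"
proof -
  \<comment> \<open>\<open>R\<close> need not contain the unit object itself, only a representative
    of its class.\<close>
  obtain u where u: "u \<in> R" "isomorphic C u I"
    using R simple_unit isomorphic_sym unfolding is_Irr_def by metis
  interpret S: strict_ribbon_fusion typed.sarr typed.ssrc typed.strg typed.scomp typed.stens typed.sidt typed.sbr typed.sibr typed.stw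
    "smult C" smk svec "(\<lambda>x. [x]) ` R" "[u]"
    by (rule strict_fusion[OF R u])
  have simple: "simple_object C x" if "x \<in> R" for x using R that by (auto simp: is_Irr_def)
  have \<theta>: "S.\<theta> [x] = twist_scalar C x" if x: "x \<in> R" for x
  proof -
    have "svec (typed.stw [x]) = smult C (S.\<theta> [x]) (svec (typed.sidt [x]))"
      using S.tw_eq[of "[x]"] x by simp
    then have "twist C x = smult C (S.\<theta> [x]) (ident C x)"
      using twist_scalar_runit by (simp add: smk_simps)
    from twist_scalar_eq[OF simple[OF x] this] show ?thesis by simp
  qed
  \<comment> \<open>The dual pair built from \<open>ev\<close> and \<open>coev\<close> computes
    \<open>S.d\<close>, and \<open>strace_single\<close> recognises its loop as
    \<open>unknot\<close>.\<close>
  have d: "S.d [x] = quantum_dim C x" for x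
  proof -
    let ?e = "(dual C x \<otimes> x, ev C x, I)" and ?c = "(I, coev C x, x \<otimes> dual C x)"
    have ec: "ev C x \<in> Hom C (dual C x \<otimes> x) I" "coev C x \<in> Hom C I (x \<otimes> dual C x)"
      using left_dual[of x] by (auto simp: left_duality_def)
    note dp = sdual_pair_single[of x]
    note dpD = S.dual_pairD(4-6)[OF dp]
    have "typed.scomp (S.tev [x] [dual C x] (typed.sev x (dual C x) ?e)) (typed.scoev x (dual C x) ?c) = S.sm (S.d [x]) (typed.sidt [])"
      using S.T_eq[OF dp, of "typed.sidt [x]"] dpD by (simp add: S.d_def)
    moreover have "typed.scomp (S.tev [x] [dual C x] (typed.sev x (dual C x) ?e)) (typed.scoev x (dual C x) ?c) = ([], (I, unknot C x, I), [])"
      using typed.strace_single[of ?e "dual C x" x ?c] ec by (simp add: c_defs unknot_def)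
    ultimately have "svec ([], (I, unknot C x, I), []) = svec (S.sm (S.d [x]) (typed.sidt []))" by simp
    then have "unknot C x = smult C (S.d [x]) (ident C I)"
      unfolding S.sm_simps by (simp add: smk_simps) (simp add: svec_def)
    then show ?thesis
      unfolding quantum_dim_def using simple_ident_nonzero[OF simple_unit] by (intro the_equality[symmetric]) auto
  qed
  have t: "S.is_transparent [x] \<longleftrightarrow> transparent C x" for x
    unfolding typed.is_transparent_single transparent_def by (simp add: c_defs)
  have gp: "S.gp = gauss_plus C R"
    unfolding S.gp_def gauss_plus_def by (subst sum.reindex) (auto simp: \<theta> d inj_on_def)
  have gm: "S.gm = gauss_minus C R"
    unfolding S.gm_def gauss_minus_def by (subst sum.reindex) (auto simp: \<theta> d inj_on_def)
  have "(\<exists>x. simple_object C x \<and> transparent C x \<and> twist_scalar C x \<noteq> 1) \<longleftrightarrow>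
      (\<exists>x\<in>R. transparent C x \<and> twist_scalar C x \<noteq> 1)"
  proof
    assume "\<exists>x. simple_object C x \<and> transparent C x \<and> twist_scalar C x \<noteq> 1"
    then obtain x where x: "simple_object C x" "transparent C x" "twist_scalar C x \<noteq> 1" by blast
    then obtain y where y: "y \<in> R" "isomorphic C x y" using R unfolding is_Irr_def by metis
    then show "\<exists>x\<in>R. transparent C x \<and> twist_scalar C x \<noteq> 1"
      using isomorphic_twist_transparent[OF x(1) simple[OF y(1)] y(2)] x by metis
  qed (use simple in blast)
  also have "\<dots> \<longleftrightarrow> (\<exists>i\<in>(\<lambda>x. [x]) ` R. S.is_transparent i \<and> S.\<theta> i \<noteq> 1)"
    by (auto simp: t \<theta>)
  finally show "(\<exists>x. simple_object C x \<and> transparent C x \<and> twist_scalar C x \<noteq> 1) \<longleftrightarrow> gauss_plus C R = 0"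
    "(\<exists>x. simple_object C x \<and> transparent C x \<and> twist_scalar C x \<noteq> 1) \<longleftrightarrow> gauss_minus C R = 0"
    using S.gauss_sums unfolding gp gm by simp_all
qed

end

theorem corollary4p12:
  fixes C :: "('o, 'm::ab_group_add, 'k::{alg_closed_field, field_char_0}) ribbon_cat"
    and Irr :: "'o set"
  assumes "ribbon_fusion_category C"
    and "is_Irr C Irr"
  shows "((\<exists>x. simple_object C x \<and> transparent C x \<and> twist_scalar C x \<noteq> 1) \<longleftrightarrow>
            gauss_plus C Irr = 0 \<or> gauss_minus C Irr = 0) \<and>
         (gauss_plus C Irr = 0 \<longleftrightarrow> gauss_minus C Irr = 0)"
proof -
  interpret char_0_ribbon_fusion_category C
    using assms(1) by (rule char_0_ribbon_fusion_category.intro)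
  show ?thesis using gauss_sums_vanish[OF assms(2)] by blast
qed

end
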